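(* Let $\epsilon_n\ge0$ with $\epsilon_n\to0$. For each $n$ and $\vec w\in\mathcal{W}^n$ let $\hat x^n(\vec w)=(\hat x^n_1(\vec w),\dots,\hat x^n_n(\vec w))$ be an $\epsilon_n$-Nash equilibrium with type vector $\vec w$, each $\hat x^n_i$ universally measurable. Let $\vec W^n=(W^n_1,\dots,W^n_n)$ be a $\mathcal{W}^n$-valued random vector and set $\mu_n=\frac1n\sum_{i=1}^n\delta_{(W^n_i,\hat x^n_i(\vec W^n))}$, $\mu^w_n=\frac1n\sum_{i=1}^n\delta_{W^n_i}$. Then: (i) If the sequence (of laws of) $\{\mu^w_n\}$ is tight, then so is $\{\mu_n\}$, and every subsequential limit in distribution $\mu$ of $\{\mu_n\}$ satisfies $\mu\in\mathcal{M}(\mu^w)$ almost surely. (ii) If $\mu^w_n\to\lambda_0$ in distribution with $\lambda_0\in\mathcal{P}(\mathcal{W})$ deterministic, then every subsequential limit in distribution of $\{\mu_n\}$ is supported on $\mathcal{M}(\lambda_0)$; in particular $\lim_{n\to\infty}\mathbb{P}(d(\mu_n,\mathcal{M}(\lambda_0))\ge\epsilon)=0$ for every $\epsilon>0$ and every metric $d$ on $\mathcal{P}(\mathcal{W}\times\mathcal{X})$ compatible with weak convergence. (iii) If, for each $n$, $W^n_1,\dots,W^n_n$ are i.i.d. with distribution $\lambda_0\in\mathcal{P}(\mathcal{W})$, then $d(\mu_n,\mathcal{M}(\lambda_0))\to0$ almost surely, for $d$ as in (ii).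
   Context: Standing assumptions: $\mathcal{X}$ compact metric space, $\mathcal{W}$ complete separable metric space; $\mathcal{P}(S)$ = Borel probability measures on $S$ with the weak topology. $\mathcal{C}$ maps $w$ to a nonempty closed $\mathcal{C}(w)\subset\mathcal{X}$, continuous in the sense that $\mathrm{Gr}(\mathcal{C})=\{(w,x):x\in\mathcal{C}(w)\}$ is closed and whenever $w_n\to w$, $x\in\mathcal{C}(w)$ there exist $n_k$, $x_{n_k}\in\mathcal{C}(w_{n_k})$ with $x_{n_k}\to x$. $F:\mathcal{P}(\mathcal{W}\times\mathcal{X})\times\mathcal{W}\times\mathcal{X}\to\mathbb{R}$ bounded continuous. For $\epsilon\ge0$, an $\epsilon$-Nash equilibrium with type vector $(w_1,\dots,w_n)$ is $(x_1,\dots,x_n)$ with $x_i\in\mathcal{C}(w_i)$ and, writing $m=\frac1n\sum_k\delta_{(w_k,x_k)}$, $F(m,w_i,x_i)-\inf_{y\in\mathcal{C}(w_i)}F(m+\frac1n(\delta_{(w_i,y)}-\delta_{(w_i,x_i)}),w_i,y)\le\epsilon$ for all $i$. $m^w$ = first marginal of $m$. $\mathcal{M}(\lambda)$ = set of $m$ with $m^w=\lambda$ such that for $m$-a.e. $(w,x)$, $x\in\mathcal{C}(w)$ and $F(m,w,x)=\inf_{y\in\mathcal{C}(w)}F(m,w,y)$. $d(\mu,S)=\inf_{m\in S}d(\mu,m)$. *)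

theory Defs
  imports "HOL-Probability.Probability"
begin

definition probs :: "'a::topological_space measure set" where
  "probs = {m. prob_space m \<and> sets m = sets borel}"

definition wk_conv :: "(nat \<Rightarrow> 'a::topological_space measure) \<Rightarrow> 'a measure \<Rightarrow> bool" where
  "wk_conv mu m \<longleftrightarrow>
     (\<forall>f :: 'a \<Rightarrow> real. continuous_on UNIV f \<and> bounded (range f) \<longrightarrow>
        (\<lambda>n. integral\<^sup>L (mu n) f) \<longlonglongrightarrow> integral\<^sup>L m f)"

text \<open>Continuity of a real function on P(S) w.r.t. the weak topology
  (sequential; the weak topology is metrizable).\<close>
definition wcont :: "('a::topological_space measure \<Rightarrow> real) \<Rightarrow> bool" where
  "wcont \<Phi> \<longleftrightarrow> (\<forall>mu m. (\<forall>n. mu n \<in> probs) \<longrightarrow> m \<in> probs \<longrightarrow> wk_conv mu m \<longrightarrow>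
                     (\<lambda>n. \<Phi> (mu n)) \<longlonglongrightarrow> \<Phi> m)"

text \<open>Compact subsets of P(S) in the weak topology (sequential compactness; metrizable).\<close>
definition wcompact :: "'a::topological_space measure set \<Rightarrow> bool" where
  "wcompact S \<longleftrightarrow> S \<subseteq> probs \<and>
     (\<forall>mu :: nat \<Rightarrow> 'a measure. (\<forall>n. mu n \<in> S) \<longrightarrow> (\<exists>r m. strict_mono r \<and> m \<in> S \<and> wk_conv (mu \<circ> r) m))"

text \<open>Laws of random elements of P(S) are probability measures on the measurable space
  \<open>prob_algebra borel\<close> (whose space is exactly P(S)).\<close>
definition law_conv :: "(nat \<Rightarrow> 'a::topological_space measure measure) \<Rightarrow> 'a measure measure \<Rightarrow> bool" where
  "law_conv Q Q0 \<longleftrightarrow> prob_space Q0 \<and> sets Q0 = sets (prob_algebra borel) \<and>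
     (\<forall>\<Phi>. wcont \<Phi> \<and> bounded (\<Phi> ` probs) \<longrightarrow>
        (\<lambda>n. \<integral>m. \<Phi> m \<partial>Q n) \<longlonglongrightarrow> (\<integral>m. \<Phi> m \<partial>Q0))"

definition tight_laws :: "(nat \<Rightarrow> 'a::topological_space measure measure) \<Rightarrow> bool" where
  "tight_laws Q \<longleftrightarrow> (\<forall>e>0. \<exists>Kc. wcompact Kc \<and> Kc \<in> sets (prob_algebra borel) \<and>
                         (\<forall>n. measure (Q n) Kc \<ge> 1 - e))"

definition empirical :: "nat \<Rightarrow> (nat \<Rightarrow> 'a::topological_space) \<Rightarrow> 'a measure" where
  "empirical n z = distr (uniform_count_measure {..<n}) borel z"

text \<open>epsilon-Nash equilibrium with type vector w (coordinates i < n).  The measure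
  m + (1/n)(delta_(w_i,y) - delta_(w_i,x_i)) is the empirical measure of the profile
  where x_i is replaced by y.\<close>
definition nash_eq :: "('w::topological_space \<Rightarrow> 'x::topological_space set) \<Rightarrow>
    (('w \<times> 'x) measure \<Rightarrow> 'w \<Rightarrow> 'x \<Rightarrow> real) \<Rightarrow> real \<Rightarrow> nat \<Rightarrow> (nat \<Rightarrow> 'w) \<Rightarrow> (nat \<Rightarrow> 'x) \<Rightarrow> bool" where
  "nash_eq C F e n w x \<longleftrightarrow> (\<forall>i<n. x i \<in> C (w i)) \<and>
     (\<forall>i<n. F (empirical n (\<lambda>k. (w k, x k))) (w i) (x i)
            - (INF y\<in>C (w i). F (empirical n (\<lambda>k. (w k, (x(i := y)) k))) (w i) y) \<le> e)"

definition Meq :: "('w::topological_space \<Rightarrow> 'x::topological_space set) \<Rightarrow>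
    (('w \<times> 'x) measure \<Rightarrow> 'w \<Rightarrow> 'x \<Rightarrow> real) \<Rightarrow> 'w measure \<Rightarrow> ('w \<times> 'x) measure set" where
  "Meq C F lam = {m \<in> probs. distr m borel fst = lam \<and>
     (AE z in m. snd z \<in> C (fst z) \<and> F m (fst z) (snd z) = (INF y\<in>C (fst z). F m (fst z) y))}"

definition univ_meas :: "'a measure \<Rightarrow> ('a \<Rightarrow> 'b) \<Rightarrow> 'b measure \<Rightarrow> bool" where
  "univ_meas A f B \<longleftrightarrow> (\<forall>\<mu>. prob_space \<mu> \<and> sets \<mu> = sets A \<longrightarrow> f \<in> measurable (completion \<mu>) B)"

definition compat_metric :: "('a::topological_space measure \<Rightarrow> 'a measure \<Rightarrow> real) \<Rightarrow> bool" where
  "compat_metric d \<longleftrightarrow>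
     (\<forall>a\<in>probs. \<forall>b\<in>probs. d a b \<ge> 0 \<and> (d a b = 0 \<longleftrightarrow> a = b) \<and> d a b = d b a) \<and>
     (\<forall>a\<in>probs. \<forall>b\<in>probs. \<forall>c\<in>probs. d a c \<le> d a b + d b c) \<and>
     (\<forall>mu m. (\<forall>n. mu n \<in> probs) \<longrightarrow> m \<in> probs \<longrightarrow>
        ((\<lambda>n. d (mu n) m) \<longlonglongrightarrow> 0 \<longleftrightarrow> wk_conv mu m))"

end

(* Put G(m) = integral of min 1 (dist(z, Gr C)) + |F(m,w,x) - inf_y F(m,w,y)| against m(dz),
   z = (w,x).  By Berge's theorem G is a bounded weakly continuous function, and G(m) = 0 exactly when m lies
   in M(m^w).  Moving one player changes the empirical measure by at most 2/n in total variation, so G tends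
   to 0 along weakly convergent empirical measures of eps_n-equilibria.  As X is compact, convergence of the
   W-marginals suffices for relative compactness (Le Cam and Prokhorov), so G(mu_n), and the distance to
   M(lambda), tend to 0 along every path on which the type distributions converge to lambda.  Part (i) tests
   a limit law against G, with the relevant marginals confined to a compact set; part (ii) passes to an
   almost surely convergent subsequence; part (iii) uses Hoeffding and Borel-Cantelli, as the rows of the array are not
   assumed to be related. *)

theory Submission
  imports Defs
begin

section \<open>Weak convergence through countably many test functions\<close>

text \<open>The bound \<open>2/n\<close> on the effect of a deviation gives no uniform bound on
  payoffs: \<open>F\<close> is merely continuous and P(W x X) need not be compact. What survives is
  continuous convergence: the payoff errors vanish whenever measures, types and strategies converge
  along a sequence. So integrals occur in which measure and integrand vary together, and the error,
  a supremum over uncountably many deviations, may fail to be measurable. A Lipschitz envelope that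
  dominates all late errors removes both difficulties. The weak topology is handled through
  countably many rational hat functions centred at a dense sequence. They turn a measure into a
  point of a countable product of real lines, which yields measurability of weakly continuous
  functions and one null set for all test functions. The limit measure in Prokhorov's theorem is the
  law of an explicit random variable on \<open>[0,1)\<close>: points are coded by bits, the
  probabilities of finite bit patterns converge along a subsequence, and a random bit sequence with
  the limit probabilities is decoded.\<close>

lemma probsD:
  assumes "m \<in> probs"
  shows "prob_space m" "sets m = sets borel" "space m = UNIV"
  using assms sets_eq_imp_space_eq[of m borel] by (auto simp: probs_def)

lemma space_prob_algebra_borel: "space (prob_algebra borel) = probs"
  by (auto simp: space_prob_algebra probs_def)

lemma wk_convD:
  assumes "wk_conv mu m" "continuous_on UNIV f" "\<And>x. \<bar>f x\<bar> \<le> (B::real)"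
  shows "(\<lambda>n. integral\<^sup>L (mu n) f) \<longlonglongrightarrow> integral\<^sup>L m f"
  using assms unfolding wk_conv_def by (auto simp: bounded_iff)

lemma wk_conv_compose:
  assumes "wk_conv mu m" "filterlim r sequentially sequentially"
  shows "wk_conv (\<lambda>n. mu (r n)) m"
  using assms(1) filterlim_compose[OF _ assms(2)] unfolding wk_conv_def by fast

lemma borel_measurable_probs:
  assumes "m \<in> probs" "f \<in> borel_measurable borel"
  shows "f \<in> borel_measurable m"
  using assms(2) by (simp add: measurable_cong_sets[OF probsD(2)[OF assms(1)] refl])

lemma integrable_bounded_probs:
  fixes f :: "'a::topological_space \<Rightarrow> real"
  assumes "m \<in> probs" "f \<in> borel_measurable borel" "\<And>x. \<bar>f x\<bar> \<le> B"
  shows "integrable m f"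
proof -
  interpret prob_space m using assms(1) by (simp add: probsD)
  show ?thesis
    by (rule integrable_const_bound[where B=B])
       (use assms(3) borel_measurable_probs[OF assms(1,2)] in auto)
qed

lemma integral_const_probs: "m \<in> probs \<Longrightarrow> integral\<^sup>L m (\<lambda>_. c::real) = c"
  using probsD[of m] prob_space.prob_space[of m] by simp

section \<open>Dense sequences and Borel measurability\<close>

definition dense_seq :: "(nat \<Rightarrow> 'a::metric_space) \<Rightarrow> bool" where
  "dense_seq s \<longleftrightarrow> (\<forall>x. \<forall>e>0. \<exists>i. dist x (s i) < e)"

lemma dense_seqD: "dense_seq s \<Longrightarrow> e > 0 \<Longrightarrow> \<exists>i. dist x (s i) < e"
  unfolding dense_seq_def by blast

lemma ex_dense_seq_second_countable:
  "\<exists>s :: nat \<Rightarrow> 'a::{metric_space,second_countable_topology}. dense_seq s"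
proof -
  obtain D :: "'a set" where D: "countable D" "\<And>X. open X \<Longrightarrow> X \<noteq> {} \<Longrightarrow> \<exists>d\<in>D. d \<in> X"
    using countable_dense_setE by blast
  then have ne: "D \<noteq> {}" using D(2)[OF open_UNIV] by auto
  show ?thesis unfolding dense_seq_def
  proof (intro exI[of _ "from_nat_into D"] allI impI)
    fix x :: 'a and e :: real assume "e > 0"
    then obtain d where "d \<in> D" "d \<in> ball x e" using D(2)[of "ball x e"] by fastforce
    then show "\<exists>i. dist x (from_nat_into D i) < e"
      using from_nat_into_surj[OF D(1), of d] by auto
  qed
qed

text \<open>Finite \<open>1/(n+1)\<close>-nets, collected over all \<open>n\<close>, are dense. The
  strategy type is a metric space with compact universe, so its separability has to be extracted
  from total boundedness.\<close>

lemma ex_dense_seq_compact: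
  assumes "compact (UNIV :: 'a::metric_space set)"
  shows "\<exists>s :: nat \<Rightarrow> 'a. dense_seq s"
proof -
  have "\<forall>n. \<exists>k. finite k \<and> UNIV \<subseteq> (\<Union>x\<in>k. ball x (1 / real (Suc n)) :: 'a set)"
    using assms unfolding compact_eq_totally_bounded by simp
  then obtain k where k: "\<And>n. finite (k n)" "\<And>n. UNIV \<subseteq> (\<Union>x\<in>k n. ball x (1 / real (Suc n)) :: 'a set)"
    unfolding choice_iff by blast
  let ?D = "\<Union>n. k n"
  have c: "countable ?D" using k(1) by (simp add: countable_finite)
  show ?thesis unfolding dense_seq_def
  proof (intro exI[of _ "from_nat_into ?D"] allI impI)
    fix x :: 'a and e :: real assume "e > 0"
    then obtain n where n: "1 / real (Suc n) < e" using nat_approx_posE by auto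
    obtain d where "d \<in> k n" "dist d x < 1 / real (Suc n)" using k(2)[of n] by fastforce
    then have d: "d \<in> ?D" "dist x d < e" using n by (auto simp: dist_commute)
    obtain i where "from_nat_into ?D i = d" using from_nat_into_surj[OF c d(1)] ..
    with d(2) show "\<exists>i. dist x (from_nat_into ?D i) < e" by blast
  qed
qed

lemma ex_dense_seq_prod:
  assumes "dense_seq (s :: nat \<Rightarrow> 'a::metric_space)" "dense_seq (t :: nat \<Rightarrow> 'b::metric_space)"
  shows "\<exists>u :: nat \<Rightarrow> 'a \<times> 'b. dense_seq u"
  unfolding dense_seq_def
proof (intro exI[of _ "\<lambda>n. (s (fst (prod_decode n)), t (snd (prod_decode n)))"] allI impI)
  fix x :: "'a \<times> 'b" and e :: real assume "e > 0"
  then have "e / 2 > 0" by simp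
  then obtain i j where "dist (fst x) (s i) < e/2" "dist (snd x) (t j) < e/2"
    using dense_seqD[OF assms(1)] dense_seqD[OF assms(2)] by blast
  moreover have "dist x (s i, t j) \<le> dist (fst x) (s i) + dist (snd x) (t j)"
    using sqrt_sum_squares_le_sum[of "dist (fst x) (s i)" "dist (snd x) (t j)"]
    by (simp add: dist_prod_def)
  ultimately have "dist x (s i, t j) < e" by linarith
  then show "\<exists>n. dist x (s (fst (prod_decode n)), t (snd (prod_decode n))) < e"
    by (intro exI[of _ "prod_encode (i, j)"]) simp
qed

text \<open>An open set is the union of the countably many balls of radius \<open>1/(k+1)\<close>
  about dense points that it contains, so its preimage is built from sublevel sets of the distance
  functions. This does the work of second countability for pairs of a type and a strategy.\<close>

lemma measurable_borel_dense_seq: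
  fixes s :: "nat \<Rightarrow> 'b::metric_space"
  assumes s: "dense_seq s" and f: "\<And>i. (\<lambda>x. dist (f x) (s i)) \<in> borel_measurable M"
  shows "f \<in> borel_measurable M"
proof (rule borel_measurableI)
  fix S :: "'b set" assume S: "open S"
  let ?I = "{(i :: nat, k :: nat). ball (s i) (1 / real (Suc k)) \<subseteq> S}"
  have "f -` S \<inter> space M = (\<Union>(i,k)\<in>?I. {x \<in> space M. dist (f x) (s i) < 1 / real (Suc k)})"
  proof (intro set_eqI iffI)
    fix x assume x: "x \<in> f -` S \<inter> space M"
    then obtain e where e: "e > 0" "ball (f x) e \<subseteq> S" using S open_contains_ball by blast
    then obtain k where k: "1 / real (Suc k) < e / 2" using nat_approx_posE[of "e/2"] by auto
    obtain i where i: "dist (f x) (s i) < 1 / real (Suc k)"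
      using dense_seqD[OF s, of "1 / real (Suc k)"] by auto
    have "ball (s i) (1 / real (Suc k)) \<subseteq> ball (f x) e"
    proof
      fix y assume "y \<in> ball (s i) (1 / real (Suc k))"
      then show "y \<in> ball (f x) e" using i k dist_triangle[of "f x" y "s i"] by (simp add: dist_commute)
    qed
    then show "x \<in> (\<Union>(i,k)\<in>?I. {x \<in> space M. dist (f x) (s i) < 1 / real (Suc k)})"
      using i x e by auto
  qed (auto simp: dist_commute subset_iff)
  also have "\<dots> \<in> sets M"
    using f by (intro sets.countable_UN'') (auto simp: borel_measurable_iff_less)
  finally show "f -` S \<inter> space M \<in> sets M" .
qed

lemma measurable_Pair_borel:
  fixes s :: "nat \<Rightarrow> 'a::metric_space \<times> 'b::metric_space" and f :: "'c \<Rightarrow> 'a" and g :: "'c \<Rightarrow> 'b"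
  assumes "dense_seq s" "f \<in> borel_measurable M" "g \<in> borel_measurable M"
  shows "(\<lambda>x. (f x, g x)) \<in> borel_measurable M"
proof (rule measurable_borel_dense_seq[OF assms(1)])
  fix i
  have "(\<lambda>y. dist y a) \<in> borel_measurable borel" for a :: 'a
    by (intro borel_measurable_continuous_onI continuous_intros)
  note [measurable] = measurable_compose[OF assms(2) this]
  have "(\<lambda>y. dist y a) \<in> borel_measurable borel" for a :: 'b
    by (intro borel_measurable_continuous_onI continuous_intros)
  note [measurable] = measurable_compose[OF assms(3) this]
  show "(\<lambda>x. dist (f x, g x) (s i)) \<in> borel_measurable M"
    unfolding dist_prod_def by simp
qed

text \<open>A finite maximum of rational multiples of hats. Lists of triples form a countable type,
  so one null set serves all tents; the base value \<open>0\<close> keeps every tent nonnegative,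
  even where a coefficient is negative.\<close>

fun tent :: "(nat \<Rightarrow> 'a::metric_space) \<Rightarrow> (nat \<times> rat \<times> nat) list \<Rightarrow> 'a \<Rightarrow> real" where
  "tent s [] x = 0"
| "tent s ((i, q, k) # l) x = max (tent s l x) (of_rat q * max 0 (1 - real k * dist x (s i)))"

lemma tent_nonneg: "0 \<le> tent s l x"
  by (induction s l x rule: tent.induct) auto

lemma continuous_tent: "continuous_on UNIV (tent s l)"
proof (induction l)
  case Nil
  then show ?case by (simp add: continuous_on_const)
next
  case (Cons a l)
  then show ?case by (cases a) (auto intro!: continuous_intros)
qed

lemma tent_bounded: "\<exists>B. \<forall>x. \<bar>tent s l x\<bar> \<le> B"
proof (induction l)
  case (Cons a l)
  obtain i q k where a: "a = (i, q, k)" by (cases a)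
  from Cons obtain B where B: "\<And>x. \<bar>tent s l x\<bar> \<le> B" by auto
  have *: "\<bar>real_of_rat q * max 0 (1 - real k * dist x (s i))\<bar> \<le> \<bar>real_of_rat q\<bar> * 1" for x
    unfolding abs_mult by (intro mult_left_mono) auto
  have "\<bar>tent s (a # l) x\<bar> \<le> B + \<bar>real_of_rat q\<bar>" for x
    using B[of x] *[of x] unfolding a tent.simps by linarith
  then show ?case by blast
qed auto

lemma borel_tent: "tent s l \<in> borel_measurable borel"
  by (intro borel_measurable_continuous_onI continuous_tent)

lemma tent_le:
  assumes "\<And>x. 0 \<le> f x"
    "\<And>i q k x. (i, q, k) \<in> set l \<Longrightarrow> real_of_rat q * max 0 (1 - real k * dist x (s i)) \<le> f x"
  shows "tent s l x \<le> f x"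
  using assms(2)
proof (induction l)
  case (Cons a l)
  then show ?case by (cases a) fastforce
qed (use assms in auto)

lemma tent_ge:
  "(i, q, k) \<in> set l \<Longrightarrow> real_of_rat q * max 0 (1 - real k * dist x (s i)) \<le> tent s l x"
  by (induction s l x rule: tent.induct) (auto simp: le_max_iff_disj)

text \<open>A lower semicontinuous function is the supremum of the rational hat functions below it.\<close>

lemma tent_approx:
  fixes f :: "'a::metric_space \<Rightarrow> real" and s :: "nat \<Rightarrow> 'a"
  assumes s: "dense_seq s" and f0: "\<And>x. 0 \<le> f x" and lsc: "\<And>c. open {x. c < f x}"
  shows "\<exists>L. (\<forall>n x. tent s (L n) x \<le> f x) \<and> (\<forall>x. (\<lambda>n. tent s (L n) x) \<longlonglongrightarrow> f x)"
proof -
  define G where "G = {(i, q, k). \<forall>x. real_of_rat q * max 0 (1 - real k * dist x (s i)) \<le> f x}"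
  \<comment> \<open>\<open>L n\<close> keeps the admissible hats among the first \<open>n\<close>
    codes, so a hat once listed bounds all later tents from below.\<close>
  define L :: "nat \<Rightarrow> (nat \<times> rat \<times> nat) list" where
    "L n = filter (\<lambda>t. t \<in> G) (map from_nat [0..<n])" for n
  have le: "tent s (L n) x \<le> f x" for n x
    by (rule tent_le) (auto simp: f0 L_def G_def)
  have "(\<lambda>n. tent s (L n) x) \<longlonglongrightarrow> f x" for x
  proof (rule LIMSEQ_I)
    fix e :: real assume e: "e > 0"
    have "\<exists>N. \<forall>n\<ge>N. tent s (L n) x > f x - e"
    proof (cases "f x - e < 0")
      case True
      then show ?thesis using tent_nonneg[of s _ x] by (meson less_le_trans)
    next
      case False
      then obtain q where q: "f x - e < real_of_rat q" "real_of_rat q < f x"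
        using of_rat_dense[of "f x - e" "f x"] e by auto
      have qp: "real_of_rat q > 0" using False q by linarith
      have "open {y. real_of_rat q < f y}" "x \<in> {y. real_of_rat q < f y}" using lsc q by auto
      then obtain d where d: "d > 0" "\<And>y. dist y x < d \<Longrightarrow> real_of_rat q < f y"
        unfolding open_dist by auto
      obtain k where k: "1 / real (Suc k) < d / 2" using nat_approx_posE[of "d/2"] d by auto
      \<comment> \<open>A hat of height \<open>q\<close> and slope \<open>q * Suc k\<close> is still
        above \<open>f x - e\<close> at distance less than \<open>\<eta>\<close> from its centre.
        The other bound \<open>d/2\<close> keeps its support within \<open>d\<close> of
        \<open>x\<close>, where \<open>f\<close> exceeds \<open>q\<close>.\<close>
      define \<eta> where "\<eta> = (real_of_rat q - (f x - e)) / (real_of_rat q * real (Suc k))"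
      have "min \<eta> (d/2) > 0" using q qp d unfolding \<eta>_def by (auto intro!: divide_pos_pos mult_pos_pos)
      then obtain i where i: "dist x (s i) < min \<eta> (d/2)" using dense_seqD[OF s] by blast
      have "(i, q, Suc k) \<in> G" unfolding G_def
      proof (clarify)
        fix y
        show "real_of_rat q * max 0 (1 - real (Suc k) * dist y (s i)) \<le> f y"
        proof (cases "dist y (s i) < 1 / real (Suc k)")
          case True
          then have "dist y x < d" using i k dist_triangle[of y x "s i"] by (simp add: dist_commute)
          moreover have "real_of_rat q * max 0 (1 - real (Suc k) * dist y (s i)) \<le> real_of_rat q * 1"
            using qp by (intro mult_left_mono) (auto simp del: of_nat_Suc)
          ultimately show ?thesis using d(2) by fastforce
        next
          case False
          then have "1 - real (Suc k) * dist y (s i) \<le> 0" by (simp add: field_simps)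
          then show ?thesis using f0 by (simp add: max_def del: of_nat_Suc)
        qed
      qed
      moreover obtain N where N: "from_nat N = (i, q, Suc k)" by (metis surj_from_nat surjD)
      ultimately have "(i, q, Suc k) \<in> set (L n)" if "n \<ge> Suc N" for n
        using that unfolding L_def by (auto intro!: image_eqI[of _ _ N])
      from tent_ge[OF this] have "tent s (L n) x \<ge> real_of_rat q * max 0 (1 - real (Suc k) * dist x (s i))"
        if "n \<ge> Suc N" for n using that .
      moreover have "real_of_rat q * max 0 (1 - real (Suc k) * dist x (s i)) > f x - e"
      proof -
        have "dist x (s i) * (real_of_rat q * real (Suc k)) < real_of_rat q - (f x - e)"
          using i qp by (simp add: \<eta>_def pos_less_divide_eq del: of_nat_Suc)
        then have "f x - e < real_of_rat q * (1 - real (Suc k) * dist x (s i))"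
          by (simp add: algebra_simps)
        also have "\<dots> \<le> real_of_rat q * max 0 (1 - real (Suc k) * dist x (s i))"
          using qp by (intro mult_left_mono) auto
        finally show ?thesis .
      qed
      ultimately show ?thesis by (meson less_le_trans)
    qed
    then show "\<exists>N. \<forall>n\<ge>N. norm (tent s (L n) x - f x) < e"
      using le e by (metis abs_diff_less_iff add.commute le_less_trans less_add_same_cancel1 real_norm_def)
  qed
  with le show ?thesis by blast
qed

lemma borel_measurable_lsc:
  fixes f :: "'a::topological_space \<Rightarrow> real"
  assumes "\<And>c. open {x. c < f x}"
  shows "f \<in> borel_measurable borel"
  using assms by (auto simp: borel_measurable_iff_greater)

lemma integral_tent_tendsto:
  fixes f :: "'a::metric_space \<Rightarrow> real" and s :: "nat \<Rightarrow> 'a"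
  assumes m: "m \<in> probs" and lsc: "\<And>c. open {x. c < f x}" and B: "\<And>x. f x \<le> B"
    and L: "\<And>n x. tent s (L n) x \<le> f x" "\<And>x. (\<lambda>n. tent s (L n) x) \<longlonglongrightarrow> f x"
  shows "(\<lambda>n. integral\<^sup>L m (tent s (L n))) \<longlonglongrightarrow> integral\<^sup>L m f"
proof (rule integral_dominated_convergence[where w="\<lambda>_. B"])
  interpret prob_space m using m by (simp add: probsD)
  show "f \<in> borel_measurable m" "tent s (L n) \<in> borel_measurable m" for n
    by (intro borel_measurable_probs[OF m] borel_measurable_lsc[OF lsc] borel_tent)+
  show "integrable m (\<lambda>_. B)" by simp
  show "AE x in m. (\<lambda>n. tent s (L n) x) \<longlonglongrightarrow> f x" using L by simp
  show "AE x in m. norm (tent s (L n) x) \<le> B" for n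
    using L(1)[of n] B tent_nonneg[of s "L n"] by (auto intro: order_trans)
qed

text \<open>Some tent below \<open>f\<close> carries all but less than \<open>e\<close> of the
  \<open>m\<close>-integral of \<open>f\<close>; its integrals converge and bound those of
  \<open>f\<close> from below. Convergence is assumed on tents only, so that weak convergence can be
  deduced from it.\<close>

lemma liminf_integral_lsc:
  fixes f :: "'a::metric_space \<Rightarrow> real" and s :: "nat \<Rightarrow> 'a"
  assumes s: "dense_seq s" and mu: "\<And>n. mu n \<in> probs" and m: "m \<in> probs"
    and conv: "\<And>l. (\<lambda>n. integral\<^sup>L (mu n) (tent s l)) \<longlonglongrightarrow> integral\<^sup>L m (tent s l)"
    and f0: "\<And>x. 0 \<le> f x" and lsc: "\<And>c. open {x. c < f x}" and B: "\<And>x. f x \<le> B" and e: "e > 0"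
  shows "eventually (\<lambda>n. integral\<^sup>L (mu n) f > integral\<^sup>L m f - e) sequentially"
proof -
  obtain L where L: "\<And>n x. tent s (L n) x \<le> f x" "\<And>x. (\<lambda>n. tent s (L n) x) \<longlonglongrightarrow> f x"
    using tent_approx[OF s f0 lsc] by blast
  have "(\<lambda>n. integral\<^sup>L m (tent s (L n))) \<longlonglongrightarrow> integral\<^sup>L m f"
    by (rule integral_tent_tendsto[OF m lsc B L])
  then have "eventually (\<lambda>n. integral\<^sup>L m (tent s (L n)) > integral\<^sup>L m f - e) sequentially"
    using e by (intro order_tendstoD) auto
  then obtain j where j: "integral\<^sup>L m (tent s (L j)) > integral\<^sup>L m f - e"
    using eventually_happens'[OF sequentially_bot] by blast
  have "eventually (\<lambda>n. integral\<^sup>L (mu n) (tent s (L j)) > integral\<^sup>L m f - e) sequentially"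
    using conv j by (rule order_tendstoD)
  moreover have "integral\<^sup>L (mu n) (tent s (L j)) \<le> integral\<^sup>L (mu n) f" for n
  proof (rule integral_mono)
    obtain B' where B': "\<And>x. \<bar>tent s (L j) x\<bar> \<le> B'" using tent_bounded by blast
    show "integrable (mu n) (tent s (L j))"
      using integrable_bounded_probs[OF mu borel_tent B'] .
    show "integrable (mu n) f"
      by (rule integrable_bounded_probs[OF mu borel_measurable_lsc[OF lsc], of B]) (simp add: B f0)
  qed (use L in auto)
  ultimately show ?thesis by (elim eventually_mono) (rule less_le_trans)
qed

lemma open_less_continuous:
  fixes f :: "'a::topological_space \<Rightarrow> real"
  assumes "continuous_on UNIV f" shows "open {x. c < f x}"
  using assms by (intro open_Collect_less continuous_on_const)

text \<open>If \<open>\<bar>f\<bar> \<le> B\<close>, then \<open>B + f\<close> and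
  \<open>B - f\<close> are nonnegative and continuous; the one-sided bound for lower semicontinuous
  functions, applied to each, gives the two halves of the limit.\<close>

lemma wk_conv_iff_tent:
  fixes s :: "nat \<Rightarrow> 'a::metric_space" and m :: "'a measure"
  assumes s: "dense_seq s" and mu: "\<And>n. mu n \<in> probs" and m: "m \<in> probs"
  shows "wk_conv mu m \<longleftrightarrow> (\<forall>l. (\<lambda>n. integral\<^sup>L (mu n) (tent s l)) \<longlonglongrightarrow> integral\<^sup>L m (tent s l))"
proof
  assume w: "wk_conv mu m"
  show "\<forall>l. (\<lambda>n. integral\<^sup>L (mu n) (tent s l)) \<longlonglongrightarrow> integral\<^sup>L m (tent s l)"
    using wk_convD[OF w continuous_tent] tent_bounded by blast
next
  assume "\<forall>l. (\<lambda>n. integral\<^sup>L (mu n) (tent s l)) \<longlonglongrightarrow> integral\<^sup>L m (tent s l)"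
  then have conv: "(\<lambda>n. integral\<^sup>L (mu n) (tent s l)) \<longlonglongrightarrow> integral\<^sup>L m (tent s l)" for l by blast
  show "wk_conv mu m"
    unfolding wk_conv_def
  proof (intro allI impI)
    fix f :: "'a \<Rightarrow> real" assume "continuous_on UNIV f \<and> bounded (range f)"
    then obtain B where c: "continuous_on UNIV f" and B: "\<And>x. \<bar>f x\<bar> \<le> B"
      by (auto simp: bounded_iff)
    have i: "integrable m' f" if "m' \<in> probs" for m'
      using integrable_bounded_probs[OF that borel_measurable_continuous_onI[OF c] B] .
    have lo: "0 \<le> B + f x" "B + f x \<le> 2 * B" and hi: "0 \<le> B - f x" "B - f x \<le> 2 * B" for x
      using B[of x] by linarith+
    note c' = open_less_continuous[OF continuous_on_add[OF continuous_on_const c]]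
      open_less_continuous[OF continuous_on_diff[OF continuous_on_const c]]
    have *: "integral\<^sup>L m' (\<lambda>x. B + f x) = B + integral\<^sup>L m' f"
            "integral\<^sup>L m' (\<lambda>x. B - f x) = B - integral\<^sup>L m' f" if "m' \<in> probs" for m'
    proof -
      interpret prob_space m' using that by (simp add: probsD)
      show "integral\<^sup>L m' (\<lambda>x. B + f x) = B + integral\<^sup>L m' f"
            "integral\<^sup>L m' (\<lambda>x. B - f x) = B - integral\<^sup>L m' f"
        using i[OF that] by (simp_all add: prob_space)
    qed
    show "(\<lambda>n. integral\<^sup>L (mu n) f) \<longlonglongrightarrow> integral\<^sup>L m f"
    proof (rule order_tendstoI)
      fix a assume a: "a < integral\<^sup>L m f"
      have "eventually (\<lambda>n. integral\<^sup>L (mu n) (\<lambda>x. B + f x) > integral\<^sup>L m (\<lambda>x. B + f x) - (integral\<^sup>L m f - a)) sequentially"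
        by (rule liminf_integral_lsc[OF s mu m conv lo(1) c'(1) lo(2)]) (use a in simp)
      then show "eventually (\<lambda>n. a < integral\<^sup>L (mu n) f) sequentially"
        by (simp add: *[OF mu] *[OF m])
    next
      fix a assume a: "integral\<^sup>L m f < a"
      have "eventually (\<lambda>n. integral\<^sup>L (mu n) (\<lambda>x. B - f x) > integral\<^sup>L m (\<lambda>x. B - f x) - (a - integral\<^sup>L m f)) sequentially"
        by (rule liminf_integral_lsc[OF s mu m conv hi(1) c'(2) hi(2)]) (use a in simp)
      then show "eventually (\<lambda>n. integral\<^sup>L (mu n) f < a) sequentially"
        by (simp add: *[OF mu] *[OF m])
    qed
  qed
qed

lemma lsc_indicator_open:
  assumes "open (U :: 'a::topological_space set)" shows "open {x. c < (indicator U x :: real)}"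
proof -
  have "{x. c < (indicator U x :: real)} = (if c < 0 then UNIV else if c < 1 then U else {})"
    by (auto simp: indicator_def)
  then show ?thesis using assms by simp
qed

lemma integral_indicator_probs: "m \<in> probs \<Longrightarrow> A \<in> sets borel \<Longrightarrow> integral\<^sup>L m (indicator A :: 'a::topological_space \<Rightarrow> real) = measure m A"
  using probsD[of m] by (simp add: Int_absorb2)

lemma portmanteau_open:
  fixes s :: "nat \<Rightarrow> 'a::metric_space" and m :: "'a measure"
  assumes s: "dense_seq s" and mu: "\<And>n. mu n \<in> probs" and m: "m \<in> probs" and w: "wk_conv mu m"
    and U: "open U" and e: "e > 0"
  shows "eventually (\<lambda>n. measure (mu n) U > measure m U - e) sequentially"
proof -
  have "eventually (\<lambda>n. integral\<^sup>L (mu n) (indicator U) > integral\<^sup>L m (indicator U) - e) sequentially"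
    using w by (intro liminf_integral_lsc[OF s mu m, where B=1] lsc_indicator_open U e)
      (auto simp: wk_conv_iff_tent[OF s mu m] indicator_def)
  then show ?thesis using U by (simp add: probsD(3)[OF mu] probsD(3)[OF m])
qed

section \<open>Embedding of measures into the space of real sequences\<close>

lemma tendsto_fun_iff:
  fixes v :: "nat \<Rightarrow> 'i \<Rightarrow> 'b::topological_space"
  shows "v \<longlonglongrightarrow> l \<longleftrightarrow> (\<forall>j. (\<lambda>n. v n j) \<longlonglongrightarrow> l j)"
proof -
  have "v \<longlonglongrightarrow> l \<longleftrightarrow> limitin (product_topology (\<lambda>_. euclidean) UNIV) v l sequentially"
    by (simp add: euclidean_product_topology)
  then show ?thesis unfolding limitin_componentwise by simp
qed

definition tent_vec :: "(nat \<Rightarrow> 'a::metric_space) \<Rightarrow> 'a measure \<Rightarrow> nat \<Rightarrow> real" where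
  "tent_vec s m j = integral\<^sup>L m (tent s (from_nat j))"

lemma wk_conv_iff_tent_vec:
  fixes s :: "nat \<Rightarrow> 'a::metric_space" and m :: "'a measure"
  assumes s: "dense_seq s" and mu: "\<And>n. mu n \<in> probs" and m: "m \<in> probs"
  shows "wk_conv mu m \<longleftrightarrow> (\<lambda>n. tent_vec s (mu n)) \<longlonglongrightarrow> tent_vec s m"
proof -
  have "(\<forall>l. P (l :: (nat \<times> rat \<times> nat) list)) \<longleftrightarrow> (\<forall>j. P (from_nat j))" for P
    by (metis surj_from_nat surjD)
  then show ?thesis
    unfolding wk_conv_iff_tent[OF assms] tendsto_fun_iff tent_vec_def .
qed

text \<open>Tents converge boundedly to the indicator of any open set, so equal coordinates force
  equal masses on the open sets, a generator stable under intersection.\<close>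

lemma tent_vec_inject:
  fixes s :: "nat \<Rightarrow> 'a::metric_space"
  assumes s: "dense_seq s" and m: "m \<in> probs" and m': "m' \<in> probs" and eq: "tent_vec s m = tent_vec s m'"
  shows "m = m'"
proof -
  interpret m: prob_space m using m by (simp add: probsD)
  interpret m': prob_space m' using m' by (simp add: probsD)
  show ?thesis
  proof (rule measure_eqI_generator_eq[where E="{U. open U}" and \<Omega>=UNIV and A="\<lambda>_. UNIV"])
    have tent_eq: "integral\<^sup>L m (tent s l) = integral\<^sup>L m' (tent s l)" for l
      using fun_cong[OF eq, of "to_nat l"] by (simp add: tent_vec_def)
    show "Int_stable {U :: 'a set. open U}" by (auto simp: Int_stable_def)
    show "sets m = sigma_sets UNIV {U. open U}" "sets m' = sigma_sets UNIV {U. open U}"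
      using probsD(2)[OF m] probsD(2)[OF m'] by (auto simp: borel_def)
    show "emeasure m U = emeasure m' U" if "U \<in> {U. open U}" for U
    proof -
      have U: "open U" using that by simp
      obtain L where L: "\<And>n x. tent s (L n) x \<le> (indicator U x :: real)" "\<And>x. (\<lambda>n. tent s (L n) x) \<longlonglongrightarrow> indicator U x"
        using tent_approx[OF s _ lsc_indicator_open[OF U]] by fastforce
      have *: "(\<lambda>n. integral\<^sup>L m'' (tent s (L n))) \<longlonglongrightarrow> measure m'' U" if "m'' \<in> probs" for m''
        using integral_tent_tendsto[OF that lsc_indicator_open[OF U] _ L, of 1] U
        by (simp add: probsD(3)[OF that])
      have "measure m U = measure m' U"
        using LIMSEQ_unique[OF *[OF m]] *[OF m'] tent_eq by simp
      then show ?thesis by (simp add: m.emeasure_eq_measure m'.emeasure_eq_measure)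
    qed
  qed (auto simp: m.emeasure_eq_measure)
qed

lemma wk_conv_unique:
  fixes s :: "nat \<Rightarrow> 'a::metric_space" and m :: "'a measure"
  assumes s: "dense_seq s" and mu: "\<And>n. mu n \<in> probs" and m: "m \<in> probs" "m' \<in> probs"
    and w: "wk_conv mu m" "wk_conv mu m'"
  shows "m = m'"
proof (rule tent_vec_inject[OF s m LIMSEQ_unique])
  show "(\<lambda>n. tent_vec s (mu n)) \<longlonglongrightarrow> tent_vec s m" "(\<lambda>n. tent_vec s (mu n)) \<longlonglongrightarrow> tent_vec s m'"
    using w unfolding wk_conv_iff_tent_vec[OF s mu m(1)] wk_conv_iff_tent_vec[OF s mu m(2)] .
qed

lemma measurable_tent_vec: "tent_vec s \<in> borel_measurable (prob_algebra borel)"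
proof (rule measurable_coordinatewise_then_product)
  fix j
  have "(\<lambda>m. integral\<^sup>L m (tent s (from_nat j))) \<in> borel_measurable (subprob_algebra borel)"
    using borel_tent by (rule integral_measurable_subprob_algebra)
  then show "(\<lambda>m. tent_vec s m j) \<in> borel_measurable (prob_algebra borel)"
    unfolding tent_vec_def prob_algebra_def by (rule measurable_restrict_space1)
qed

text \<open>\<^term>\<open>tent_vec s\<close> embeds the weak topology into the Polish space of real sequences, so that
  a weakly continuous function factors through a continuous function on the image.\<close>

lemma wcont_measurable:
  fixes \<Phi> :: "'a::metric_space measure \<Rightarrow> real" and s :: "nat \<Rightarrow> 'a"
  assumes s: "dense_seq s" and \<Phi>: "wcont \<Phi>"
  shows "\<Phi> \<in> borel_measurable (prob_algebra borel)"
proof -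
  let ?T = "tent_vec s" and ?J = "the_inv_into probs (tent_vec s)"
  have inj: "inj_on ?T probs" using tent_vec_inject[OF s] by (intro inj_onI)
  have J: "?J (?T m) = m" if "m \<in> probs" for m using the_inv_into_f_f[OF inj that] .
  have "continuous_on (?T ` probs) (\<Phi> \<circ> ?J)"
    unfolding continuous_on_sequentially
  proof (intro allI ballI impI)
    fix v v0 assume v0: "v0 \<in> ?T ` probs" and v: "(\<forall>n. v n \<in> ?T ` probs) \<and> v \<longlonglongrightarrow> v0"
    then obtain m where m: "m \<in> probs" "v0 = ?T m" by blast
    from v have "\<forall>n. \<exists>m'\<in>probs. v n = ?T m'" by blast
    then obtain mu where mu: "\<And>n. mu n \<in> probs" "\<And>n. v n = ?T (mu n)" by metis
    have "wk_conv mu m" unfolding wk_conv_iff_tent_vec[OF s mu(1) m(1)] using v m mu(2)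
      by (metis (no_types, lifting) ext)
    then have "(\<lambda>n. \<Phi> (mu n)) \<longlonglongrightarrow> \<Phi> m" using \<Phi> m mu unfolding wcont_def by blast
    then show "((\<Phi> \<circ> ?J) \<circ> v) \<longlonglongrightarrow> (\<Phi> \<circ> ?J) v0" using m mu J by (simp add: comp_def)
  qed
  then have "\<Phi> \<circ> ?J \<in> borel_measurable (restrict_space borel (?T ` probs))"
    by (rule borel_measurable_continuous_on_restrict)
  moreover have "?T \<in> measurable (prob_algebra borel) (restrict_space borel (?T ` probs))"
    by (intro measurable_restrict_space2 measurable_tent_vec) (auto simp: space_prob_algebra_borel)
  ultimately have "(\<lambda>m. (\<Phi> \<circ> ?J) (?T m)) \<in> borel_measurable (prob_algebra borel)"
    by (rule measurable_compose[rotated])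
  then show ?thesis
    by (rule measurable_cong[THEN iffD1, rotated]) (simp add: J space_prob_algebra_borel)
qed

text \<open>Tychonoff's theorem in place of a diagonal argument: the countable index type makes the
  product first countable, so compactness gives convergent subsequences.\<close>

lemma convergent_subseq_fun:
  fixes q :: "nat \<Rightarrow> 'i::countable \<Rightarrow> real"
  assumes "\<And>n l. q n l \<in> {a..b}"
  shows "\<exists>r p. strict_mono r \<and> (\<forall>l. (\<lambda>n. q (r n) l) \<longlonglongrightarrow> p l)"
proof -
  have "compactin (product_topology (\<lambda>_::'i. euclidean) UNIV) (Pi\<^sub>E UNIV (\<lambda>_. {a..b}))"
    by (simp add: compactin_PiE)
  then have "compact (Pi\<^sub>E UNIV (\<lambda>_::'i. {a..b}))"
    unfolding euclidean_product_topology by simp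
  then have "seq_compact (Pi\<^sub>E UNIV (\<lambda>_::'i. {a..b}))" by (rule compact_imp_seq_compact)
  moreover have "\<And>n. q n \<in> Pi\<^sub>E UNIV (\<lambda>_. {a..b})" using assms by auto
  ultimately obtain p r where "strict_mono r" "(q \<circ> r) \<longlonglongrightarrow> p"
    unfolding seq_compact_def by blast
  then show ?thesis unfolding tendsto_fun_iff by (auto simp: comp_def)
qed

section \<open>Continuously convergent integrands\<close>

text \<open>\<open>h j\<close> is the Lipschitz (Pasch-Hausdorff) envelope of the supremum of
  \<open>g k\<close> over \<open>k \<ge> j\<close>. A pair \<open>(k, y)\<close> that nearly attains
  it at \<open>x\<close> satisfies \<open>j * dist x y \<le> B + 1\<close>, since \<open>g\<close>
  lies in \<open>[0, B]\<close>; as \<open>j\<close> grows, \<open>y\<close> tends to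
  \<open>x\<close> and \<open>k\<close> to infinity, and continuous convergence of \<open>g\<close>
  identifies the limit.\<close>

lemma envelope_continuous:
  fixes g :: "nat \<Rightarrow> 'a::metric_space \<Rightarrow> real"
  assumes B: "\<And>k x. g k x \<in> {0..B}"
    and conv: "\<And>\<kappa> z x. filterlim \<kappa> sequentially sequentially \<Longrightarrow> z \<longlonglongrightarrow> x \<Longrightarrow> (\<lambda>j. g (\<kappa> j) (z j)) \<longlonglongrightarrow> g0 x"
  shows "\<exists>h. (\<forall>j. continuous_on UNIV (h j)) \<and> (\<forall>j x. h j x \<in> {0..B}) \<and>
    (\<forall>j k x. j \<le> k \<longrightarrow> g k x \<le> h j x) \<and> (\<forall>x. (\<lambda>j. h j x) \<longlonglongrightarrow> g0 x)"
proof -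
  define h where "h j x = (SUP p\<in>{j..} \<times> UNIV. g (fst p) (snd p) - real j * dist x (snd p))" for j :: nat and x
  have bdd: "bdd_above ((\<lambda>p. g (fst p) (snd p) - real j * dist x (snd p)) ` ({j..} \<times> UNIV))" for j x
  proof (rule bdd_aboveI2[of _ _ B])
    fix p
    show "g (fst p) (snd p) - real j * dist x (snd p) \<le> B"
      using B[of "fst p" "snd p"] by (simp add: add_increasing2 diff_le_eq)
  qed
  have up: "g k y - real j * dist x y \<le> h j x" if "j \<le> k" for j k x y
    unfolding h_def using cSUP_upper[OF _ bdd, of "(k, y)" j x] that by simp
  have ge: "g k x \<le> h j x" if "j \<le> k" for j k x using up[OF that, of x x] by simp
  have hB: "h j x \<le> B" for j x
    unfolding h_def
  proof (rule cSUP_least)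
    show "g (fst p) (snd p) - real j * dist x (snd p) \<le> B" for p
      using B[of "fst p" "snd p"] by (simp add: add_increasing2 diff_le_eq)
  qed auto
  have h0: "0 \<le> h j x" for j x using ge[of j j x] B[of j x] by auto
  have lip: "h j x \<le> h j x' + real j * dist x x'" for j x x'
    unfolding h_def[of j x]
  proof (rule cSUP_least)
    fix p :: "nat \<times> 'a" assume p: "p \<in> {j..} \<times> UNIV"
    have "real j * dist x' (snd p) \<le> real j * (dist x (snd p) + dist x x')"
      using dist_triangle3[of x' "snd p" x] by (intro mult_left_mono) (auto simp: dist_commute)
    then have "g (fst p) (snd p) - real j * dist x (snd p)
        \<le> g (fst p) (snd p) - real j * dist x' (snd p) + real j * dist x x'" by (simp add: algebra_simps)
    also have "\<dots> \<le> h j x' + real j * dist x x'" using up[of j "fst p" "snd p" x'] p by auto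
    finally show "g (fst p) (snd p) - real j * dist x (snd p) \<le> h j x' + real j * dist x x'" .
  qed auto
  have "continuous_on UNIV (h j)" for j
  proof (rule lipschitz_on_continuous_on[of "real j"], rule lipschitz_onI)
    show "dist (h j x) (h j x') \<le> real j * dist x x'" for x x'
      using lip[of j x x'] lip[of j x' x] by (auto simp: dist_real_def dist_commute)
  qed simp
  moreover have "(\<lambda>j. h j x) \<longlonglongrightarrow> g0 x" for x
  proof -
    have "\<exists>p. p \<in> {j..} \<times> UNIV \<and> h j x - 1 / real (Suc j) < g (fst p) (snd p) - real j * dist x (snd p)" for j
      using less_cSUP_iff[OF _ bdd, of j "h j x - 1 / real (Suc j)" x] unfolding h_def[symmetric] by auto
    then obtain p where p: "\<And>j. p j \<in> {j..} \<times> UNIV"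
      "\<And>j. h j x - 1 / real (Suc j) < g (fst (p j)) (snd (p j)) - real j * dist x (snd (p j))" by metis
    have \<kappa>: "filterlim (\<lambda>j. fst (p j)) sequentially sequentially"
      using p(1) by (intro filterlim_at_top_mono[OF filterlim_ident]) (auto simp: mem_Times_iff)
    have "dist (snd (p j)) x \<le> (B + 1) * inverse (real j)" if "j > 0" for j
    proof -
      have "real j * dist x (snd (p j)) \<le> B + 1 / real (Suc j)"
        using p(2)[of j] h0[of j x] B[of "fst (p j)" "snd (p j)"] by auto
      moreover have "1 / real (Suc j) \<le> 1" by (simp add: divide_le_eq)
      ultimately have "real j * dist x (snd (p j)) \<le> B + 1" by linarith
      then show ?thesis using that by (simp add: field_simps dist_commute)
    qed
    then have "eventually (\<lambda>j. norm (dist (snd (p j)) x) \<le> (B + 1) * inverse (real j)) sequentially"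
      by (intro eventually_mono[OF eventually_gt_at_top[of 0]]) simp
    moreover have "(\<lambda>j. (B + 1) * inverse (real j)) \<longlonglongrightarrow> 0"
      by (rule tendsto_mult_right_zero[OF lim_inverse_n])
    ultimately have "(\<lambda>j. dist (snd (p j)) x) \<longlonglongrightarrow> 0" by (rule Lim_null_comparison)
    then have "(\<lambda>j. snd (p j)) \<longlonglongrightarrow> x" by (rule iffD2[OF tendsto_dist_iff])
    from conv[OF \<kappa> this]
    have "(\<lambda>j. g (fst (p j)) (snd (p j)) + 1 / real (Suc j)) \<longlonglongrightarrow> g0 x + 0"
      by (intro tendsto_add LIMSEQ_Suc[OF lim_1_over_n])
    then have upper: "(\<lambda>j. g (fst (p j)) (snd (p j)) + 1 / real (Suc j)) \<longlonglongrightarrow> g0 x" by simp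
    have lower: "(\<lambda>j. g j x) \<longlonglongrightarrow> g0 x" using conv[OF filterlim_ident, of "\<lambda>_. x" x] by simp
    have "h j x \<le> g (fst (p j)) (snd (p j)) + 1 / real (Suc j)" for j
    proof -
      have "0 \<le> real j * dist x (snd (p j))" by simp
      with p(2)[of j] show ?thesis by linarith
    qed
    then show ?thesis using ge by (intro tendsto_sandwich[OF _ _ lower upper]) auto
  qed
  ultimately show ?thesis using ge hB h0 by (intro exI[of _ h]) auto
qed

text \<open>The integrands \<open>g k\<close> need not be measurable: they are dominated by one continuous \<open>h\<close>.\<close>

lemma dominating_continuous:
  fixes g :: "nat \<Rightarrow> 'a::metric_space \<Rightarrow> real"
  assumes B: "\<And>k x. g k x \<in> {0..B}"
    and conv: "\<And>\<kappa> z x. filterlim \<kappa> sequentially sequentially \<Longrightarrow> z \<longlonglongrightarrow> x \<Longrightarrow> (\<lambda>j. g (\<kappa> j) (z j)) \<longlonglongrightarrow> g0 x"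
    and mu: "\<And>n. mu n \<in> probs" and m: "m \<in> probs" and w: "wk_conv mu m" and e: "e > 0"
  shows "\<exists>h j. continuous_on UNIV h \<and> (\<forall>x. h x \<in> {0..B}) \<and> (\<forall>k\<ge>j. \<forall>x. g k x \<le> h x) \<and>
    eventually (\<lambda>k. integral\<^sup>L (mu k) h < integral\<^sup>L m g0 + e) sequentially"
proof -
  obtain h where h: "\<And>j. continuous_on UNIV (h j)" "\<And>j x. h j x \<in> {0..B}"
    "\<And>j k x. j \<le> k \<Longrightarrow> g k x \<le> h j x" "\<And>x. (\<lambda>j. h j x) \<longlonglongrightarrow> g0 x"
    using envelope_continuous[of g B g0, OF B conv] by blast
  interpret prob_space m using m by (simp add: probsD)
  have hm: "h j \<in> borel_measurable m" for j
    by (intro borel_measurable_probs[OF m] borel_measurable_continuous_onI h)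
  have "(\<lambda>j. integral\<^sup>L m (h j)) \<longlonglongrightarrow> integral\<^sup>L m g0"
  proof (rule integral_dominated_convergence[where w="\<lambda>_. B"])
    show "g0 \<in> borel_measurable m" by (rule borel_measurable_LIMSEQ_real[OF h(4) hm])
  qed (use h in \<open>auto simp: hm\<close>)
  then have "eventually (\<lambda>j. integral\<^sup>L m (h j) < integral\<^sup>L m g0 + e) sequentially"
    using e by (intro order_tendstoD) auto
  then obtain j where j: "integral\<^sup>L m (h j) < integral\<^sup>L m g0 + e"
    using eventually_happens'[OF sequentially_bot] by blast
  have "(\<lambda>k. integral\<^sup>L (mu k) (h j)) \<longlonglongrightarrow> integral\<^sup>L m (h j)"
    using h(2)[of j] by (intro wk_convD[OF w h(1), of _ B]) auto
  then have "eventually (\<lambda>k. integral\<^sup>L (mu k) (h j) < integral\<^sup>L m g0 + e) sequentially"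
    using j by (rule order_tendstoD)
  then show ?thesis using h by blast
qed

text \<open>The dominating envelope yields the upper half of the limit; the lower half is the same
  statement for \<open>B - g k\<close>. Continuous convergence of the integrands replaces uniform
  convergence.\<close>

lemma tendsto_integral_varying:
  fixes g :: "nat \<Rightarrow> 'a::metric_space \<Rightarrow> real"
  assumes B: "\<And>k x. g k x \<in> {0..B}" and meas: "\<And>k. g k \<in> borel_measurable borel"
    and g0: "g0 \<in> borel_measurable borel"
    and conv: "\<And>\<kappa> z x. filterlim \<kappa> sequentially sequentially \<Longrightarrow> z \<longlonglongrightarrow> x \<Longrightarrow> (\<lambda>j. g (\<kappa> j) (z j)) \<longlonglongrightarrow> g0 x"
    and mu: "\<And>n. mu n \<in> probs" and m: "m \<in> probs" and w: "wk_conv mu m"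
  shows "(\<lambda>k. integral\<^sup>L (mu k) (g k)) \<longlonglongrightarrow> integral\<^sup>L m g0"
proof -
  have upper: "eventually (\<lambda>k. integral\<^sup>L (mu k) (f k) < integral\<^sup>L m f0 + e) sequentially"
    if f: "\<And>k x. f k x \<in> {0..B}" "\<And>k. f k \<in> borel_measurable borel"
      "\<And>\<kappa> z x. filterlim \<kappa> sequentially sequentially \<Longrightarrow> z \<longlonglongrightarrow> x \<Longrightarrow> (\<lambda>j. f (\<kappa> j) (z j)) \<longlonglongrightarrow> f0 x"
      and e: "e > 0" for f :: "nat \<Rightarrow> 'a \<Rightarrow> real" and f0 e
  proof -
    obtain h j where h: "continuous_on UNIV h" "\<And>x. h x \<in> {0..B}" "\<And>k x. k \<ge> j \<Longrightarrow> f k x \<le> h x"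
      "eventually (\<lambda>k. integral\<^sup>L (mu k) h < integral\<^sup>L m f0 + e) sequentially"
      using dominating_continuous[of f B f0, OF f(1,3) mu m w e] by blast
    from h(4) eventually_ge_at_top[of j] show ?thesis
    proof eventually_elim
      case (elim k)
      have "integral\<^sup>L (mu k) (f k) \<le> integral\<^sup>L (mu k) h"
      proof (rule integral_mono)
        show "integrable (mu k) (f k)"
          using f(1)[of k] by (intro integrable_bounded_probs[OF mu f(2), of _ B]) auto
        show "integrable (mu k) h"
          using h(2) by (intro integrable_bounded_probs[OF mu borel_measurable_continuous_onI[OF h(1)], of B]) auto
      qed (use elim h in auto)
      with elim show ?case by simp
    qed
  qed
  have g0B: "g0 x \<in> {0..B}" for x
  proof -
    have l: "(\<lambda>j. g j x) \<longlonglongrightarrow> g0 x" using conv[OF filterlim_ident, of "\<lambda>_. x" x] by simp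
    have "0 \<le> g0 x" "g0 x \<le> B"
      using B by (auto intro!: LIMSEQ_le_const[OF l] LIMSEQ_le_const2[OF l])
    then show ?thesis by simp
  qed
  have i: "integrable m' f" if "m' \<in> probs" "f \<in> borel_measurable borel" "\<And>x. f x \<in> {0..B}" for m' and f :: "'a \<Rightarrow> real"
    using that(3) by (intro integrable_bounded_probs[OF that(1,2), of B]) auto
  have flip: "integral\<^sup>L m' (\<lambda>x. B - f x) = B - integral\<^sup>L m' f"
    if "m' \<in> probs" "f \<in> borel_measurable borel" "\<And>x. f x \<in> {0..B}" for m' and f :: "'a \<Rightarrow> real"
  proof -
    interpret prob_space m' using that by (simp add: probsD)
    show ?thesis using i[OF that] by (simp add: prob_space)
  qed
  show ?thesis
  proof (rule order_tendstoI)
    fix a assume a: "integral\<^sup>L m g0 < a"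
    show "eventually (\<lambda>k. integral\<^sup>L (mu k) (g k) < a) sequentially"
      using upper[of g g0 "a - integral\<^sup>L m g0", OF B meas conv] a by simp
  next
    fix a assume a: "a < integral\<^sup>L m g0"
    have "eventually (\<lambda>k. integral\<^sup>L (mu k) (\<lambda>x. B - g k x)
        < integral\<^sup>L m (\<lambda>x. B - g0 x) + (integral\<^sup>L m g0 - a)) sequentially"
    proof (rule upper)
      show "B - g k x \<in> {0..B}" for k x using B[of k x] by auto
    qed (use a meas conv in \<open>auto intro!: tendsto_intros\<close>)
    then show "eventually (\<lambda>k. a < integral\<^sup>L (mu k) (g k)) sequentially"
      by (simp add: flip[OF mu meas B] flip[OF m g0 g0B])
  qed
qed

section \<open>Prokhorov's theorem\<close>

text \<open>The newest bit stands first, so that extending a prefix is a \<open>Cons\<close>, as the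
  recursions over bit strings want. Bit \<open>i\<close> of a prefix of length \<open>n\<close>
  therefore sits at position \<open>n - Suc i\<close>.\<close>

fun prefix_bits :: "(nat \<Rightarrow> bool) \<Rightarrow> nat \<Rightarrow> bool list" where
  "prefix_bits b 0 = []"
| "prefix_bits b (Suc n) = b n # prefix_bits b n"

lemma length_prefix_bits [simp]: "length (prefix_bits b n) = n"
  by (induction n) auto

lemma nth_prefix_bits: "i < n \<Longrightarrow> prefix_bits b n ! (n - Suc i) = b i"
proof (induction n)
  case (Suc n)
  show ?case
  proof (cases "i = n")
    case False
    then have "Suc n - Suc i = Suc (n - Suc i)" using Suc by simp
    then show ?thesis using Suc False by simp
  qed simp
qed simp

text \<open>The interval of \<open>l\<close> has length \<open>p l\<close>. Its left part belongs to
  \<open>False # l\<close>, the rest to \<open>True # l\<close>, which therefore starts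
  \<open>p (False # l)\<close> further right.\<close>

fun left_end :: "(bool list \<Rightarrow> real) \<Rightarrow> bool list \<Rightarrow> real" where
  "left_end p [] = 0"
| "left_end p (False # l) = left_end p l"
| "left_end p (True # l) = left_end p l + p (False # l)"

fun bits_of_real :: "(bool list \<Rightarrow> real) \<Rightarrow> real \<Rightarrow> nat \<Rightarrow> bool list" where
  "bits_of_real p u 0 = []"
| "bits_of_real p u (Suc n) = (let l = bits_of_real p u n in (left_end p l + p (False # l) \<le> u) # l)"

text \<open>Consistent weights on finite bit strings come from a random bit sequence: cut \<open>[0,1)\<close> into
  nested intervals whose lengths are the weights.\<close>

lemma ex_random_bits:
  fixes p :: "bool list \<Rightarrow> real"
  assumes p0: "\<And>l. 0 \<le> p l" and p1: "p [] = 1" and add: "\<And>l. p l = p (False # l) + p (True # l)"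
  shows "\<exists>(N :: real measure) c. prob_space N \<and>
    (\<forall>l. {u \<in> space N. prefix_bits (c u) (length l) = l} \<in> sets N \<and>
         measure N {u \<in> space N. prefix_bits (c u) (length l) = l} = p l)"
proof -
  define N where "N = restrict_space lborel {0..<1::real}"
  define c where "c u n = hd (bits_of_real p u (Suc n))" for u n
  have pre: "prefix_bits (c u) n = bits_of_real p u n" for u n
    by (induction n) (auto simp: c_def Let_def)
  have sp: "space N = {0..<1}" by (simp add: N_def space_restrict_space)
  \<comment> \<open>The next bit is set exactly when \<open>u\<close> has passed the left part;
    half-open intervals leave no ambiguity at the end points.\<close>
  have iff: "bits_of_real p u (length l) = l \<longleftrightarrow> left_end p l \<le> u \<and> u < left_end p l + p l"
    if "u \<in> {0..<1}" for u l
  proof (induction l)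
    case Nil
    then show ?case using that p1 by simp
  next
    case (Cons b l)
    have "p (False # l) \<le> p l" using add[of l] p0[of "True # l"] by simp
    then show ?case using Cons add[of l] p0[of "False # l"] by (cases b) (auto simp: Let_def)
  qed
  have sub: "0 \<le> left_end p l \<and> left_end p l + p l \<le> 1" for l
  proof (induction l)
    case Nil
    then show ?case using p1 by simp
  next
    case (Cons b l)
    then show ?case using add[of l] p0[of "False # l"] p0[of "True # l"] by (cases b) auto
  qed
  have eq: "{u \<in> space N. prefix_bits (c u) (length l) = l} = {left_end p l ..< left_end p l + p l}" for l
    unfolding pre sp using iff[of _ l] sub[of l] by auto
  have m: "emeasure N {a..<b} = ennreal (b - a)" if "0 \<le> a" "b \<le> 1" "a \<le> b" for a b
    unfolding N_def using that by (subst emeasure_restrict_space) auto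
  have "prob_space N" by (rule prob_spaceI) (simp add: sp m)
  moreover have "{left_end p l ..< left_end p l + p l} \<in> sets N" for l
    unfolding N_def sets_restrict_space_iff[of "{0..<1::real}" lborel, simplified] using sub[of l] p0[of l] by auto
  moreover have "measure N {left_end p l ..< left_end p l + p l} = p l" for l
    unfolding measure_def using m[of "left_end p l" "left_end p l + p l"] sub[of l] p0[of l] by simp
  ultimately show ?thesis unfolding eq[symmetric] by (intro exI[of _ N] exI[of _ c]) (simp add: eq)
qed

text \<open>A point is coded by the bits \<open>prod_encode (k, i)\<close>, which tell whether it lies within \<open>1/2^k\<close> of the
  \<open>i\<close>-th point of the dense sequence. It is recovered as the limit of the first near points, so limits of
  laws may be taken on the level of bits.\<close>

definition near_bit :: "nat \<Rightarrow> nat \<Rightarrow> (nat \<Rightarrow> bool) \<Rightarrow> bool" where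
  "near_bit k i b = b (prod_encode (k, i))"

definition first_bit :: "nat \<Rightarrow> nat \<Rightarrow> (nat \<Rightarrow> bool) \<Rightarrow> bool" where
  "first_bit k i b \<longleftrightarrow> near_bit k i b \<and> (\<forall>i'<i. \<not> near_bit k i' b)"

definition code_bits :: "(nat \<Rightarrow> 'a::metric_space) \<Rightarrow> 'a \<Rightarrow> nat \<Rightarrow> bool" where
  "code_bits s x j \<longleftrightarrow> dist x (s (snd (prod_decode j))) < 1 / 2 ^ fst (prod_decode j)"

text \<open>Cylinder events: probabilities of finite prefixes are all that is known to converge, so
  only for such events does the probability pass to the limit.\<close>

definition fin_dep :: "((nat \<Rightarrow> bool) \<Rightarrow> bool) \<Rightarrow> bool" where
  "fin_dep Q \<longleftrightarrow> (\<exists>n. \<forall>b b'. (\<forall>i<n. b i = b' i) \<longrightarrow> Q b = Q b')"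

lemma near_bit_code: "near_bit k i (code_bits s x) \<longleftrightarrow> dist x (s i) < 1 / 2 ^ k"
  by (simp add: near_bit_def code_bits_def)

lemma fin_dep_near: "fin_dep (near_bit k i)"
  unfolding fin_dep_def near_bit_def by (rule exI[of _ "Suc (prod_encode (k, i))"]) auto

lemma fin_dep_not: "fin_dep P \<Longrightarrow> fin_dep (\<lambda>b. \<not> P b)"
  unfolding fin_dep_def by metis

lemma fin_dep_conj:
  assumes "fin_dep P" "fin_dep Q" shows "fin_dep (\<lambda>b. P b \<and> Q b)"
proof -
  obtain m n where m: "\<And>b b'. (\<forall>i<m. b i = b' i) \<Longrightarrow> P b = P b'"
    and n: "\<And>b b'. (\<forall>i<n. b i = b' i) \<Longrightarrow> Q b = Q b'"
    using assms unfolding fin_dep_def by metis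
  show ?thesis unfolding fin_dep_def
  proof (intro exI[of _ "max m n"] allI impI)
    fix b b' :: "nat \<Rightarrow> bool" assume "\<forall>i<max m n. b i = b' i"
    then show "(P b \<and> Q b) = (P b' \<and> Q b')" using m[of b b'] n[of b b'] by auto
  qed
qed

lemma fin_dep_all_less:
  assumes "\<And>i. fin_dep (P i)" shows "fin_dep (\<lambda>b. \<forall>i<n::nat. P i b)"
proof (induction n)
  case 0
  then show ?case by (simp add: fin_dep_def)
next
  case (Suc n)
  have "(\<lambda>b. \<forall>i<Suc n. P i b) = (\<lambda>b. (\<forall>i<n. P i b) \<and> P n b)" by (auto simp: less_Suc_eq)
  then show ?case using fin_dep_conj[OF Suc assms] by simp
qed

lemma fin_dep_first: "fin_dep (first_bit k i)"
  unfolding first_bit_def[abs_def] by (intro fin_dep_conj fin_dep_all_less fin_dep_not fin_dep_near)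

text \<open>If some \<open>i < I\<close> is near at scale \<open>k\<close>, exactly one such index
  is first, and replacing \<open>Z\<close> by that point costs at most \<open>K / 2 ^ k\<close>;
  otherwise the sum vanishes and the error is at most \<open>B\<close>. Being first concerns
  finitely many bits only, so the lemma, applied to the given measures and to the limit space,
  compares their integrals through cylinder probabilities.\<close>

lemma integral_code_approx:
  fixes f :: "'a::metric_space \<Rightarrow> real"
  assumes P: "prob_space P" and c: "\<And>j. Measurable.pred P (\<lambda>u. c u j)"
    and Z: "Z \<in> borel_measurable P" and f: "f \<in> borel_measurable borel"
    and near: "AE u in P. \<forall>i. first_bit k i (c u) \<longrightarrow> dist (Z u) (s i) \<le> 1 / 2 ^ k"
    and B: "\<And>x. \<bar>f x\<bar> \<le> B" and K: "\<And>x y. \<bar>f x - f y\<bar> \<le> K * dist x y" "0 \<le> K"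
  shows "\<bar>(\<integral>u. f (Z u) \<partial>P) - (\<Sum>i<I. f (s i) * measure P {u \<in> space P. first_bit k i (c u)})\<bar>
    \<le> K / 2 ^ k + B * measure P {u \<in> space P. \<forall>i<I. \<not> near_bit k i (c u)}"
proof -
  interpret prob_space P by (rule P)
  have nb [measurable]: "Measurable.pred P (\<lambda>u. near_bit k i (c u))" for k i
    unfolding near_bit_def by (rule c)
  have fb [measurable]: "Measurable.pred P (\<lambda>u. first_bit k i (c u))" for i
    unfolding first_bit_def by measurable
  have fZ [measurable]: "(\<lambda>u. f (Z u)) \<in> borel_measurable P" by (rule measurable_compose[OF Z f])
  let ?E = "{u \<in> space P. \<forall>i<I. \<not> near_bit k i (c u)}" and ?F = "\<lambda>i. {u \<in> space P. first_bit k i (c u)}"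
  have E: "?E \<in> sets P" and F: "?F i \<in> sets P" for i by measurable
  have i1: "integrable P (\<lambda>u. f (Z u))"
    by (rule integrable_const_bound[where B=B]) (use B in auto)
  have i2: "integrable P (\<lambda>u. \<Sum>i<I. f (s i) * indicator (?F i) u)"
    by (intro Bochner_Integration.integrable_sum integrable_mult_right integrable_real_indicator F) (simp add: emeasure_eq_measure)
  have i3: "integrable P (\<lambda>u. K / 2 ^ k + B * indicator ?E u)"
    by (intro Bochner_Integration.integrable_add integrable_mult_right integrable_real_indicator E) (simp_all add: emeasure_eq_measure)
  have "(\<integral>u. (\<Sum>i<I. f (s i) * indicator (?F i) u) \<partial>P) = (\<Sum>i<I. \<integral>u. f (s i) * indicator (?F i) u \<partial>P)"
    by (intro Bochner_Integration.integral_sum integrable_mult_right integrable_real_indicator F) (simp add: emeasure_eq_measure)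
  also have "\<dots> = (\<Sum>i<I. f (s i) * measure P (?F i))"
    by (simp add: sets.Int_space_eq2[OF F])
  finally have sum_eq: "(\<integral>u. (\<Sum>i<I. f (s i) * indicator (?F i) u) \<partial>P) = (\<Sum>i<I. f (s i) * measure P (?F i))" .
  have "\<bar>(\<integral>u. f (Z u) \<partial>P) - (\<Sum>i<I. f (s i) * measure P (?F i))\<bar>
      = \<bar>(\<integral>u. f (Z u) - (\<Sum>i<I. f (s i) * indicator (?F i) u) \<partial>P)\<bar>"
    unfolding Bochner_Integration.integral_diff[OF i1 i2] sum_eq ..
  also have "\<dots> \<le> (\<integral>u. \<bar>f (Z u) - (\<Sum>i<I. f (s i) * indicator (?F i) u)\<bar> \<partial>P)"
    by (rule integral_abs_bound)
  also have "\<dots> \<le> (\<integral>u. K / 2 ^ k + B * indicator ?E u \<partial>P)"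
  proof (rule integral_mono_AE)
    show "AE u in P. \<bar>f (Z u) - (\<Sum>i<I. f (s i) * indicator (?F i) u)\<bar> \<le> K / 2 ^ k + B * indicator ?E u"
      using near AE_space
    proof eventually_elim
      case (elim u)
      show ?case
      proof (cases "u \<in> ?E")
        case True
        then have "(\<Sum>i<I. f (s i) * indicator (?F i) u) = 0"
          by (intro sum.neutral) (auto simp: first_bit_def)
        then show ?thesis using True B[of "Z u"] K(2) by (simp add: add_increasing)
      next
        case False
        then obtain i where i: "i < I" "near_bit k i (c u)" using elim by auto
        define j where "j = (LEAST i. near_bit k i (c u))"
        have "near_bit k j (c u)" "j \<le> i"
          unfolding j_def by (rule LeastI[of "\<lambda>i. near_bit k i (c u)", OF i(2)], rule Least_le[of "\<lambda>i. near_bit k i (c u)", OF i(2)])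
        moreover have "\<not> near_bit k i' (c u)" if "i' < j" for i'
          using that unfolding j_def by (rule not_less_Least)
        ultimately have j: "near_bit k j (c u)" "j \<le> i" "\<And>i'. i' < j \<Longrightarrow> \<not> near_bit k i' (c u)" by blast+
        have fj: "first_bit k i' (c u) \<longleftrightarrow> i' = j" for i'
          unfolding first_bit_def using j(1,3) by (metis linorder_neqE_nat)
        have "(\<Sum>i<I. f (s i) * indicator (?F i) u) = (\<Sum>i<I. if i = j then f (s i) else 0)"
          using elim by (intro sum.cong) (auto simp: fj)
        also have "\<dots> = f (s j)" using i(1) j(2) by simp
        finally have "\<bar>f (Z u) - (\<Sum>i<I. f (s i) * indicator (?F i) u)\<bar> \<le> K * dist (Z u) (s j)"
          using K(1) by simp
        also have "\<dots> \<le> K * (1 / 2 ^ k)" using elim fj K(2) by (intro mult_left_mono) auto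
        finally show ?thesis using False by simp
      qed
    qed
  qed (use i1 i2 i3 in auto)
  also have "\<dots> = K / 2 ^ k + B * measure P ?E"
    using E by (subst Bochner_Integration.integral_add) (auto simp: prob_space emeasure_eq_measure)
  finally show ?thesis .
qed

lemma tent_Lipschitz: "\<exists>K\<ge>0. \<forall>x y. \<bar>tent s l x - tent s l y\<bar> \<le> K * dist x y"
proof (induction l)
  case Nil
  then show ?case by (intro exI[of _ 0]) simp
next
  case (Cons a l)
  then obtain K where K: "0 \<le> K" "\<And>x y. \<bar>tent s l x - tent s l y\<bar> \<le> K * dist x y" by blast
  obtain i q k where a: "a = (i, q, k)" by (cases a)
  let ?h = "\<lambda>x. real_of_rat q * max 0 (1 - real k * dist x (s i))"
  have h: "\<bar>?h x - ?h y\<bar> \<le> \<bar>real_of_rat q\<bar> * (real k * dist x y)" for x y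
  proof -
    have "\<bar>real k * dist y (s i) - real k * dist x (s i)\<bar> \<le> real k * dist x y"
      using abs_dist_diff_le[of y "s i" x]
      by (simp add: right_diff_distrib[symmetric] abs_mult dist_commute mult_left_mono)
    then have "\<bar>max 0 (1 - real k * dist x (s i)) - max 0 (1 - real k * dist y (s i))\<bar> \<le> real k * dist x y"
      by linarith
    then show ?thesis
      by (simp add: right_diff_distrib[symmetric] abs_mult mult_left_mono)
  qed
  have "\<bar>tent s (a # l) x - tent s (a # l) y\<bar> \<le> (K + \<bar>real_of_rat q\<bar> * real k) * dist x y" for x y
  proof -
    have "\<bar>max A (?h x) - max A' (?h y)\<bar> \<le> \<bar>A - A'\<bar> + \<bar>?h x - ?h y\<bar>" for A A' by linarith
    from this[of "tent s l x" "tent s l y"] K(2)[of x y] h[of x y] show ?thesis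
      by (simp add: a algebra_simps)
  qed
  then show ?case using K(1) by (intro exI[of _ "K + \<bar>real_of_rat q\<bar> * real k"]) simp
qed

lemma LIMSEQ_approx:
  fixes x :: "nat \<Rightarrow> real"
  assumes "\<And>e. e > 0 \<Longrightarrow> \<exists>a a0. a \<longlonglongrightarrow> a0 \<and> (\<forall>n. \<bar>x n - a n\<bar> \<le> e) \<and> \<bar>x0 - a0\<bar> \<le> e"
  shows "x \<longlonglongrightarrow> x0"
proof (rule LIMSEQ_I)
  fix r :: real assume "r > 0"
  then obtain a a0 where a: "a \<longlonglongrightarrow> a0" "\<And>n. \<bar>x n - a n\<bar> \<le> r/4" "\<bar>x0 - a0\<bar> \<le> r/4"
    using assms[of "r/4"] by auto
  obtain N where N: "\<And>n. n \<ge> N \<Longrightarrow> \<bar>a n - a0\<bar> < r/4" using LIMSEQ_D[OF a(1), of "r/4"] \<open>r > 0\<close> by auto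
  have "norm (x n - x0) < r" if "n \<ge> N" for n
    using a(2)[of n] a(3) N[OF that] \<open>r > 0\<close> unfolding real_norm_def by linarith
  then show "\<exists>N. \<forall>n\<ge>N. norm (x n - x0) < r" by blast
qed

text \<open>A cylinder event is a finite disjoint union of prefix events. The sequence
  \<open>\<lambda>i. l ! (n - Suc i)\<close> undoes the reversal of the prefix; its values from
  \<open>n\<close> on do not affect \<open>Q\<close>.\<close>

lemma measure_fin_dep:
  assumes P: "prob_space P" and c: "\<And>l. {u \<in> space P. prefix_bits (c u) (length l) = l} \<in> sets P"
    and n: "\<And>b b'. (\<forall>i<n. b i = b' i) \<Longrightarrow> Q b = Q b'"
  shows "{u \<in> space P. Q (c u)} \<in> sets P"
    and "measure P {u \<in> space P. Q (c u)} = (\<Sum>l | length l = n \<and> Q (\<lambda>i. l ! (n - Suc i)).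
      measure P {u \<in> space P. prefix_bits (c u) (length l) = l})"
proof -
  interpret prob_space P by (rule P)
  let ?L = "{l. length l = n \<and> Q (\<lambda>i. l ! (n - Suc i))}"
  have fin: "finite ?L" using finite_lists_length_eq[of "UNIV :: bool set" n] by (auto intro: finite_subset[rotated])
  have Q: "Q b \<longleftrightarrow> prefix_bits b n \<in> ?L" for b
    using n[of b "\<lambda>i. prefix_bits b n ! (n - Suc i)"] by (simp add: nth_prefix_bits)
  have eq: "{u \<in> space P. Q (c u)} = (\<Union>l\<in>?L. {u \<in> space P. prefix_bits (c u) (length l) = l})"
  proof (rule set_eqI)
    fix u
    show "u \<in> {u \<in> space P. Q (c u)} \<longleftrightarrow> u \<in> (\<Union>l\<in>?L. {u \<in> space P. prefix_bits (c u) (length l) = l})"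
      using Q[of "c u"] by auto
  qed
  have "measure P (\<Union>l\<in>?L. {u \<in> space P. prefix_bits (c u) (length l) = l})
      = (\<Sum>l\<in>?L. measure P {u \<in> space P. prefix_bits (c u) (length l) = l})"
    by (intro finite_measure_finite_Union fin) (auto simp: c disjoint_family_on_def image_subset_iff)
  with fin c show "{u \<in> space P. Q (c u)} \<in> sets P"
    and "measure P {u \<in> space P. Q (c u)} = (\<Sum>l\<in>?L. measure P {u \<in> space P. prefix_bits (c u) (length l) = l})"
    unfolding eq by auto
qed

text \<open>Tightness is stated with finitely many balls of each radius, which together with
  completeness stands for compact sets. It acts twice: it prevents the limit bits from having no
  near point at some scale, and it bounds the truncation error of the integrals uniformly in
  \<open>n\<close>.\<close>

theorem prokhorov_subseq:
  fixes s :: "nat \<Rightarrow> 'a::metric_space" and mu :: "nat \<Rightarrow> 'a measure"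
  assumes s: "dense_seq s" and compl: "\<And>X :: nat \<Rightarrow> 'a. Cauchy X \<Longrightarrow> convergent X" and mu: "\<And>n. mu n \<in> probs"
    and tight: "\<And>e d. e > 0 \<Longrightarrow> d > 0 \<Longrightarrow> \<exists>A. finite A \<and> (\<forall>n. measure (mu n) (\<Union>a\<in>A. ball a d) \<ge> 1 - e)"
  shows "\<exists>r m. strict_mono r \<and> m \<in> probs \<and> wk_conv (mu \<circ> r) m"
proof -
  define b where "b = code_bits s"
  have pm: "prob_space (mu n)" "space (mu n) = UNIV" "sets (mu n) = sets borel" for n
    using probsD[OF mu] by auto
  have bm: "Measurable.pred (mu n) (\<lambda>x. b x j)" for n j
  proof -
    have "{x. b x j} = ball (s (snd (prod_decode j))) (1 / 2 ^ fst (prod_decode j))"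
      by (auto simp: b_def code_bits_def dist_commute)
    then show ?thesis using pm by (simp add: pred_def)
  qed
  have pb_meas: "{x \<in> space (mu n). prefix_bits (b x) (length l) = l} \<in> sets (mu n)" for n l
  proof (induction l)
    case Nil
    then show ?case by simp
  next
    case (Cons a l)
    have "{x \<in> space (mu n). prefix_bits (b x) (length (a # l)) = a # l}
      = {x \<in> space (mu n). b x (length l) = a} \<inter> {x \<in> space (mu n). prefix_bits (b x) (length l) = l}" by auto
    moreover have "{x \<in> space (mu n). b x (length l) = a} \<in> sets (mu n)" using bm[of "length l" n] by (cases a) (simp_all add: pred_def)
    ultimately show ?case using Cons by simp
  qed
  define q where "q n l = measure (mu n) {x \<in> space (mu n). prefix_bits (b x) (length l) = l}" for n l
  have "q n l \<in> {0..1}" for n l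
    using prob_space.prob_le_1[OF pm(1)] by (simp add: q_def)
  then obtain r p where r: "strict_mono r" and p: "\<And>l. (\<lambda>n. q (r n) l) \<longlonglongrightarrow> p l"
    using convergent_subseq_fun[of q 0 1] by blast
  have qadd: "q n l = q n (False # l) + q n (True # l)" for n l
  proof -
    interpret prob_space "mu n" by (rule pm)
    have eq: "{x \<in> space (mu n). prefix_bits (b x) (length l) = l}
       = {x \<in> space (mu n). prefix_bits (b x) (length (False # l)) = False # l}
         \<union> {x \<in> space (mu n). prefix_bits (b x) (length (True # l)) = True # l}" by auto
    show ?thesis unfolding q_def eq by (rule finite_measure_Union[OF pb_meas pb_meas]) auto
  qed
  have "0 \<le> p l" for l by (rule LIMSEQ_le_const[OF p]) (simp add: q_def)
  moreover have "p [] = 1"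
    using LIMSEQ_unique[OF p[of "[]"]] prob_space.prob_space[OF pm(1)] by (simp add: q_def)
  moreover have "p l = p (False # l) + p (True # l)" for l
  proof (rule LIMSEQ_unique[OF p])
    show "(\<lambda>n. q (r n) l) \<longlonglongrightarrow> p (False # l) + p (True # l)"
      unfolding qadd[of _ l] by (intro tendsto_add p)
  qed
  ultimately obtain N :: "real measure" and c where N: "prob_space N"
    and c: "\<And>l. {u \<in> space N. prefix_bits (c u) (length l) = l} \<in> sets N"
    and cp: "\<And>l. measure N {u \<in> space N. prefix_bits (c u) (length l) = l} = p l"
    using ex_random_bits[of p] by blast
  interpret N: prob_space N by (rule N)
  have conv: "(\<lambda>n. measure (mu (r n)) {x. Q (b x)}) \<longlonglongrightarrow> measure N {u \<in> space N. Q (c u)}"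
    and Qm: "{u \<in> space N. Q (c u)} \<in> sets N" if "fin_dep Q" for Q
  proof -
    obtain n where n: "\<And>b b'. (\<forall>i<n. b i = b' i) \<Longrightarrow> Q b = Q b'" using \<open>fin_dep Q\<close> unfolding fin_dep_def by blast
    show "{u \<in> space N. Q (c u)} \<in> sets N" by (rule measure_fin_dep(1)[OF N c n])
    have "measure (mu k) {x. Q (b x)} = (\<Sum>l | length l = n \<and> Q (\<lambda>i. l ! (n - Suc i)). q k l)" for k
      using measure_fin_dep(2)[where P="mu k" and c=b and Q=Q, OF pm(1) pb_meas n] by (simp add: pm q_def)
    moreover have "measure N {u \<in> space N. Q (c u)} = (\<Sum>l | length l = n \<and> Q (\<lambda>i. l ! (n - Suc i)). p l)"
      unfolding cp[symmetric] by (rule measure_fin_dep(2)[OF N c n])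
    ultimately show "(\<lambda>n. measure (mu (r n)) {x. Q (b x)}) \<longlonglongrightarrow> measure N {u \<in> space N. Q (c u)}"
      by (simp only:) (intro tendsto_sum p)
  qed
  have nb [measurable]: "Measurable.pred N (\<lambda>u. near_bit k i (c u))" for k i
    using Qm[OF fin_dep_near] by (simp add: pred_def)
  have tail: "\<exists>I. (\<forall>n. measure (mu n) {x. \<forall>i<I. \<not> near_bit k i (b x)} \<le> e) \<and>
      measure N {u \<in> space N. \<forall>i<I. \<not> near_bit k i (c u)} \<le> e" if e: "e > 0" for e k
  proof -
    \<comment> \<open>Half the radius \<open>1 / 2 ^ k\<close> is spent on the ball about a centre
      in \<open>A\<close>, the other half on moving that centre to a point of the dense
      sequence.\<close>
    have "(1::real) / 2 ^ Suc k > 0" by simp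
    from tight[OF e this] obtain A where A: "finite A"
      "\<And>n. measure (mu n) (\<Union>a\<in>A. ball a (1 / 2 ^ Suc k)) \<ge> 1 - e" by blast
    have "\<forall>a. \<exists>i. dist a (s i) < 1 / 2 ^ Suc k" using dense_seqD[OF s] by simp
    then obtain \<iota> where \<iota>: "\<And>a. dist a (s (\<iota> a)) < 1 / 2 ^ Suc k" by metis
    obtain I where I: "\<And>a. a \<in> A \<Longrightarrow> \<iota> a < I"
      using finite_nat_set_iff_bounded[of "\<iota> ` A"] A(1) by auto
    have le: "measure (mu n) {x. \<forall>i<I. \<not> near_bit k i (b x)} \<le> e" for n
    proof -
      interpret prob_space "mu n" by (rule pm)
      let ?U = "\<Union>a\<in>A. ball a (1 / 2 ^ Suc k)"
      have half: "1 / 2 ^ Suc k + 1 / 2 ^ Suc k = (1 / 2 ^ k :: real)" by simp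
      have "near_bit k (\<iota> a) (b x)" if "x \<in> ball a (1 / 2 ^ Suc k)" for a x
        using that \<iota>[of a] dist_triangle[of x "s (\<iota> a)" a] half
        unfolding b_def near_bit_code mem_ball dist_commute[of a x] by linarith
      then have "{x. \<forall>i<I. \<not> near_bit k i (b x)} \<subseteq> space (mu n) - ?U"
        using I unfolding pm(2) by blast
      moreover have U: "?U \<in> sets (mu n)" unfolding pm by (intro borel_open) auto
      ultimately have "measure (mu n) {x. \<forall>i<I. \<not> near_bit k i (b x)} \<le> measure (mu n) (space (mu n) - ?U)"
        by (intro finite_measure_mono) auto
      also have "\<dots> \<le> e" using A(2)[of n] U by (simp add: prob_compl)
      finally show ?thesis .
    qed
    moreover have "measure N {u \<in> space N. \<forall>i<I. \<not> near_bit k i (c u)} \<le> e"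
      by (rule LIMSEQ_le_const2[OF conv[OF fin_dep_all_less[OF fin_dep_not[OF fin_dep_near]]]]) (use le in auto)
    ultimately show ?thesis by blast
  qed
  \<comment> \<open>Codes of actual points have both properties. The second excludes countably many
    cylinder events of probability \<open>0\<close> and passes to the limit at once; the first is no
    cylinder event and is saved by tightness.\<close>
  define good where "good u \<longleftrightarrow> (\<forall>k. \<exists>i. near_bit k i (c u)) \<and>
     (\<forall>k i k' i'. near_bit k i (c u) \<and> near_bit k' i' (c u) \<longrightarrow> dist (s i) (s i') < 1 / 2 ^ k + 1 / 2 ^ k')" for u
  have good_meas [measurable]: "Measurable.pred N good" unfolding good_def by measurable
  have ae1: "AE u in N. \<exists>i. near_bit k i (c u)" for k
  proof -
    have "measure N {u \<in> space N. \<not> (\<exists>i. near_bit k i (c u))} \<le> e" if e: "e > 0" for e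
    proof -
      obtain I where "measure N {u \<in> space N. \<forall>i<I. \<not> near_bit k i (c u)} \<le> e" using tail[OF e] by blast
      moreover have "measure N {u \<in> space N. \<not> (\<exists>i. near_bit k i (c u))} \<le> measure N {u \<in> space N. \<forall>i<I. \<not> near_bit k i (c u)}"
        by (rule N.finite_measure_mono) auto
      ultimately show ?thesis by simp
    qed
    then have "measure N {u \<in> space N. \<not> (\<exists>i. near_bit k i (c u))} = 0"
      by (rule antisym[OF field_le_epsilon measure_nonneg]) simp
    then show ?thesis by (subst AE_iff_measurable[OF _ refl]) (auto simp: N.emeasure_eq_measure)
  qed
  have ae2: "AE u in N. near_bit k i (c u) \<and> near_bit k' i' (c u) \<longrightarrow> dist (s i) (s i') < 1 / 2 ^ k + 1 / 2 ^ k'" for k i k' i'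
  proof (cases "dist (s i) (s i') < 1 / 2 ^ k + 1 / 2 ^ k'")
    case False
    have "\<not> (near_bit k i (b x) \<and> near_bit k' i' (b x))" for x
      using False dist_triangle3[of "s i" "s i'" x] unfolding b_def near_bit_code by linarith
    then have empty: "{x. near_bit k i (b x) \<and> near_bit k' i' (b x)} = {}" by blast
    have "(\<lambda>n. measure (mu (r n)) {x. near_bit k i (b x) \<and> near_bit k' i' (b x)}) \<longlonglongrightarrow> 0"
      unfolding empty by simp
    then have "measure N {u \<in> space N. near_bit k i (c u) \<and> near_bit k' i' (c u)} = 0"
      by (rule LIMSEQ_unique[OF conv[OF fin_dep_conj[OF fin_dep_near fin_dep_near]]])
    then have "AE u in N. \<not> (near_bit k i (c u) \<and> near_bit k' i' (c u))"
      by (subst AE_iff_measurable[OF _ refl]) (auto simp: N.emeasure_eq_measure)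
    then show ?thesis by eventually_elim blast
  qed simp
  have good: "AE u in N. good u"
    unfolding good_def using ae1 ae2 by (simp add: AE_all_countable)
  \<comment> \<open>The constant value off the good event makes the sequence Cauchy for every
    \<open>u\<close>, so that its limit is defined everywhere.\<close>
  define Zk where "Zk k u = (if good u then s (LEAST i. near_bit k i (c u)) else s 0)" for k u
  have Zk_meas: "Zk k \<in> borel_measurable N" for k
    unfolding Zk_def by measurable
  have near_least: "near_bit k (LEAST i. near_bit k i (c u)) (c u)" if "good u" for u k
    using that unfolding good_def by (meson LeastI_ex)
  have Zk_dist: "dist (Zk k u) (Zk k' u) < 1 / 2 ^ k + 1 / 2 ^ k'" for k k' u
  proof (cases "good u")
    case True
    then show ?thesis unfolding Zk_def using near_least[OF True] by (auto simp: good_def)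
  qed (simp add: Zk_def add_pos_pos)
  have half: "(\<lambda>k. 1 / 2 ^ k :: real) \<longlonglongrightarrow> 0"
    using LIMSEQ_realpow_zero[of "1/2 :: real"] by (simp add: power_one_over)
  have "Cauchy (\<lambda>k. Zk k u)" for u
  proof (rule metric_CauchyI)
    fix e :: real assume "e > 0"
    then obtain M where M: "\<And>k. k \<ge> M \<Longrightarrow> 1 / 2 ^ k < e / 2" 
      using order_tendstoD(2)[OF half, of "e/2"] by (auto simp: eventually_sequentially)
    show "\<exists>M. \<forall>m\<ge>M. \<forall>n\<ge>M. dist (Zk m u) (Zk n u) < e"
    proof (intro exI[of _ M] allI impI)
      fix m n assume "M \<le> m" "M \<le> n"
      then show "dist (Zk m u) (Zk n u) < e" using M[of m] M[of n] Zk_dist[of m u n] by linarith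
    qed
  qed
  then have "\<forall>u. \<exists>z. (\<lambda>k. Zk k u) \<longlonglongrightarrow> z" using compl unfolding convergent_def by blast
  then obtain Z where Z: "\<And>u. (\<lambda>k. Zk k u) \<longlonglongrightarrow> Z u" by metis
  have Z_meas: "Z \<in> borel_measurable N" by (rule borel_measurable_LIMSEQ_metric[OF Zk_meas Z])
  have Z_dist: "dist (Z u) (Zk k u) \<le> 1 / 2 ^ k" for u k
  proof (rule LIMSEQ_le[of "\<lambda>k'. dist (Zk k' u) (Zk k u)" _ "\<lambda>k'. 1 / 2 ^ k' + 1 / 2 ^ k"])
    show "(\<lambda>k'. dist (Zk k' u) (Zk k u)) \<longlonglongrightarrow> dist (Z u) (Zk k u)" by (intro tendsto_intros Z)
    show "(\<lambda>k'. 1 / 2 ^ k' + 1 / 2 ^ k :: real) \<longlonglongrightarrow> 1 / 2 ^ k" using tendsto_add[OF half tendsto_const] by simp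
    show "\<exists>N. \<forall>n\<ge>N. dist (Zk n u) (Zk k u) \<le> 1 / 2 ^ n + 1 / 2 ^ k" using Zk_dist less_imp_le by blast
  qed
  define m where "m = distr N borel Z"
  have m: "m \<in> probs" using N.prob_space_distr[OF Z_meas] by (simp add: m_def probs_def)
  have near_Z: "AE u in N. \<forall>i. first_bit k i (c u) \<longrightarrow> dist (Z u) (s i) \<le> 1 / 2 ^ k" for k
    using good
  proof eventually_elim
    case (elim u)
    have "i = (LEAST i. near_bit k i (c u))" if "first_bit k i (c u)" for i
      using that unfolding first_bit_def by (metis Least_equality not_le)
    then show ?case using Z_dist[of u k] elim by (auto simp: Zk_def)
  qed
  have cm: "Measurable.pred N (\<lambda>u. c u j)" for j
    using nb[of "fst (prod_decode j)" "snd (prod_decode j)"] by (simp add: near_bit_def)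
  have "wk_conv (mu \<circ> r) m"
  proof (subst wk_conv_iff_tent[OF s])
    show "(mu \<circ> r) n \<in> probs" for n using mu by simp
    show "m \<in> probs" by (rule m)
    show "\<forall>l. (\<lambda>n. integral\<^sup>L ((mu \<circ> r) n) (tent s l)) \<longlonglongrightarrow> integral\<^sup>L m (tent s l)"
    proof (intro allI LIMSEQ_approx)
      fix l and e :: real assume e: "e > 0"
      obtain B where B: "\<And>x. \<bar>tent s l x\<bar> \<le> B" using tent_bounded by blast
      obtain K where K: "0 \<le> K" "\<And>x y. \<bar>tent s l x - tent s l y\<bar> \<le> K * dist x y" using tent_Lipschitz by blast
      have B0: "0 \<le> B" using B[of "s 0"] by linarith
      have "(\<lambda>k. K * (1 / 2 ^ k)) \<longlonglongrightarrow> 0" by (rule tendsto_mult_right_zero[OF half])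
      then have "eventually (\<lambda>k. K * (1 / 2 ^ k) < e / 2) sequentially" using e by (intro order_tendstoD(2)) auto
      then obtain k where k: "K / 2 ^ k < e / 2" by (auto simp: eventually_sequentially)
      \<comment> \<open>The exceptional event contributes at most \<open>B\<close> times this, hence
        at most \<open>e / 2\<close>; the summand \<open>1\<close> covers the case
        \<open>B = 0\<close>.\<close>
      have "e / (2 * (B + 1)) > 0" using e B0 by simp
      from tail[OF this] obtain I where I: "\<And>n. measure (mu n) {x. \<forall>i<I. \<not> near_bit k i (b x)} \<le> e / (2 * (B + 1))"
        "measure N {u \<in> space N. \<forall>i<I. \<not> near_bit k i (c u)} \<le> e / (2 * (B + 1))" by blast
      have Be: "B * t \<le> e / 2" if "t \<le> e / (2 * (B + 1))" for t
      proof -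
        have "B * t \<le> B * (e / (2 * (B + 1)))" using that B0 by (rule mult_left_mono)
        also have "\<dots> \<le> e / 2" using e B0 by (simp add: field_simps)
        finally show ?thesis .
      qed
      let ?app = "\<lambda>n. \<Sum>i<I. tent s l (s i) * measure (mu (r n)) {x. first_bit k i (b x)}"
      let ?lim = "\<Sum>i<I. tent s l (s i) * measure N {u \<in> space N. first_bit k i (c u)}"
      have "?app \<longlonglongrightarrow> ?lim" by (intro tendsto_intros conv fin_dep_first)
      moreover have "\<bar>integral\<^sup>L ((mu \<circ> r) n) (tent s l) - ?app n\<bar> \<le> e" for n
      proof -
        have "\<bar>(\<integral>x. tent s l x \<partial>mu (r n)) - (\<Sum>i<I. tent s l (s i) * measure (mu (r n)) {x \<in> space (mu (r n)). first_bit k i (b x)})\<bar>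
           \<le> K / 2 ^ k + B * measure (mu (r n)) {x \<in> space (mu (r n)). \<forall>i<I. \<not> near_bit k i (b x)}"
          by (rule integral_code_approx[OF pm(1) bm _ borel_tent _ B K(2) K(1)])
             (auto simp: first_bit_def b_def near_bit_code measurable_ident_sets[OF pm(3)])
        also have "\<dots> \<le> e" using add_mono[OF less_imp_le[OF k] Be[OF I(1)[of "r n"]]] by (simp add: pm)
        finally show ?thesis by (simp add: pm)
      qed
      moreover have "\<bar>integral\<^sup>L m (tent s l) - ?lim\<bar> \<le> e"
      proof -
        have "integral\<^sup>L m (tent s l) = (\<integral>u. tent s l (Z u) \<partial>N)"
          unfolding m_def by (rule integral_distr[OF Z_meas borel_tent])
        moreover have "\<bar>(\<integral>u. tent s l (Z u) \<partial>N) - ?lim\<bar> \<le> K / 2 ^ k + B * measure N {u \<in> space N. \<forall>i<I. \<not> near_bit k i (c u)}"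
          by (rule integral_code_approx[OF N cm Z_meas borel_tent near_Z B K(2) K(1)])
        ultimately show ?thesis using k Be[OF I(2)] by linarith
      qed
      ultimately show "\<exists>a a0. a \<longlonglongrightarrow> a0 \<and> (\<forall>n. \<bar>integral\<^sup>L ((mu \<circ> r) n) (tent s l) - a n\<bar> \<le> e) \<and> \<bar>integral\<^sup>L m (tent s l) - a0\<bar> \<le> e"
        by blast
    qed
  qed
  with r m show ?thesis by blast
qed

section \<open>Empirical measures\<close>

lemma LIMSEQ_subsubseq:
  fixes x :: "nat \<Rightarrow> 'a::topological_space"
  assumes "\<And>r. strict_mono r \<Longrightarrow> \<exists>r'. strict_mono (r' :: nat \<Rightarrow> nat) \<and> (\<lambda>n. x (r (r' n))) \<longlonglongrightarrow> l"
  shows "x \<longlonglongrightarrow> l"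
proof (rule topological_tendstoI, rule ccontr)
  fix S assume S: "open S" "l \<in> S" and "\<not> eventually (\<lambda>n. x n \<in> S) sequentially"
  then obtain r :: "nat \<Rightarrow> nat" where r: "strict_mono r" "\<And>n. x (r n) \<notin> S"
    using not_eventually_sequentiallyD[of "\<lambda>n. x n \<in> S"] by blast
  obtain r' where "(\<lambda>n. x (r (r' n))) \<longlonglongrightarrow> l" using assms[OF r(1)] by blast
  from topological_tendstoD[OF this S] r(2) show False by simp
qed

lemma measurable_uniform_count: "z \<in> measurable (uniform_count_measure A) borel"
  by (simp add: measurable_def space_uniform_count_measure sets_uniform_count_measure)

lemma empirical_probs: "n \<ge> 1 \<Longrightarrow> empirical n z \<in> probs"
  unfolding empirical_def probs_def
  by (auto intro!: prob_space.prob_space_distr prob_space_uniform_count_measure measurable_uniform_count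
      simp: lessThan_empty_iff)

lemma integral_empirical:
  fixes f :: "'a::topological_space \<Rightarrow> real"
  assumes "f \<in> borel_measurable borel"
  shows "integral\<^sup>L (empirical n z) f = (\<Sum>i<n. f (z i)) / n"
  unfolding empirical_def
  by (subst integral_distr[OF measurable_uniform_count assms])
     (simp add: uniform_count_measure_def lebesgue_integral_point_measure_finite sum_divide_distrib)

lemma distr_empirical:
  assumes "g \<in> borel_measurable borel"
  shows "distr (empirical n z) borel g = empirical n (\<lambda>i. g (z i))"
  unfolding empirical_def by (subst distr_distr[OF assms measurable_uniform_count]) (simp add: comp_def)

lemma measurable_empirical:
  assumes n: "n \<ge> 1" and z: "\<And>i. i < n \<Longrightarrow> (\<lambda>\<omega>. z \<omega> i) \<in> borel_measurable M"
  shows "(\<lambda>\<omega>. empirical n (z \<omega>)) \<in> measurable M (prob_algebra borel)"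
proof (intro measurable_prob_algebraI measurable_subprob_algebra)
  show "prob_space (empirical n (z \<omega>))" "sets (empirical n (z \<omega>)) = sets borel" for \<omega>
    using probsD(1,2)[OF empirical_probs[OF n, of "z \<omega>"]] by auto
  then show "subprob_space (empirical n (z \<omega>))" for \<omega> by (blast intro: prob_space_imp_subprob_space)
  fix A :: "'b set" assume A: "A \<in> sets borel"
  have ind: "(indicator A :: 'b \<Rightarrow> real) \<in> borel_measurable borel" using A by simp
  have "emeasure (empirical n (z \<omega>)) A = ennreal ((\<Sum>i<n. indicator A (z \<omega> i)) / n)" for \<omega>
  proof -
    interpret prob_space "empirical n (z \<omega>)" by (rule probsD(1)[OF empirical_probs[OF n]])
    show ?thesis
      unfolding emeasure_eq_measure integral_empirical[OF ind, symmetric]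
      using integral_indicator_probs[OF empirical_probs[OF n] A] by simp
  qed
  moreover have "(\<lambda>\<omega>. ennreal ((\<Sum>i<n. indicator A (z \<omega> i)) / n)) \<in> borel_measurable M"
    using measurable_compose[OF z ind] by (intro measurable_compose[OF _ measurable_ennreal] borel_measurable_divide borel_measurable_sum) auto
  ultimately show "(\<lambda>\<omega>. emeasure (empirical n (z \<omega>)) A) \<in> borel_measurable M" by simp
qed

lemma integral_empirical_perturb:
  fixes f :: "'a::topological_space \<Rightarrow> real"
  assumes f: "f \<in> borel_measurable borel" and B: "\<And>x. \<bar>f x\<bar> \<le> B" and eq: "\<And>j. j < n \<Longrightarrow> j \<noteq> i \<Longrightarrow> z j = z' j"
  shows "\<bar>integral\<^sup>L (empirical n z) f - integral\<^sup>L (empirical n z') f\<bar> \<le> 2 * B / n"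
proof -
  have B0: "0 \<le> B" using B[of undefined] by linarith
  have "\<bar>(\<Sum>j<n. f (z j)) - (\<Sum>j<n. f (z' j))\<bar> \<le> (\<Sum>j<n. \<bar>f (z j) - f (z' j)\<bar>)"
    unfolding sum_subtractf[symmetric] by (rule sum_abs)
  also have "\<dots> \<le> (\<Sum>j<n. if j = i then 2 * B else 0)"
  proof (rule sum_mono)
    fix j assume "j \<in> {..<n}"
    then show "\<bar>f (z j) - f (z' j)\<bar> \<le> (if j = i then 2 * B else 0)"
      using eq[of j] B[of "z j"] B[of "z' j"] by auto
  qed
  also have "\<dots> \<le> 2 * B" using B0 by simp
  finally show ?thesis
    unfolding integral_empirical[OF f] diff_divide_distrib[symmetric] by (simp add: divide_right_mono)
qed

section \<open>Measures on a product with a compact factor\<close>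

lemma borel_measurable_fst: "(fst :: 'a::topological_space \<times> 'b::topological_space \<Rightarrow> 'a) \<in> borel_measurable borel"
  by (intro borel_measurable_continuous_onI continuous_intros)

lemma distr_fst_probs:
  fixes m :: "('a::topological_space \<times> 'b::topological_space) measure"
  assumes "m \<in> probs" shows "distr m borel fst \<in> probs"
  using prob_space.prob_space_distr[OF probsD(1)[OF assms] borel_measurable_probs[OF assms borel_measurable_fst]]
  by (simp add: probs_def)

lemma wk_conv_fst:
  fixes m :: "('a::topological_space \<times> 'b::topological_space) measure"
  assumes mu: "\<And>n. mu n \<in> probs" and m: "m \<in> probs" and w: "wk_conv mu m"
  shows "wk_conv (\<lambda>n. distr (mu n) borel fst) (distr m borel fst)"
  unfolding wk_conv_def
proof (intro allI impI)
  fix f :: "'a \<Rightarrow> real" assume f: "continuous_on UNIV f \<and> bounded (range f)"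
  then have fm: "f \<in> borel_measurable borel" by (intro borel_measurable_continuous_onI) simp
  have eq: "integral\<^sup>L (distr m' borel fst) f = integral\<^sup>L m' (\<lambda>z. f (fst z))" if "m' \<in> probs" for m' :: "('a \<times> 'b) measure"
    by (rule integral_distr[OF borel_measurable_probs[OF that borel_measurable_fst] fm])
  obtain B where "\<And>x. \<bar>f x\<bar> \<le> B" using f by (auto simp: bounded_iff)
  moreover have "continuous_on UNIV (\<lambda>z :: 'a \<times> 'b. f (fst z))"
    by (rule continuous_on_compose2[of UNIV f]) (use f in \<open>auto intro: continuous_intros\<close>)
  ultimately have "(\<lambda>n. integral\<^sup>L (mu n) (\<lambda>z. f (fst z))) \<longlonglongrightarrow> integral\<^sup>L m (\<lambda>z. f (fst z))"
    by (intro wk_convD[OF w, of _ B]) auto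
  then show "(\<lambda>n. integral\<^sup>L (distr (mu n) borel fst) f) \<longlonglongrightarrow> integral\<^sup>L (distr m borel fst) f"
    unfolding eq[OF mu] eq[OF m] .
qed

text \<open>Le Cam's observation: one finite union of balls that is large for the limit is large for
  all late measures, because it is open; each of the finitely many earlier measures has its own
  union, and the largest index serves all.\<close>

lemma tight_of_wk_conv:
  fixes t :: "nat \<Rightarrow> 'a::metric_space"
  assumes t: "dense_seq t" and mu: "\<And>n. mu n \<in> probs" and m: "m \<in> probs" and w: "wk_conv mu m"
    and e: "e > 0" and d: "d > 0"
  shows "\<exists>N. \<forall>n. measure (mu n) (\<Union>i<N. ball (t i) d) \<ge> 1 - (e :: real)"
proof -
  let ?U = "\<lambda>N. \<Union>i<N. ball (t i) d"
  have U: "open (?U N)" for N by auto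
  have single: "\<exists>N. measure m' (?U N) > 1 - e'" if m': "m' \<in> probs" and e': "e' > (0::real)" for m' e'
  proof -
    interpret prob_space m' using m' by (simp add: probsD)
    have "(\<Union>N. ?U N) = UNIV"
    proof (intro set_eqI iffI UNIV_I)
      fix x :: 'a
      obtain i where "dist x (t i) < d" using dense_seqD[OF t d] by blast
      then have "x \<in> ?U (Suc i)" by (auto simp: dist_commute)
      then show "x \<in> (\<Union>N. ?U N)" by blast
    qed
    then have "(\<lambda>N. measure m' (?U N)) \<longlonglongrightarrow> 1"
      using finite_Lim_measure_incseq[of ?U] probsD[OF m'] prob_space
      by (simp add: image_subset_iff incseq_def UN_mono)
    then have "eventually (\<lambda>N. measure m' (?U N) > 1 - e') sequentially"
      using e' by (intro order_tendstoD) auto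
    then show ?thesis using eventually_happens'[OF sequentially_bot] by blast
  qed
  obtain N0 where N0: "measure m (?U N0) > 1 - e/2" using single[OF m, of "e/2"] e by auto
  have "eventually (\<lambda>n. measure (mu n) (?U N0) > measure m (?U N0) - e/2) sequentially"
    using e by (intro portmanteau_open[OF t mu m w U]) simp
  then obtain K where K: "\<And>n. n \<ge> K \<Longrightarrow> measure (mu n) (?U N0) > measure m (?U N0) - e/2"
    by (auto simp: eventually_sequentially)
  have "\<forall>n. \<exists>N. measure (mu n) (?U N) > 1 - e" using single[OF mu e] by blast
  then obtain N1 where N1: "\<And>n. measure (mu n) (?U (N1 n)) > 1 - e" by metis
  define N where "N = Max (insert N0 (N1 ` {..<K}))"
  have "measure (mu n) (?U N) \<ge> 1 - e" for n
  proof -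
    interpret prob_space "mu n" using mu by (simp add: probsD)
    have mono: "measure (mu n) (?U N') \<le> measure (mu n) (?U N)" if "N' \<le> N" for N'
      using that U[of N] probsD(2)[OF mu] by (intro finite_measure_mono) fastforce+
    show ?thesis
    proof (cases "n < K")
      case True
      then have "N1 n \<le> N" unfolding N_def by (intro Max_ge) auto
      then show ?thesis using mono N1[of n] by fastforce
    next
      case False
      have "N0 \<le> N" unfolding N_def by (intro Max_ge) auto
      then show ?thesis using mono[of N0] K[of n] False N0 by simp
    qed
  qed
  then show ?thesis by blast
qed

text \<open>Balls of radius \<open>d/2\<close> that nearly carry the marginals, combined with a
  finite \<open>d/2\<close>-net of the compact factor, give balls of radius \<open>d\<close> that
  nearly carry the joint measures. Compactness of the factor also supplies completeness of the
  product.\<close>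

lemma wk_conv_subseq_of_marginal:
  fixes mu :: "nat \<Rightarrow> ('w::polish_space \<times> 'x::metric_space) measure"
  assumes X: "compact (UNIV :: 'x set)" and mu: "\<And>n. mu n \<in> probs" and lam: "lam \<in> probs"
    and w: "wk_conv (\<lambda>n. distr (mu n) borel fst) lam"
  shows "\<exists>r m. strict_mono r \<and> m \<in> probs \<and> wk_conv (mu \<circ> r) m \<and> distr m borel fst = lam"
proof -
  obtain t :: "nat \<Rightarrow> 'w" where t: "dense_seq t" using ex_dense_seq_second_countable by blast
  obtain u :: "nat \<Rightarrow> 'x" where "dense_seq u" using ex_dense_seq_compact[OF X] by blast
  then obtain s :: "nat \<Rightarrow> 'w \<times> 'x" where s: "dense_seq s" using ex_dense_seq_prod[OF t] by blast
  have "\<exists>r m. strict_mono r \<and> m \<in> probs \<and> wk_conv (mu \<circ> r) m"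
  proof (rule prokhorov_subseq[OF s _ mu])
    fix Z :: "nat \<Rightarrow> 'w \<times> 'x" assume Z: "Cauchy Z"
    obtain a where a: "(\<lambda>n. fst (Z n)) \<longlonglongrightarrow> a" using Cauchy_convergent[OF Cauchy_fst[OF Z]] by (auto simp: convergent_def)
    obtain b where b: "(\<lambda>n. snd (Z n)) \<longlonglongrightarrow> b"
      using compact_imp_complete[OF X] Cauchy_snd[OF Z] unfolding complete_def by blast
    show "convergent Z" using tendsto_Pair[OF a b] by (auto simp: convergent_def)
  next
    fix e d :: real assume e: "e > 0" and d: "d > 0"
    obtain N where N: "\<And>n. measure (distr (mu n) borel fst) (\<Union>i<N. ball (t i) (d/2)) \<ge> 1 - e"
      using tight_of_wk_conv[OF t distr_fst_probs[OF mu] lam w e, of "d/2"] d by auto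
    obtain AX :: "'x set" where AX: "finite AX" "UNIV \<subseteq> (\<Union>x\<in>AX. ball x (d/2))"
      using X d unfolding compact_eq_totally_bounded by (meson half_gt_zero)
    let ?A = "t ` {..<N} \<times> AX"
    have "measure (mu n) (\<Union>a\<in>?A. ball a d) \<ge> 1 - e" for n
    proof -
      interpret prob_space "mu n" using mu by (simp add: probsD)
      have "fst -` (\<Union>i<N. ball (t i) (d/2)) \<inter> space (mu n) \<subseteq> (\<Union>a\<in>?A. ball a d)"
      proof
        fix z assume "z \<in> fst -` (\<Union>i<N. ball (t i) (d/2)) \<inter> space (mu n)"
        then obtain i where i: "i < N" "dist (t i) (fst z) < d/2" by auto
        obtain x where x: "x \<in> AX" "dist x (snd z) < d/2" using AX(2) by (meson UNIV_I UN_E mem_ball subsetD)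
        have "dist (t i, x) z \<le> dist (t i) (fst z) + dist x (snd z)"
          using sqrt_sum_squares_le_sum[of "dist (t i) (fst z)" "dist x (snd z)"] by (simp add: dist_prod_def)
        then have "z \<in> ball (t i, x) d" using i x by simp
        then show "z \<in> (\<Union>a\<in>?A. ball a d)" using i x by blast
      qed
      moreover have "(\<Union>a\<in>?A. ball a d) \<in> sets (mu n)" unfolding probsD(2)[OF mu] by (intro borel_open) auto
      ultimately have "measure (mu n) (fst -` (\<Union>i<N. ball (t i) (d/2)) \<inter> space (mu n)) \<le> measure (mu n) (\<Union>a\<in>?A. ball a d)"
        by (rule finite_measure_mono)
      moreover have "measure (distr (mu n) borel fst) (\<Union>i<N. ball (t i) (d/2))
        = measure (mu n) (fst -` (\<Union>i<N. ball (t i) (d/2)) \<inter> space (mu n))"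
        by (rule measure_distr[OF borel_measurable_probs[OF mu borel_measurable_fst]]) auto
      ultimately show ?thesis using N[of n] by simp
    qed
    moreover have "finite ?A" using AX by simp
    ultimately show "\<exists>A. finite A \<and> (\<forall>n. measure (mu n) (\<Union>a\<in>A. ball a d) \<ge> 1 - e)" by blast
  qed
  then obtain r m where r: "strict_mono r" and m: "m \<in> probs" and c: "wk_conv (mu \<circ> r) m" by blast
  have "wk_conv (\<lambda>n. distr (mu (r n)) borel fst) (distr m borel fst)"
    using wk_conv_fst[OF _ m c] mu by simp
  moreover have "wk_conv (\<lambda>n. distr (mu (r n)) borel fst) lam"
    using wk_conv_compose[OF w filterlim_subseq[OF r]] .
  ultimately have "distr m borel fst = lam"
    using wk_conv_unique[OF t distr_fst_probs[OF mu] distr_fst_probs[OF m] lam] by blast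
  with r m c show ?thesis by blast
qed

section \<open>The static game\<close>

lemma compact_subseq:
  fixes y :: "nat \<Rightarrow> 'x::metric_space"
  assumes "compact (UNIV :: 'x set)"
  shows "\<exists>r y0. strict_mono r \<and> (\<lambda>n. y (r n)) \<longlonglongrightarrow> y0"
  using compact_imp_seq_compact[OF assms] unfolding seq_compact_def comp_def by blast

locale static_game =
  fixes C :: "'w::polish_space \<Rightarrow> 'x::metric_space set"
    and F :: "('w \<times> 'x) measure \<Rightarrow> 'w \<Rightarrow> 'x \<Rightarrow> real"
  assumes X_compact: "compact (UNIV :: 'x set)"
    and C_ne: "\<And>w. C w \<noteq> {}"
    and C_graph_closed: "closed {(w, x). x \<in> C w}"
    and C_lower: "\<And>ws w x. ws \<longlonglongrightarrow> w \<Longrightarrow> x \<in> C w \<Longrightarrow>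
                    \<exists>r xs. strict_mono r \<and> (\<forall>k. xs k \<in> C (ws (r k))) \<and> xs \<longlonglongrightarrow> x"
    and F_bounded: "bounded ((\<lambda>(m, w, x). F m w x) ` (probs \<times> UNIV \<times> UNIV))"
    and F_cont: "\<And>ms m ws w xs x. (\<And>k. ms k \<in> probs) \<Longrightarrow> m \<in> probs \<Longrightarrow> wk_conv ms m \<Longrightarrow>
                    ws \<longlonglongrightarrow> w \<Longrightarrow> xs \<longlonglongrightarrow> x \<Longrightarrow>
                    (\<lambda>k. F (ms k) (ws k) (xs k)) \<longlonglongrightarrow> F m w x"
begin

definition bnd :: real where
  "bnd = (SOME B. \<forall>m\<in>probs. \<forall>w x. \<bar>F m w x\<bar> \<le> B)"

lemma F_bnd: "m \<in> probs \<Longrightarrow> \<bar>F m w x\<bar> \<le> bnd"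
proof -
  obtain B where "\<forall>z\<in>(\<lambda>(m, w, x). F m w x) ` (probs \<times> UNIV \<times> UNIV). norm z \<le> B"
    using F_bounded unfolding bounded_iff by blast
  then have "\<forall>m\<in>probs. \<forall>w x. \<bar>F m w x\<bar> \<le> B" by force
  then have "\<forall>m\<in>probs. \<forall>w x. \<bar>F m w x\<bar> \<le> bnd" unfolding bnd_def by (rule someI)
  then show "m \<in> probs \<Longrightarrow> \<bar>F m w x\<bar> \<le> bnd" by blast
qed

section \<open>The value function and Berge's maximum theorem\<close>

definition V :: "('w \<times> 'x) measure \<Rightarrow> 'w \<Rightarrow> real" where
  "V m w = (INF y\<in>C w. F m w y)"

lemma F_bdd_below: "m \<in> probs \<Longrightarrow> bdd_below (F m w ` A)"
  using F_bnd[of m w] by (intro bdd_belowI[of _ "- bnd"]) (auto simp: abs_le_iff minus_le_iff)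

lemma V_le: "m \<in> probs \<Longrightarrow> x \<in> C w \<Longrightarrow> V m w \<le> F m w x"
  unfolding V_def by (intro cINF_lower F_bdd_below)

lemma V_ge: "(\<And>y. y \<in> C w \<Longrightarrow> a \<le> F m w y) \<Longrightarrow> a \<le> V m w"
  unfolding V_def using C_ne by (intro cINF_greatest) auto

lemma V_bnd: assumes "m \<in> probs" shows "\<bar>V m w\<bar> \<le> bnd"
proof -
  obtain x where "x \<in> C w" using C_ne by blast
  then have "V m w \<le> bnd" using V_le[OF assms] F_bnd[OF assms, of w x] by fastforce
  moreover have "- bnd \<le> V m w" using F_bnd[OF assms, of w] by (intro V_ge) (simp add: abs_le_iff minus_le_iff)
  ultimately show ?thesis by (simp add: abs_le_iff)
qed

text \<open>Both halves are by contradiction along a subsequence. Upper half: a nearly optimal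
  strategy at \<open>w\<close> is a limit of feasible ones, by lower hemicontinuity. Lower half:
  near-minimisers have a limit point because the strategy space is compact, and it is feasible
  because the graph is closed.\<close>

lemma V_cont:
  assumes ms: "\<And>k. ms k \<in> probs" and m: "m \<in> probs" and c: "wk_conv ms m" and ws: "ws \<longlonglongrightarrow> w"
  shows "(\<lambda>k. V (ms k) (ws k)) \<longlonglongrightarrow> V m w"
proof (rule order_tendstoI; rule ccontr)
  fix a assume a: "V m w < a" and "\<not> eventually (\<lambda>k. V (ms k) (ws k) < a) sequentially"
  then obtain r :: "nat \<Rightarrow> nat" where r: "strict_mono r" "\<And>k. a \<le> V (ms (r k)) (ws (r k))"
    using not_eventually_sequentiallyD[of "\<lambda>k. V (ms k) (ws k) < a"] by (auto simp: not_less)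
  obtain y where y: "y \<in> C w" "F m w y < a"
    using a C_ne cINF_less_iff[OF _ F_bdd_below[OF m]] unfolding V_def by blast
  obtain r' xs where r': "strict_mono r'" "\<And>k. xs k \<in> C (ws (r (r' k)))" "xs \<longlonglongrightarrow> y"
    using C_lower[OF LIMSEQ_subseq_LIMSEQ[OF ws r(1)] y(1)] by (auto simp: comp_def)
  have sub: "filterlim (\<lambda>k. r (r' k)) sequentially sequentially"
    by (rule filterlim_compose[OF filterlim_subseq[OF r(1)] filterlim_subseq[OF r'(1)]])
  have "(\<lambda>k. F (ms (r (r' k))) (ws (r (r' k))) (xs k)) \<longlonglongrightarrow> F m w y"
    by (intro F_cont ms m wk_conv_compose[OF c sub] filterlim_compose[OF ws sub] r')
  moreover have "a \<le> F (ms (r (r' k))) (ws (r (r' k))) (xs k)" for k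
    using r(2)[of "r' k"] V_le[OF ms r'(2)] by (rule order_trans)
  ultimately have "a \<le> F m w y" by (intro LIMSEQ_le_const) auto
  with y show False by simp
next
  fix a assume a: "a < V m w" and "\<not> eventually (\<lambda>k. a < V (ms k) (ws k)) sequentially"
  then obtain r :: "nat \<Rightarrow> nat" where r: "strict_mono r" "\<And>k. V (ms (r k)) (ws (r k)) \<le> a"
    using not_eventually_sequentiallyD[of "\<lambda>k. a < V (ms k) (ws k)"] by (auto simp: not_less)
  have "\<exists>y. y \<in> C (ws (r k)) \<and> F (ms (r k)) (ws (r k)) y < a + 1 / real (Suc k)" for k
  proof -
    have "V (ms (r k)) (ws (r k)) < a + 1 / real (Suc k)" using r(2)[of k] by (simp add: add_strict_increasing2 less_le_trans le_less_trans)
    then show ?thesis using C_ne cINF_less_iff[OF _ F_bdd_below[OF ms]] unfolding V_def by blast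
  qed
  then obtain ys where ys: "\<And>k. ys k \<in> C (ws (r k))" "\<And>k. F (ms (r k)) (ws (r k)) (ys k) < a + 1 / real (Suc k)" by metis
  obtain r' y where r': "strict_mono r'" "(\<lambda>k. ys (r' k)) \<longlonglongrightarrow> y" using compact_subseq[OF X_compact] by blast
  have sub: "filterlim (\<lambda>k. r (r' k)) sequentially sequentially"
    by (rule filterlim_compose[OF filterlim_subseq[OF r(1)] filterlim_subseq[OF r'(1)]])
  have "(\<lambda>k. (ws (r (r' k)), ys (r' k))) \<longlonglongrightarrow> (w, y)"
    by (intro tendsto_Pair filterlim_compose[OF ws sub] r')
  then have "(w, y) \<in> {(w, x). x \<in> C w}"
    using ys(1) by (intro Lim_in_closed_set[OF C_graph_closed]) auto
  then have "V m w \<le> F m w y" using V_le[OF m] by simp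
  moreover have "F m w y \<le> a + 0"
  proof (rule LIMSEQ_le)
    show "(\<lambda>k. F (ms (r (r' k))) (ws (r (r' k))) (ys (r' k))) \<longlonglongrightarrow> F m w y"
      by (intro F_cont ms m wk_conv_compose[OF c sub] filterlim_compose[OF ws sub] r')
    show "(\<lambda>k. a + 1 / real (Suc (r' k))) \<longlonglongrightarrow> a + 0"
      by (intro tendsto_add tendsto_const filterlim_compose[OF LIMSEQ_Suc[OF lim_1_over_n] filterlim_subseq[OF r'(1)]])
    show "\<exists>N. \<forall>k\<ge>N. F (ms (r (r' k))) (ws (r (r' k))) (ys (r' k)) \<le> a + 1 / real (Suc (r' k))"
      using ys(2) less_imp_le by blast
  qed
  ultimately show False using a by simp
qed

definition Gr :: "('w \<times> 'x) set" where "Gr = {(w, x). x \<in> C w}"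

text \<open>Truncating the distance to the graph keeps \<open>gap\<close> bounded.\<close>

definition gap :: "('w \<times> 'x) measure \<Rightarrow> 'w \<times> 'x \<Rightarrow> real" where
  "gap m z = min 1 (infdist z Gr) + \<bar>F m (fst z) (snd z) - V m (fst z)\<bar>"

definition eq_gap :: "('w \<times> 'x) measure \<Rightarrow> real" where
  "eq_gap m = integral\<^sup>L m (gap m)"

lemma Gr_ne: "Gr \<noteq> {}"
  using C_ne unfolding Gr_def by fast

lemma gap_bounds: "m \<in> probs \<Longrightarrow> gap m z \<in> {0..1 + 2 * bnd}"
  using F_bnd[of m "fst z" "snd z"] V_bnd[of m "fst z"] infdist_nonneg[of z Gr] unfolding gap_def by (auto simp: min_def)

lemma gap_cont:
  assumes ms: "\<And>k. ms k \<in> probs" and m: "m \<in> probs" and c: "wk_conv ms m" and z: "z \<longlonglongrightarrow> z0"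
  shows "(\<lambda>k. gap (ms k) (z k)) \<longlonglongrightarrow> gap m z0"
proof -
  have "(\<lambda>k. infdist (z k) Gr) \<longlonglongrightarrow> infdist z0 Gr" by (intro tendsto_infdist z)
  moreover have "(\<lambda>k. F (ms k) (fst (z k)) (snd (z k))) \<longlonglongrightarrow> F m (fst z0) (snd z0)"
    by (intro F_cont ms m c tendsto_fst tendsto_snd z)
  moreover have "(\<lambda>k. V (ms k) (fst (z k))) \<longlonglongrightarrow> V m (fst z0)" by (intro V_cont ms m c tendsto_fst z)
  ultimately show ?thesis unfolding gap_def by (intro tendsto_add tendsto_min tendsto_const tendsto_rabs tendsto_diff)
qed

lemma borel_gap:
  assumes m: "m \<in> probs" shows "gap m \<in> borel_measurable borel"
proof (rule borel_measurable_continuous_onI)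
  have "wk_conv (\<lambda>_. m) m" by (simp add: wk_conv_def)
  then show "continuous_on UNIV (gap m)"
    unfolding continuous_on_sequentially using gap_cont[of "\<lambda>_. m" m] m by (auto simp: comp_def)
qed

lemma integrable_gap: "m \<in> probs \<Longrightarrow> integrable m (gap m)"
  using gap_bounds by (intro integrable_bounded_probs[of m _ "1 + 2 * bnd"] borel_gap) auto

lemma eq_gap_bounds:
  assumes m: "m \<in> probs" shows "eq_gap m \<in> {0..1 + 2 * bnd}"
proof -
  have "integral\<^sup>L m (gap m) \<le> integral\<^sup>L m (\<lambda>_. 1 + 2 * bnd)"
    using gap_bounds[OF m] integrable_gap[OF m] integrable_bounded_probs[OF m, of "\<lambda>_. 1 + 2 * bnd"]
    by (intro integral_mono) auto
  moreover have "0 \<le> integral\<^sup>L m (gap m)" using gap_bounds[OF m] by (intro Bochner_Integration.integral_nonneg) auto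
  ultimately show ?thesis
    unfolding eq_gap_def integral_const_probs[OF m] by simp
qed

text \<open>The integrand depends on the measure, so weak convergence alone does not suffice; joint
  continuity of \<open>gap\<close> is precisely continuous convergence of the integrands.\<close>

lemma eq_gap_cont:
  assumes ms: "\<And>k. ms k \<in> probs" and m: "m \<in> probs" and c: "wk_conv ms m"
  shows "(\<lambda>k. eq_gap (ms k)) \<longlonglongrightarrow> eq_gap m"
  unfolding eq_gap_def
proof (rule tendsto_integral_varying[OF gap_bounds[OF ms] borel_gap[OF ms] borel_gap[OF m] _ ms m c])
  show "(\<lambda>j. gap (ms (\<kappa> j)) (z j)) \<longlonglongrightarrow> gap m x" if "filterlim \<kappa> sequentially sequentially" "z \<longlonglongrightarrow> x" for \<kappa> z x
    using that by (intro gap_cont ms m wk_conv_compose[OF c])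
qed

lemma wcont_eq_gap: "wcont eq_gap"
  unfolding wcont_def using eq_gap_cont by blast

lemma eq_gap_zero:
  assumes m: "m \<in> probs" and 0: "eq_gap m = 0"
  shows "m \<in> Meq C F (distr m borel fst)"
proof -
  have "AE z in m. gap m z = 0"
    using 0 gap_bounds[OF m] integral_nonneg_eq_0_iff_AE[OF integrable_gap[OF m]] unfolding eq_gap_def by auto
  then have "AE z in m. snd z \<in> C (fst z) \<and> F m (fst z) (snd z) = (INF y\<in>C (fst z). F m (fst z) y)"
  proof eventually_elim
    case (elim z)
    have "infdist z Gr = 0" "F m (fst z) (snd z) = V m (fst z)"
      using elim infdist_nonneg[of z Gr] unfolding gap_def by (auto simp: min_def add_nonneg_eq_0_iff split: if_splits)
    moreover have "closed Gr" using C_graph_closed unfolding Gr_def .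
    ultimately have "z \<in> Gr" using Gr_ne in_closed_iff_infdist_zero by blast
    then show ?case using \<open>F m (fst z) (snd z) = V m (fst z)\<close> by (auto simp: Gr_def V_def)
  qed
  then show ?thesis using m by (simp add: Meq_def)
qed

text \<open>The sequence index is separate from the number \<open>n k\<close> of players, and each
  entry has its own profile. This makes the notion stable under subsequences and allows a different
  sample point at each index.\<close>

definition near_nash :: "(nat \<Rightarrow> ('w \<times> 'x) measure) \<Rightarrow> bool" where
  "near_nash ms \<longleftrightarrow> (\<exists>n e w x. filterlim n sequentially sequentially \<and> e \<longlonglongrightarrow> 0 \<and>
     (\<forall>k. n k \<ge> 1 \<and> nash_eq C F (e k) (n k) (w k) (x k) \<and> ms k = empirical (n k) (\<lambda>i. (w k i, x k i))))"

lemma near_nash_probs: "near_nash ms \<Longrightarrow> ms k \<in> probs"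
  unfolding near_nash_def using empirical_probs by fastforce

lemma near_nash_subseq:
  assumes "near_nash ms" and r: "filterlim r sequentially sequentially" shows "near_nash (\<lambda>k. ms (r k))"
proof -
  obtain n e w x where *: "filterlim n sequentially sequentially" "e \<longlonglongrightarrow> 0"
     "\<And>k. n k \<ge> 1 \<and> nash_eq C F (e k) (n k) (w k) (x k) \<and> ms k = empirical (n k) (\<lambda>i. (w k i, x k i))"
    using assms(1) unfolding near_nash_def by blast
  show ?thesis unfolding near_nash_def
    by (intro exI[of _ "\<lambda>k. n (r k)"] exI[of _ "\<lambda>k. e (r k)"] exI[of _ "\<lambda>k. w (r k)"] exI[of _ "\<lambda>k. x (r k)"]
        conjI allI filterlim_compose[OF *(1) r] filterlim_compose[OF *(2) r]) (use *(3) in auto)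
qed

lemma wk_conv_perturb:
  fixes z z' :: "nat \<Rightarrow> nat \<Rightarrow> 'a::metric_space"
  assumes c: "wk_conv (\<lambda>k. empirical (n k) (z k)) m" and n: "filterlim n sequentially sequentially"
    and eq: "\<And>k j. j \<noteq> i k \<Longrightarrow> z k j = z' k j"
  shows "wk_conv (\<lambda>k. empirical (n k) (z' k)) m"
  unfolding wk_conv_def
proof (intro allI impI)
  fix f :: "'a \<Rightarrow> real" assume f: "continuous_on UNIV f \<and> bounded (range f)"
  then obtain B where B: "\<And>x. \<bar>f x\<bar> \<le> B" by (auto simp: bounded_iff)
  have fm: "f \<in> borel_measurable borel" using f by (intro borel_measurable_continuous_onI) simp
  let ?I = "\<lambda>z k. integral\<^sup>L (empirical (n k) (z k)) f"
  have "(\<lambda>k. ?I z' k - ?I z k) \<longlonglongrightarrow> 0"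
  proof (rule Lim_null_comparison)
    show "eventually (\<lambda>k. norm (?I z' k - ?I z k) \<le> 2 * B / real (n k)) sequentially"
    proof (intro always_eventually allI)
      show "norm (?I z' k - ?I z k) \<le> 2 * B / real (n k)" for k
        unfolding real_norm_def by (rule integral_empirical_perturb[OF fm B eq[symmetric]])
    qed
    show "(\<lambda>k. 2 * B / real (n k)) \<longlonglongrightarrow> 0"
      by (intro tendsto_divide_0[OF tendsto_const] filterlim_at_top_imp_at_infinity filterlim_compose[OF filterlim_real_sequentially n])
  qed
  from tendsto_add[OF this wk_convD[OF c conjunct1[OF f] B]] show "(\<lambda>k. ?I z' k) \<longlonglongrightarrow> integral\<^sup>L m f" by simp
qed

text \<open>The equilibrium inequality evaluates a deviation at the deviated measure,
  \<open>gap\<close> at the actual one. \<open>D k v\<close> is the worst payoff difference between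
  the two at type \<open>v\<close>, so the gap of player \<open>i\<close> is at most
  \<open>e k + D k (w k i)\<close>. It remains to average \<open>D\<close> over the players,
  although it tends to \<open>0\<close> only along convergent types.\<close>

lemma near_nash_eq_gap:
  assumes nn: "near_nash ms" and m: "m \<in> probs" and c: "wk_conv ms m"
  shows "(\<lambda>k. eq_gap (ms k)) \<longlonglongrightarrow> 0"
proof -
  obtain n e w x where n: "filterlim n sequentially sequentially" and e: "e \<longlonglongrightarrow> 0" and n1: "\<And>k. n k \<ge> 1"
     and nash: "\<And>k. nash_eq C F (e k) (n k) (w k) (x k)" and ms: "\<And>k. ms k = empirical (n k) (\<lambda>i. (w k i, x k i))"
    using nn unfolding near_nash_def by blast
  define P where "P k i y = empirical (n k) (\<lambda>j. (w k j, ((x k)(i := y)) j))" for k i y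
  have P_probs: "P k i y \<in> probs" for k i y unfolding P_def by (rule empirical_probs[OF n1])
  have ms_probs: "ms k \<in> probs" for k by (rule near_nash_probs[OF nn])
  \<comment> \<open>The deviating player \<open>i\<close> and the strategy \<open>y\<close> may vary
    arbitrarily with \<open>j\<close>: a single coordinate has weight \<open>1/n\<close> whichever
    it is.\<close>
  have P_conv: "wk_conv (\<lambda>j. P (\<kappa> j) (i j) (y j)) m" if \<kappa>: "filterlim \<kappa> sequentially sequentially" for \<kappa> i y
  proof -
    have "wk_conv (\<lambda>j. empirical (n (\<kappa> j)) (\<lambda>i. (w (\<kappa> j) i, x (\<kappa> j) i))) m"
      using wk_conv_compose[OF c \<kappa>] unfolding ms .
    then show ?thesis unfolding P_def
      by (rule wk_conv_perturb[OF _ filterlim_compose[OF n \<kappa>], where i=i]) auto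
  qed
  define D where "D k v = (SUP p\<in>{..<n k} \<times> UNIV. \<bar>F (P k (fst p) (snd p)) v (snd p) - F (ms k) v (snd p)\<bar>)" for k v
  have D_bd: "\<bar>F (P k i y) v y' - F (ms k) v y'\<bar> \<le> 2 * bnd" for k i y v y'
    using F_bnd[OF P_probs, of k i y v y'] F_bnd[OF ms_probs, of k v y'] by linarith
  have bdd: "bdd_above ((\<lambda>p. \<bar>F (P k (fst p) (snd p)) v (snd p) - F (ms k) v (snd p)\<bar>) ` ({..<n k} \<times> UNIV))" for k v
    by (rule bdd_aboveI2) (rule D_bd)
  have ne: "{..<n k} \<times> (UNIV :: 'x set) \<noteq> {}" for k using n1[of k] by (auto simp: lessThan_empty_iff)
  have D_ge: "\<bar>F (P k i y) v y - F (ms k) v y\<bar> \<le> D k v" if "i < n k" for k i y v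
    unfolding D_def using cSUP_upper[OF _ bdd, of "(i, y)" k v] that by simp
  have D_range: "D k v \<in> {0..2 * bnd}" for k v
  proof -
    have "D k v \<le> 2 * bnd" unfolding D_def by (rule cSUP_least[OF ne D_bd])
    moreover have "0 \<le> D k v" using D_ge[of 0 k undefined v] n1[of k] by linarith
    ultimately show ?thesis by simp
  qed
  \<comment> \<open>Otherwise deviations with payoff difference above \<open>a / 2\<close> persist;
    along a subsequence their strategies converge to some \<open>y\<close>, and both payoffs tend to
    \<open>F m v0 y\<close>.\<close>
  have D_conv: "(\<lambda>j. D (\<kappa> j) (v j)) \<longlonglongrightarrow> 0" if \<kappa>: "filterlim \<kappa> sequentially sequentially" and v: "v \<longlonglongrightarrow> v0" for \<kappa> v v0
  proof (rule order_tendstoI)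
    show "eventually (\<lambda>j. a < D (\<kappa> j) (v j)) sequentially" if "a < 0" for a
      using D_range that by (intro always_eventually) (meson atLeastAtMost_iff less_le_trans)
  next
    fix a :: real assume a: "0 < a"
    show "eventually (\<lambda>j. D (\<kappa> j) (v j) < a) sequentially"
    proof (rule ccontr)
      assume "\<not> eventually (\<lambda>j. D (\<kappa> j) (v j) < a) sequentially"
      then obtain r :: "nat \<Rightarrow> nat" where r: "strict_mono r" "\<And>j. a \<le> D (\<kappa> (r j)) (v (r j))"
        using not_eventually_sequentiallyD[of "\<lambda>j. D (\<kappa> j) (v j) < a"] by (auto simp: not_less)
      have "\<exists>p. a / 2 < \<bar>F (P (\<kappa> (r j)) (fst p) (snd p)) (v (r j)) (snd p) - F (ms (\<kappa> (r j))) (v (r j)) (snd p)\<bar>" for j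
      proof -
        have "a / 2 < D (\<kappa> (r j)) (v (r j))" using r(2)[of j] a by linarith
        then show ?thesis unfolding D_def less_cSUP_iff[OF ne bdd] by blast
      qed
      then obtain p where p: "\<And>j. a / 2 < \<bar>F (P (\<kappa> (r j)) (fst (p j)) (snd (p j))) (v (r j)) (snd (p j)) - F (ms (\<kappa> (r j))) (v (r j)) (snd (p j))\<bar>"
        by metis
      obtain r' y where r': "strict_mono r'" "(\<lambda>j. snd (p (r' j))) \<longlonglongrightarrow> y"
        using compact_subseq[OF X_compact, of "\<lambda>j. snd (p j)"] by blast
      have sub: "filterlim (\<lambda>k. r (r' k)) sequentially sequentially"
        by (rule filterlim_compose[OF filterlim_subseq[OF r(1)] filterlim_subseq[OF r'(1)]])
      note \<kappa>' = filterlim_compose[OF \<kappa> sub] and v' = filterlim_compose[OF v sub]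
      have "(\<lambda>j. F (P (\<kappa> (r (r' j))) (fst (p (r' j))) (snd (p (r' j)))) (v (r (r' j))) (snd (p (r' j)))) \<longlonglongrightarrow> F m v0 y"
        by (rule F_cont[OF P_probs m P_conv[OF \<kappa>'] v' r'(2)])
      moreover have "(\<lambda>j. F (ms (\<kappa> (r (r' j)))) (v (r (r' j))) (snd (p (r' j)))) \<longlonglongrightarrow> F m v0 y"
        by (rule F_cont[OF ms_probs m wk_conv_compose[OF c \<kappa>'] v' r'(2)])
      ultimately have "(\<lambda>j. \<bar>F (P (\<kappa> (r (r' j))) (fst (p (r' j))) (snd (p (r' j)))) (v (r (r' j))) (snd (p (r' j)))
          - F (ms (\<kappa> (r (r' j)))) (v (r (r' j))) (snd (p (r' j)))\<bar>) \<longlonglongrightarrow> \<bar>F m v0 y - F m v0 y\<bar>"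
        by (intro tendsto_rabs tendsto_diff)
      then have "a / 2 \<le> \<bar>F m v0 y - F m v0 y\<bar>"
        by (rule LIMSEQ_le_const) (use p less_imp_le in blast)
      then show False using a by simp
    qed
  qed
  have gap_le: "gap (ms k) (w k i, x k i) \<le> e k + D k (w k i)" if i: "i < n k" for k i
  proof -
    have xC: "x k i \<in> C (w k i)" and N: "F (ms k) (w k i) (x k i) - (INF y\<in>C (w k i). F (P k i y) (w k i) y) \<le> e k"
      using nash[of k] i unfolding nash_eq_def ms P_def by auto
    have "(INF y\<in>C (w k i). F (P k i y) (w k i) y) - D k (w k i) \<le> V (ms k) (w k i)"
    proof (rule V_ge)
      fix y assume y: "y \<in> C (w k i)"
      have "bdd_below ((\<lambda>y. F (P k i y) (w k i) y) ` C (w k i))"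
        by (rule bdd_belowI2[of _ "- bnd"]) (metis F_bnd P_probs abs_le_iff minus_le_iff)
      from cINF_lower[OF this y] D_ge[OF i, of y "w k i"]
      show "(INF y\<in>C (w k i). F (P k i y) (w k i) y) - D k (w k i) \<le> F (ms k) (w k i) y" by linarith
    qed
    moreover have "infdist (w k i, x k i) Gr = 0" using xC by (intro infdist_zero) (simp add: Gr_def)
    moreover have "V (ms k) (w k i) \<le> F (ms k) (w k i) (x k i)" by (rule V_le[OF ms_probs xC])
    ultimately show ?thesis using N unfolding gap_def by simp
  qed
  show ?thesis
  proof (rule order_tendstoI)
    show "eventually (\<lambda>k. a < eq_gap (ms k)) sequentially" if "a < 0" for a
      using eq_gap_bounds[OF ms_probs] that by (intro always_eventually) (meson atLeastAtMost_iff less_le_trans)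
  next
    fix a :: real assume a: "0 < a"
    \<comment> \<open>A continuous majorant \<open>h\<close> of the late errors, with integrals
      eventually below \<open>a / 2\<close>; averaging \<open>h\<close> in place of \<open>D\<close>
      needs no measurability of \<open>D\<close>.\<close>
    have "\<exists>h j. continuous_on UNIV h \<and> (\<forall>z. h z \<in> {0..2 * bnd}) \<and> (\<forall>k\<ge>j. \<forall>z. D k (fst z) \<le> h z) \<and>
        eventually (\<lambda>k. integral\<^sup>L (ms k) h < integral\<^sup>L m (\<lambda>_. 0) + a / 2) sequentially"
    proof (rule dominating_continuous[OF D_range _ ms_probs m c])
      show "(\<lambda>j. D (\<kappa> j) (fst (z j))) \<longlonglongrightarrow> 0" if "filterlim \<kappa> sequentially sequentially" "z \<longlonglongrightarrow> z0" for \<kappa> z and z0 :: "'w \<times> 'x"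
        using D_conv[OF that(1) tendsto_fst[OF that(2)]] .
    qed (use a in simp)
    then obtain h j where h: "continuous_on UNIV h" "\<And>k z. k \<ge> j \<Longrightarrow> D k (fst z) \<le> h z"
      "eventually (\<lambda>k. integral\<^sup>L (ms k) h < a / 2) sequentially"
      unfolding Bochner_Integration.integral_zero add_0 by blast
    have "eventually (\<lambda>k. e k < a / 2) sequentially" using order_tendstoD(2)[OF e, of "a/2"] a by simp
    with h(3) eventually_ge_at_top[of j]
    show "eventually (\<lambda>k. eq_gap (ms k) < a) sequentially"
    proof eventually_elim
      case (elim k)
      have hm: "h \<in> borel_measurable borel" by (rule borel_measurable_continuous_onI[OF h(1)])
      have "eq_gap (ms k) = (\<Sum>i<n k. gap (ms k) (w k i, x k i)) / n k"
        unfolding eq_gap_def using integral_empirical[OF borel_gap[OF ms_probs[of k]], of "n k" "\<lambda>i. (w k i, x k i)"] ms[of k] by simp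
      also have "\<dots> \<le> (\<Sum>i<n k. e k + h (w k i, x k i)) / n k"
      proof (intro divide_right_mono sum_mono)
        fix i assume "i \<in> {..<n k}"
        then show "gap (ms k) (w k i, x k i) \<le> e k + h (w k i, x k i)"
          using gap_le[of i k] h(2)[of k "(w k i, x k i)"] elim by auto
      qed simp
      also have "\<dots> = e k + integral\<^sup>L (ms k) h"
        using n1[of k] unfolding ms[of k] integral_empirical[OF hm] by (simp add: sum.distrib add_divide_distrib)
      finally show ?case using elim by simp
    qed
  qed
qed

lemma near_nash_limit:
  assumes nn: "near_nash ms" and lam: "lam \<in> probs" and c: "wk_conv (\<lambda>k. distr (ms k) borel fst) lam"
  shows "\<exists>r m. strict_mono r \<and> m \<in> Meq C F lam \<and> wk_conv (ms \<circ> r) m \<and> (\<lambda>k. eq_gap (ms (r k))) \<longlonglongrightarrow> 0"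
proof -
  have p: "ms k \<in> probs" for k by (rule near_nash_probs[OF nn])
  obtain r m where r: "strict_mono r" and m: "m \<in> probs" and rm: "wk_conv (ms \<circ> r) m" "distr m borel fst = lam"
    using wk_conv_subseq_of_marginal[OF X_compact p lam c] by blast
  have "(\<lambda>k. eq_gap (ms (r k))) \<longlonglongrightarrow> 0"
    using rm(1) by (intro near_nash_eq_gap[OF near_nash_subseq[OF nn filterlim_subseq[OF r]] m]) (simp add: comp_def)
  moreover have "(\<lambda>k. eq_gap (ms (r k))) \<longlonglongrightarrow> eq_gap m"
    using rm(1) by (intro eq_gap_cont p m) (simp add: comp_def)
  ultimately have "eq_gap m = 0" using LIMSEQ_unique by blast
  then have "m \<in> Meq C F lam" using eq_gap_zero[OF m] rm(2) by simp
  with r rm \<open>(\<lambda>k. eq_gap (ms (r k))) \<longlonglongrightarrow> 0\<close> show ?thesis by blast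
qed

lemma near_nash_eq_gap_marginal:
  assumes nn: "near_nash ms" and lam: "lam \<in> probs" and c: "wk_conv (\<lambda>k. distr (ms k) borel fst) lam"
  shows "(\<lambda>k. eq_gap (ms k)) \<longlonglongrightarrow> 0"
proof (rule LIMSEQ_subsubseq)
  fix r :: "nat \<Rightarrow> nat" assume "strict_mono r"
  then have r: "filterlim r sequentially sequentially" by (rule filterlim_subseq)
  show "\<exists>r'. strict_mono (r' :: nat \<Rightarrow> nat) \<and> (\<lambda>n. eq_gap (ms (r (r' n)))) \<longlonglongrightarrow> 0"
    using near_nash_limit[OF near_nash_subseq[OF nn r] lam wk_conv_compose[OF c r]] by blast
qed

text \<open>Along a further subsequence the measures converge to some \<open>m\<close> in
  \<open>Meq C F lam\<close>, and the distance to the set is at most the distance to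
  \<open>m\<close>. The existence of \<open>m\<close> also makes the set nonempty, so that
  \<open>INF\<close> is a genuine infimum.\<close>

lemma near_nash_dist:
  assumes nn: "near_nash ms" and lam: "lam \<in> probs" and c: "wk_conv (\<lambda>k. distr (ms k) borel fst) lam"
    and d: "compat_metric d"
  shows "(\<lambda>k. INF m\<in>Meq C F lam. d (ms k) m) \<longlonglongrightarrow> 0"
proof (rule LIMSEQ_subsubseq)
  fix r :: "nat \<Rightarrow> nat" assume "strict_mono r"
  then have r: "filterlim r sequentially sequentially" by (rule filterlim_subseq)
  obtain r' m where r': "strict_mono r'" and m: "m \<in> Meq C F lam" and c': "wk_conv ((\<lambda>k. ms (r k)) \<circ> r') m"
    using near_nash_limit[OF near_nash_subseq[OF nn r] lam wk_conv_compose[OF c r]] by blast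
  have sub: "Meq C F lam \<subseteq> probs" by (auto simp: Meq_def)
  have p: "ms k \<in> probs" for k by (rule near_nash_probs[OF nn])
  have d0: "0 \<le> d a b" if "a \<in> probs" "b \<in> probs" for a b using d that unfolding compat_metric_def by blast
  have "\<forall>mu m. (\<forall>n. mu n \<in> probs) \<longrightarrow> m \<in> probs \<longrightarrow> ((\<lambda>n. d (mu n) m) \<longlonglongrightarrow> 0 \<longleftrightarrow> wk_conv mu m)"
    using d unfolding compat_metric_def by (elim conjE)
  from spec[OF spec[OF this, of "\<lambda>k. ms (r (r' k))"], of m]
  have lim: "(\<lambda>k. d (ms (r (r' k))) m) \<longlonglongrightarrow> 0"
    using c' p m sub by (auto simp: comp_def)
  have up: "(INF m\<in>Meq C F lam. d (ms k) m) \<le> d (ms k) m" for k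
    using d0[OF p] sub by (intro cINF_lower m bdd_belowI2[of _ 0]) auto
  have lo: "0 \<le> (INF m\<in>Meq C F lam. d (ms k) m)" for k
    using d0[OF p] sub m by (intro cINF_greatest) auto
  have "(\<lambda>k. INF m\<in>Meq C F lam. d (ms (r (r' k))) m) \<longlonglongrightarrow> 0"
    by (rule Lim_null_comparison[OF always_eventually lim]) (simp add: up lo)
  with r' show "\<exists>r'. strict_mono (r' :: nat \<Rightarrow> nat) \<and> (\<lambda>n. INF m\<in>Meq C F lam. d (ms (r (r' n))) m) \<longlonglongrightarrow> 0" by blast
qed

end

section \<open>Random type vectors\<close>

text \<open>Universal measurability is applied to the law of \<open>W\<close>; null sets of that law
  pull back to null sets, so the completion of \<open>M\<close> absorbs the exceptional
  sets.\<close>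

lemma univ_meas_compose:
  assumes M: "prob_space M" and W: "W \<in> measurable M N" and f: "univ_meas N f B"
  shows "(\<lambda>\<omega>. f (W \<omega>)) \<in> measurable (completion M) B"
proof -
  interpret prob_space M by (rule M)
  have "prob_space (distr M N W)" by (rule prob_space_distr[OF W])
  then have f': "f \<in> measurable (completion (distr M N W)) B" using f unfolding univ_meas_def by simp
  have W': "W \<in> measurable (completion M) (distr M N W)" using measurable_completion[OF W] by simp
  have "distr (completion M) (distr M N W) W = distr (completion M) N W" by (rule distr_cong) simp_all
  then have "null_sets (distr M N W) \<subseteq> null_sets (distr (completion M) (distr M N W) W)"
    using distr_completion[OF W] by simp
  from measurable_compose[OF completion.measurable_completion2[OF W' this] f'] show ?thesis .
qed

text \<open>Hoeffding's inequality makes the deviation probabilities summable, so the rows of the array need not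
  be related to each other.\<close>

lemma (in prob_space) array_SLLN_bounded:
  fixes X :: "nat \<Rightarrow> nat \<Rightarrow> 'a \<Rightarrow> real"
  assumes indep: "\<And>n. n \<ge> 1 \<Longrightarrow> indep_vars (\<lambda>_. borel) (X n) {..<n}"
    and B: "\<And>n i \<omega>. \<bar>X n i \<omega>\<bar> \<le> B" and \<mu>: "\<And>n i. i < n \<Longrightarrow> expectation (X n i) = \<mu>"
  shows "AE \<omega> in M. (\<lambda>n. (\<Sum>i<n. X n i \<omega>) / n) \<longlonglongrightarrow> \<mu>"
proof -
  \<comment> \<open>The summand \<open>1\<close> keeps the range in Hoeffding's inequality
    nondegenerate.\<close>
  define B' where "B' = \<bar>B\<bar> + 1"
  have B': "B' > 0" "\<bar>X n i \<omega>\<bar> \<le> B'" for n i \<omega>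
    using B[of n i \<omega>] unfolding B'_def by linarith+
  have rv: "X n i \<in> borel_measurable M" if "i < n" for n i
    using indep[of n] that unfolding indep_vars_def by auto
  have "AE \<omega> in M. eventually (\<lambda>n. \<bar>(\<Sum>i<n. X n i \<omega>) / n - \<mu>\<bar> < e) sequentially" if e: "e > 0" for e
  proof -
    define A where "A n = {\<omega> \<in> space M. \<bar>(\<Sum>i<n. X n i \<omega>) - n * \<mu>\<bar> \<ge> e * n}" for n
    have A: "A n \<in> events" for n
      unfolding A_def using rv by (auto intro!: borel_measurable_le borel_measurable_abs borel_measurable_diff borel_measurable_sum)
    have bound: "prob (A n) \<le> 2 * exp (- (e\<^sup>2 / (2 * B'\<^sup>2))) ^ n" if n: "n \<ge> 1" for n
    proof -
      interpret H: Hoeffding_ineq M "{..<n}" "X n" "\<lambda>_. - B'" "\<lambda>_. B'" "\<Sum>i<n. expectation (X n i)"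
      proof (unfold_locales)
        show "AE x in M. X n i x \<in> {- B'..B'}" for i
          using B'(2) by (simp add: abs_le_iff minus_le_iff)
      qed (use indep[OF n] in auto)
      have "prob {x \<in> space M. \<bar>(\<Sum>i<n. X n i x) - (\<Sum>i<n. expectation (X n i))\<bar> \<ge> e * n}
          \<le> 2 * exp (- 2 * (e * n)\<^sup>2 / (\<Sum>i<n. (B' - - B')\<^sup>2))"
        using e B'(1) n by (intro H.Hoeffding_ineq_abs_ge) (auto simp: lessThan_empty_iff)
      also have "(\<Sum>i<n. expectation (X n i)) = n * \<mu>" by (simp add: \<mu>)
      \<comment> \<open>Each of the \<open>n\<close> summands has a range of length
        \<open>2 * B'\<close>, so one factor \<open>n\<close> cancels and the bound is a geometric
        sequence.\<close>
      also have "- 2 * (e * n)\<^sup>2 / (\<Sum>i<n. (B' - - B')\<^sup>2) = real n * (- (e\<^sup>2 / (2 * B'\<^sup>2)))"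
        using B'(1) n by (simp add: power2_eq_square field_simps)
      finally show ?thesis unfolding A_def exp_of_nat_mult .
    qed
    have "summable (\<lambda>n. 2 * exp (- (e\<^sup>2 / (2 * B'\<^sup>2))) ^ n)"
      using e B'(1) by (intro summable_mult summable_geometric) simp
    then have "summable (\<lambda>n. prob (A n))"
      by (rule summable_comparison_test'[of _ 1]) (simp add: bound)
    then have "AE \<omega> in M. eventually (\<lambda>n. \<omega> \<in> space M - A n) sequentially"
      using A by (intro borel_cantelli_AE1) (auto simp: emeasure_eq_measure)
    then show ?thesis
    proof eventually_elim
      case (elim \<omega>)
      from elim eventually_ge_at_top[of 1] show ?case
      proof eventually_elim
        case (elim n)
        then have "\<bar>(\<Sum>i<n. X n i \<omega>) - n * \<mu>\<bar> < e * n" by (simp add: A_def not_le)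
        moreover have "(\<Sum>i<n. X n i \<omega>) / n - \<mu> = ((\<Sum>i<n. X n i \<omega>) - n * \<mu>) / n" using elim by (simp add: field_simps)
        ultimately show ?case using elim by (simp add: pos_divide_less_eq)
      qed
    qed
  qed
  then have "AE \<omega> in M. \<forall>k. eventually (\<lambda>n. \<bar>(\<Sum>i<n. X n i \<omega>) / n - \<mu>\<bar> < 1 / real (Suc k)) sequentially"
    by (subst AE_all_countable) simp
  then show ?thesis
  proof eventually_elim
    case (elim \<omega>)
    show ?case
    proof (rule tendstoI)
      fix e :: real assume "e > 0"
      then obtain k where k: "1 / real (Suc k) < e" using nat_approx_posE by auto
      from elim[rule_format, of k] show "eventually (\<lambda>n. dist ((\<Sum>i<n. X n i \<omega>) / n) \<mu> < e) sequentially"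
        by eventually_elim (use k in \<open>simp add: dist_real_def\<close>)
    qed
  qed
qed

lemma wcontD:
  assumes "wcont \<Phi>" "\<And>n. mu n \<in> probs" "m \<in> probs" "wk_conv mu m"
  shows "(\<lambda>n. \<Phi> (mu n)) \<longlonglongrightarrow> \<Phi> m"
  using assms unfolding wcont_def by simp

lemma law_conv_subseq:
  assumes "law_conv Q Q0" "strict_mono r" shows "law_conv (Q \<circ> r) Q0"
  using assms(1) filterlim_compose[OF _ filterlim_subseq[OF assms(2)]] unfolding law_conv_def comp_def by fast

text \<open>Truncated to be an admissible test function for \<open>law_conv\<close>. It is weakly
  continuous and, for a dense \<open>t\<close>, vanishes among probability measures only at
  \<open>lam\<close>, so its expectations detect convergence to \<open>lam\<close> in
  probability.\<close>

definition wk_dist :: "(nat \<Rightarrow> 'a::metric_space) \<Rightarrow> 'a measure \<Rightarrow> 'a measure \<Rightarrow> real" where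
  "wk_dist t lam m = min 1 (dist (tent_vec t m) (tent_vec t lam))"

lemma wcont_wk_dist:
  assumes t: "dense_seq t" shows "wcont (wk_dist t lam)"
  unfolding wcont_def wk_dist_def
proof (intro allI impI)
  fix mu :: "nat \<Rightarrow> 'a measure" and m
  assume "\<forall>n. mu n \<in> probs" "m \<in> probs" "wk_conv mu m"
  then have "(\<lambda>n. tent_vec t (mu n)) \<longlonglongrightarrow> tent_vec t m" by (subst wk_conv_iff_tent_vec[OF t, symmetric]) auto
  then show "(\<lambda>n. min 1 (dist (tent_vec t (mu n)) (tent_vec t lam))) \<longlonglongrightarrow> min 1 (dist (tent_vec t m) (tent_vec t lam))"
    by (intro tendsto_min tendsto_dist tendsto_const)
qed

lemma wk_dist_range: "wk_dist t lam m \<in> {0..1}"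
  by (auto simp: wk_dist_def)

lemma wk_dist_zero:
  assumes "dense_seq t" "m \<in> probs" "lam \<in> probs" "wk_dist t lam m = 0" shows "m = lam"
  using assms(4) tent_vec_inject[OF assms(1-3)] by (auto simp: wk_dist_def min_def split: if_splits)

lemma wk_conv_of_wk_dist:
  assumes t: "dense_seq t" and mu: "\<And>n. mu n \<in> probs" and lam: "lam \<in> probs"
    and c: "(\<lambda>n. wk_dist t lam (mu n)) \<longlonglongrightarrow> 0"
  shows "wk_conv mu lam"
proof -
  have "eventually (\<lambda>n. wk_dist t lam (mu n) < 1) sequentially" by (rule order_tendstoD(2)[OF c]) simp
  then have "eventually (\<lambda>n. wk_dist t lam (mu n) = dist (tent_vec t (mu n)) (tent_vec t lam)) sequentially"
    by eventually_elim (auto simp: wk_dist_def min_def split: if_splits)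
  from Lim_transform_eventually[OF c this]
  have "(\<lambda>n. tent_vec t (mu n)) \<longlonglongrightarrow> tent_vec t lam" by (rule iffD2[OF tendsto_dist_iff])
  then show ?thesis unfolding wk_conv_iff_tent_vec[OF t mu lam] .
qed

lemma (in prob_space) bounded_convergence:
  fixes u :: "nat \<Rightarrow> 'a \<Rightarrow> real"
  assumes "\<And>n. u n \<in> borel_measurable M" and B: "\<And>n x. x \<in> space M \<Longrightarrow> \<bar>u n x\<bar> \<le> B"
    and c: "AE x in M. (\<lambda>n. u n x) \<longlonglongrightarrow> 0"
  shows "(\<lambda>n. integral\<^sup>L M (u n)) \<longlonglongrightarrow> 0"
proof -
  have "(\<lambda>n. integral\<^sup>L M (u n)) \<longlonglongrightarrow> integral\<^sup>L M (\<lambda>_. 0)"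
    by (rule integral_dominated_convergence[where w="\<lambda>_. B"]) (use assms in \<open>auto intro!: AE_I2\<close>)
  then show ?thesis by simp
qed

section \<open>The random array and the laws of its empirical measures\<close>

locale nash_array = static_game C F + prob_space M
  for C :: "'w::polish_space \<Rightarrow> 'x::metric_space set" and F and M :: "'o measure" +
  fixes eps :: "nat \<Rightarrow> real"
    and xhat :: "nat \<Rightarrow> (nat \<Rightarrow> 'w) \<Rightarrow> nat \<Rightarrow> 'x"
    and W :: "nat \<Rightarrow> 'o \<Rightarrow> nat \<Rightarrow> 'w"
    and mu :: "nat \<Rightarrow> 'o \<Rightarrow> ('w \<times> 'x) measure"
    and muw :: "nat \<Rightarrow> 'o \<Rightarrow> 'w measure"
    and L :: "nat \<Rightarrow> ('w \<times> 'x) measure measure"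
    and Lw :: "nat \<Rightarrow> 'w measure measure"
  assumes eps_lim: "eps \<longlonglongrightarrow> 0"
    and xhat_nash: "\<And>n w. n \<ge> 1 \<Longrightarrow> w \<in> space (PiM {..<n} (\<lambda>_. borel)) \<Longrightarrow> nash_eq C F (eps n) n w (xhat n w)"
    and xhat_meas: "\<And>n i. i < n \<Longrightarrow> univ_meas (PiM {..<n} (\<lambda>_. borel)) (\<lambda>w. xhat n w i) borel"
    and W_meas: "\<And>n. n \<ge> 1 \<Longrightarrow> W n \<in> measurable M (PiM {..<n} (\<lambda>_. borel))"
    and mu_def: "\<And>n \<omega>. mu n \<omega> = empirical n (\<lambda>i. (W n \<omega> i, xhat n (W n \<omega>) i))"
    and muw_def: "\<And>n \<omega>. muw n \<omega> = empirical n (W n \<omega>)"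
    and L_def: "\<And>n. L n = distr (completion M) (prob_algebra borel) (mu n)"
    and Lw_def: "\<And>n. Lw n = distr (completion M) (prob_algebra borel) (muw n)"
begin

sublocale cM: prob_space "completion M"
  by (rule prob_space_completion)

lemma dense_prod: "\<exists>s :: nat \<Rightarrow> 'w \<times> 'x. dense_seq s"
proof -
  obtain t :: "nat \<Rightarrow> 'w" where t: "dense_seq t" using ex_dense_seq_second_countable by blast
  obtain u :: "nat \<Rightarrow> 'x" where "dense_seq u" using ex_dense_seq_compact[OF X_compact] by blast
  then show ?thesis by (rule ex_dense_seq_prod[OF t])
qed

lemma wcont_borel: "wcont \<Phi> \<Longrightarrow> \<Phi> \<in> borel_measurable (prob_algebra (borel :: ('w \<times> 'x) measure))"
  using dense_prod wcont_measurable by blast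

lemma W_coord: "i < n \<Longrightarrow> (\<lambda>\<omega>. W n \<omega> i) \<in> borel_measurable M"
  using measurable_compose[OF W_meas[of n] measurable_component_singleton[of i "{..<n}" "\<lambda>_. borel"]] by simp

text \<open>The completion enters here, since the equilibrium selection is only universally
  measurable in the types.\<close>

lemma mu_meas: "n \<ge> 1 \<Longrightarrow> mu n \<in> measurable (completion M) (prob_algebra borel)"
proof -
  assume n: "n \<ge> 1"
  obtain s :: "nat \<Rightarrow> 'w \<times> 'x" where s: "dense_seq s" using dense_prod by blast
  show ?thesis unfolding mu_def[abs_def]
  proof (rule measurable_empirical[OF n])
    show "(\<lambda>\<omega>. (W n \<omega> i, xhat n (W n \<omega>) i)) \<in> borel_measurable (completion M)" if "i < n" for i
      by (intro measurable_Pair_borel[OF s] measurable_completion[OF W_coord[OF that]]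
          univ_meas_compose[OF prob_space_axioms W_meas[OF n] xhat_meas[OF that]])
  qed
qed

lemma muw_meas: "n \<ge> 1 \<Longrightarrow> muw n \<in> measurable (completion M) (prob_algebra borel)"
  unfolding muw_def[abs_def] by (intro measurable_empirical measurable_completion W_coord)

lemma mu_probs: "n \<ge> 1 \<Longrightarrow> mu n \<omega> \<in> probs" and muw_probs: "n \<ge> 1 \<Longrightarrow> muw n \<omega> \<in> probs"
  unfolding mu_def muw_def by (rule empirical_probs, assumption)+

lemma distr_mu: "distr (mu n \<omega>) borel fst = muw n \<omega>"
  unfolding mu_def muw_def by (simp add: distr_empirical[OF borel_measurable_fst])

lemma near_nash_mu:
  assumes n: "filterlim n sequentially sequentially" "\<And>k. n k \<ge> 1" and \<omega>: "\<And>k. \<omega> k \<in> space M"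
  shows "near_nash (\<lambda>k. mu (n k) (\<omega> k))"
  unfolding near_nash_def
proof (intro exI[of _ n] exI[of _ "\<lambda>k. eps (n k)"] exI[of _ "\<lambda>k. W (n k) (\<omega> k)"]
    exI[of _ "\<lambda>k. xhat (n k) (W (n k) (\<omega> k))"] conjI allI n filterlim_compose[OF eps_lim n(1)] mu_def)
  show "nash_eq C F (eps (n k)) (n k) (W (n k) (\<omega> k)) (xhat (n k) (W (n k) (\<omega> k)))" for k
    by (rule xhat_nash[OF n(2) measurable_space[OF W_meas[OF n(2)] \<omega>]])
qed

text \<open>The way in which a limit law is tested: a nonnegative bounded weakly continuous function
  whose expectations tend to \<open>0\<close> has integral \<open>0\<close> under \<open>Q\<close>,
  hence vanishes almost everywhere.\<close>

lemma law_limit_zero: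
  assumes c: "law_conv (L \<circ> r) Q" and r: "strict_mono r"
    and \<Phi>: "wcont \<Phi>" "\<And>m. m \<in> probs \<Longrightarrow> \<Phi> m \<in> {0..B}"
    and z: "(\<lambda>n. \<integral>\<omega>. \<Phi> (mu (r n) \<omega>) \<partial>completion M) \<longlonglongrightarrow> 0"
  shows "AE m in Q. m \<in> probs \<and> \<Phi> m = 0"
proof -
  have Q: "prob_space Q" "sets Q = sets (prob_algebra borel)" using c by (auto simp: law_conv_def)
  interpret Q: prob_space Q by (rule Q)
  have sQ: "space Q = probs" using sets_eq_imp_space_eq[OF Q(2)] space_prob_algebra_borel by simp
  have \<Phi>m: "\<Phi> \<in> borel_measurable (prob_algebra borel)" by (rule wcont_borel[OF \<Phi>(1)])
  then have \<Phi>Q: "\<Phi> \<in> borel_measurable Q" by (simp add: measurable_cong_sets[OF Q(2) refl])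
  have "bounded (\<Phi> ` probs)" unfolding bounded_iff using \<Phi>(2) by (intro exI[of _ B]) auto
  then have "(\<lambda>n. \<integral>m. \<Phi> m \<partial>L (r n)) \<longlonglongrightarrow> (\<integral>m. \<Phi> m \<partial>Q)"
    using c \<Phi>(1) unfolding law_conv_def comp_def by blast
  \<comment> \<open>Restricted to positive \<open>r n\<close>, as \<open>empirical 0\<close> is not
    a probability measure.\<close>
  moreover have "eventually (\<lambda>n. (\<integral>\<omega>. \<Phi> (mu (r n) \<omega>) \<partial>completion M) = (\<integral>m. \<Phi> m \<partial>L (r n))) sequentially"
    using eventually_ge_at_top[of 1]
  proof eventually_elim
    case (elim n)
    then have "r n \<ge> 1" using seq_suble[OF r, of n] by linarith
    then show ?case unfolding L_def by (intro integral_distr[symmetric] mu_meas \<Phi>m)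
  qed
  then have "(\<lambda>n. \<integral>m. \<Phi> m \<partial>L (r n)) \<longlonglongrightarrow> 0" by (rule Lim_transform_eventually[OF z])
  ultimately have "(\<integral>m. \<Phi> m \<partial>Q) = 0" by (rule LIMSEQ_unique)
  moreover have "integrable Q \<Phi>"
    by (rule Q.integrable_const_bound[where B=B]) (use \<Phi>(2) \<Phi>Q sQ in \<open>auto intro!: AE_I2\<close>)
  moreover have "AE m in Q. 0 \<le> \<Phi> m" using \<Phi>(2) sQ by (auto intro!: AE_I2)
  ultimately have "AE m in Q. \<Phi> m = 0" using integral_nonneg_eq_0_iff_AE by blast
  then show ?thesis using AE_space by eventually_elim (simp add: sQ)
qed

text \<open>Since the strategy space is compact, the measures whose marginals lie in a compact set
  form a compact set themselves; the two events have the same probability because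
  \<open>muw n\<close> is the marginal of \<open>mu n\<close>.\<close>

lemma tight_L:
  assumes "tight_laws (\<lambda>n. Lw (Suc n))" shows "tight_laws (\<lambda>n. L (Suc n))"
  unfolding tight_laws_def
proof (intro allI impI)
  fix e :: real assume "e > 0"
  then obtain Kc where Kc: "wcompact Kc" "Kc \<in> sets (prob_algebra borel)" "\<And>n. measure (Lw (Suc n)) Kc \<ge> 1 - e"
    using assms unfolding tight_laws_def by blast
  define K where "K = {m \<in> probs :: ('w \<times> 'x) measure set. distr m borel fst \<in> Kc}"
  have "K = (\<lambda>m. distr m borel fst) -` Kc \<inter> space (prob_algebra borel)"
    by (auto simp: K_def space_prob_algebra_borel)
  then have K_sets: "K \<in> sets (prob_algebra borel)"
    using measurable_sets[OF measurable_distr_prob_space[OF borel_measurable_fst] Kc(2)] by simp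
  have "wcompact K" unfolding wcompact_def
  proof (intro conjI allI impI)
    fix ms :: "nat \<Rightarrow> ('w \<times> 'x) measure" assume ms: "\<forall>n. ms n \<in> K"
    then have p: "ms n \<in> probs" and "distr (ms n) borel fst \<in> Kc" for n by (auto simp: K_def)
    then obtain r lam where r: "strict_mono r" "lam \<in> Kc" "wk_conv ((\<lambda>n. distr (ms n) borel fst) \<circ> r) lam"
      using Kc(1) unfolding wcompact_def by meson
    have "wk_conv (\<lambda>n. distr (ms (r n)) borel fst) lam" using r(3) by (simp add: comp_def)
    moreover have "lam \<in> probs" using r(2) Kc(1) by (auto simp: wcompact_def)
    ultimately obtain r' m where r': "strict_mono r'" "m \<in> probs" "wk_conv ((\<lambda>n. ms (r n)) \<circ> r') m" "distr m borel fst = lam"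
      using wk_conv_subseq_of_marginal[OF X_compact p, of lam "\<lambda>n. r n"] by blast
    show "\<exists>r m. strict_mono r \<and> m \<in> K \<and> wk_conv (ms \<circ> r) m"
      using r r' by (intro exI[of _ "r \<circ> r'"] exI[of _ m]) (auto simp: K_def comp_def intro: strict_mono_o[unfolded comp_def])
  qed (auto simp: K_def)
  moreover have "measure (L (Suc n)) K \<ge> 1 - e" for n
  proof -
    have "measure (L (Suc n)) K = measure (completion M) (mu (Suc n) -` K \<inter> space (completion M))"
      unfolding L_def by (rule measure_distr[OF mu_meas K_sets]) simp
    also have "mu (Suc n) -` K = muw (Suc n) -` Kc"
      using mu_probs[of "Suc n"] by (auto simp: K_def distr_mu)
    also have "measure (completion M) (muw (Suc n) -` Kc \<inter> space (completion M)) = measure (Lw (Suc n)) Kc"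
      unfolding Lw_def by (rule measure_distr[OF muw_meas Kc(2), symmetric]) simp
    finally show ?thesis using Kc(3)[of n] by simp
  qed
  ultimately show "\<exists>Kc. wcompact Kc \<and> Kc \<in> sets (prob_algebra borel) \<and> (\<forall>n. measure (L (Suc n)) Kc \<ge> 1 - e)"
    using K_sets by blast
qed

lemma gap_mu_meas: "n \<ge> 1 \<Longrightarrow> (\<lambda>\<omega>. eq_gap (mu n \<omega>)) \<in> borel_measurable (completion M)"
  by (rule measurable_compose[OF mu_meas wcont_borel[OF wcont_eq_gap]])

text \<open>A violation at arbitrarily large \<open>n\<close> would pick a sample point for each of
  them. The chosen measures still form a \<open>near_nash\<close> sequence, and compactness gives a
  subsequence with convergent marginals, along which the gap tends to \<open>0\<close>.\<close>

lemma eq_gap_uniform: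
  assumes Kc: "wcompact Kc" and e: "e > 0"
  shows "\<exists>N. \<forall>n\<ge>N. \<forall>\<omega>\<in>space M. muw n \<omega> \<in> Kc \<longrightarrow> eq_gap (mu n \<omega>) < e"
proof (rule ccontr)
  assume "\<not> ?thesis"
  then have "\<forall>N. \<exists>n \<omega>. n \<ge> Suc N \<and> \<omega> \<in> space M \<and> muw n \<omega> \<in> Kc \<and> e \<le> eq_gap (mu n \<omega>)"
    by (meson not_less)
  then obtain n \<omega> where n: "\<And>k. n k \<ge> Suc k" and \<omega>: "\<And>k. \<omega> k \<in> space M" "\<And>k. muw (n k) (\<omega> k) \<in> Kc"
    "\<And>k. e \<le> eq_gap (mu (n k) (\<omega> k))" by metis
  have n1: "n k \<ge> 1" for k using n[of k] by simp
  have "filterlim n sequentially sequentially"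
    using n by (intro filterlim_at_top_mono[OF filterlim_ident]) (auto intro: always_eventually Suc_leD)
  then have nn: "near_nash (\<lambda>k. mu (n k) (\<omega> k))" by (rule near_nash_mu[OF _ n1 \<omega>(1)])
  obtain r lam where r: "strict_mono r" "lam \<in> Kc" "wk_conv ((\<lambda>k. muw (n k) (\<omega> k)) \<circ> r) lam"
    using Kc \<omega>(2) unfolding wcompact_def by meson
  have lam: "lam \<in> probs" using r(2) Kc by (auto simp: wcompact_def)
  have "(\<lambda>k. eq_gap (mu (n (r k)) (\<omega> (r k)))) \<longlonglongrightarrow> 0"
    using r(3) by (intro near_nash_eq_gap_marginal[OF near_nash_subseq[OF nn filterlim_subseq[OF r(1)]] lam])
      (simp add: distr_mu comp_def)
  then have "e \<le> 0" by (rule LIMSEQ_le_const) (use \<omega>(3) in blast)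
  with e show False by simp
qed

lemma expected_gap_tight:
  assumes tight: "tight_laws (\<lambda>n. Lw (Suc n))"
  shows "(\<lambda>n. \<integral>\<omega>. eq_gap (mu n \<omega>) \<partial>completion M) \<longlonglongrightarrow> 0"
proof (rule LIMSEQ_I)
  fix e :: real assume e: "e > 0"
  define b where "b = 1 + 2 * bnd"
  have gb: "eq_gap (mu n \<omega>) \<in> {0..b}" if "n \<ge> 1" for n \<omega>
    unfolding b_def by (rule eq_gap_bounds[OF mu_probs[OF that]])
  have b: "0 \<le> b" using gb[of 1] by fastforce
  \<comment> \<open>Outside \<open>Kc\<close> the gap is at most \<open>b\<close>, which costs at
    most \<open>e / 4\<close> in expectation; inside it is eventually below
    \<open>e / 2\<close>.\<close>
  have "e / (4 * (b + 1)) > 0" using e b by simp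
  then obtain Kc where Kc: "wcompact Kc" "Kc \<in> sets (prob_algebra borel)" "\<And>n. measure (Lw (Suc n)) Kc \<ge> 1 - e / (4 * (b + 1))"
    using tight unfolding tight_laws_def by blast
  obtain N where N: "\<And>n \<omega>. n \<ge> N \<Longrightarrow> \<omega> \<in> space M \<Longrightarrow> muw n \<omega> \<in> Kc \<Longrightarrow> eq_gap (mu n \<omega>) < e / 2"
    using eq_gap_uniform[OF Kc(1), of "e/2"] e by auto
  have "norm ((\<integral>\<omega>. eq_gap (mu n \<omega>) \<partial>completion M) - 0) < e" if n: "n \<ge> max N 1" for n
  proof -
    have n1: "n \<ge> 1" using n by simp
    define A where "A = space (completion M) - muw n -` Kc \<inter> space (completion M)"
    have S: "muw n -` Kc \<inter> space (completion M) \<in> sets (completion M)" by (rule measurable_sets[OF muw_meas[OF n1] Kc(2)])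
    have "measure (completion M) (muw n -` Kc \<inter> space (completion M)) = measure (Lw n) Kc"
      unfolding Lw_def by (rule measure_distr[OF muw_meas[OF n1] Kc(2), symmetric])
    then have PA: "measure (completion M) A \<le> e / (4 * (b + 1))"
      using Kc(3)[of "n - 1"] n1 cM.prob_compl[OF S] by (simp add: A_def)
    have A: "A \<in> sets (completion M)" using S unfolding A_def by auto
    have "(\<integral>\<omega>. eq_gap (mu n \<omega>) \<partial>completion M) \<le> (\<integral>\<omega>. e / 2 + b * indicator A \<omega> \<partial>completion M)"
    proof (rule integral_mono)
      show "integrable (completion M) (\<lambda>\<omega>. eq_gap (mu n \<omega>))"
        by (rule cM.integrable_const_bound[where B=b]) (use gb[OF n1] gap_mu_meas[OF n1] in auto)
      show "integrable (completion M) (\<lambda>\<omega>. e / 2 + b * indicator A \<omega>)"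
        by (intro Bochner_Integration.integrable_add integrable_mult_right integrable_real_indicator A) (simp_all add: cM.emeasure_eq_measure)
      show "eq_gap (mu n \<omega>) \<le> e / 2 + b * indicator A \<omega>" if "\<omega> \<in> space (completion M)" for \<omega>
      proof (cases "\<omega> \<in> A")
        case True
        show ?thesis unfolding indicator_simps(1)[OF True] using gb[OF n1, of \<omega>] e by simp
      next
        case False
        then show ?thesis using N[of n \<omega>] n that b by (simp add: A_def less_imp_le)
      qed
    qed
    also have "\<dots> = e / 2 + b * measure (completion M) A"
      using A by (subst Bochner_Integration.integral_add) (auto simp: prob_space cM.emeasure_eq_measure sets.Int_space_eq2[OF A, simplified])
    also have "\<dots> \<le> e / 2 + b * (e / (4 * (b + 1)))" using PA b by (intro add_left_mono mult_left_mono)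
    also have "\<dots> < e"
    proof -
      have "b * (e / (4 * (b + 1))) \<le> e / 4" using e b by (simp add: field_simps)
      with e show ?thesis by linarith
    qed
    finally have "(\<integral>\<omega>. eq_gap (mu n \<omega>) \<partial>completion M) < e" .
    moreover have "0 \<le> (\<integral>\<omega>. eq_gap (mu n \<omega>) \<partial>completion M)"
      using gb[OF n1] by (intro Bochner_Integration.integral_nonneg) auto
    ultimately show ?thesis by simp
  qed
  then show "\<exists>N. \<forall>n\<ge>N. norm ((\<integral>\<omega>. eq_gap (mu n \<omega>) \<partial>completion M) - 0) < e" by blast
qed

theorem limits_of_tight:
  assumes tight: "tight_laws (\<lambda>n. Lw (Suc n))" and r: "strict_mono r" and c: "law_conv (L \<circ> r) Q"
  shows "AE m in Q. m \<in> Meq C F (distr m borel fst)"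
proof -
  have z: "(\<lambda>n. \<integral>\<omega>. eq_gap (mu (r n) \<omega>) \<partial>completion M) \<longlonglongrightarrow> 0"
    by (rule filterlim_compose[OF expected_gap_tight[OF tight] filterlim_subseq[OF r]])
  have "AE m in Q. m \<in> probs \<and> eq_gap m = 0"
    by (rule law_limit_zero[OF c r wcont_eq_gap _ z]) (rule eq_gap_bounds)
  then show ?thesis by eventually_elim (use eq_gap_zero in blast)
qed

text \<open>Convergence in law to a constant is convergence in probability, hence almost sure along a subsequence.\<close>

lemma AE_subseq_of_law_conv:
  assumes lam: "lam \<in> probs" and c: "law_conv Lw (return (prob_algebra borel) lam)" and r: "strict_mono r"
  shows "\<exists>r'. strict_mono (r' :: nat \<Rightarrow> nat) \<and> (\<forall>k. r' k \<ge> 1) \<and>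
    (AE \<omega> in completion M. wk_conv (\<lambda>k. muw (r (r' k)) \<omega>) lam)"
proof -
  obtain t :: "nat \<Rightarrow> 'w" where t: "dense_seq t" using ex_dense_seq_second_countable by blast
  let ?\<Phi> = "wk_dist t lam"
  have \<Phi>m: "?\<Phi> \<in> borel_measurable (prob_algebra borel)" by (rule wcont_measurable[OF t wcont_wk_dist[OF t]])
  \<comment> \<open>The shift by \<open>Suc\<close> avoids the empty population, for which
    \<open>muw\<close> is not a probability measure.\<close>
  have r1: "r (Suc n) \<ge> 1" for n using seq_suble[OF r, of "Suc n"] by linarith
  have "bounded (?\<Phi> ` probs)" unfolding bounded_iff using wk_dist_range[of t lam] by (intro exI[of _ 1]) auto
  then have "(\<lambda>n. \<integral>m. ?\<Phi> m \<partial>Lw n) \<longlonglongrightarrow> (\<integral>m. ?\<Phi> m \<partial>return (prob_algebra borel) lam)"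
    using c wcont_wk_dist[OF t] unfolding law_conv_def by blast
  also have "(\<integral>m. ?\<Phi> m \<partial>return (prob_algebra borel) lam) = 0"
    using integral_return[OF _ \<Phi>m, of lam] lam by (simp add: space_prob_algebra_borel wk_dist_def)
  finally have "(\<lambda>n. \<integral>m. ?\<Phi> m \<partial>Lw (r (Suc n))) \<longlonglongrightarrow> 0"
    by (rule filterlim_compose[OF _ filterlim_compose[OF filterlim_subseq[OF r] filterlim_Suc]])
  moreover have "(\<integral>m. ?\<Phi> m \<partial>Lw (r (Suc n))) = (\<integral>\<omega>. norm (?\<Phi> (muw (r (Suc n)) \<omega>)) \<partial>completion M)" for n
    unfolding Lw_def using wk_dist_range[of t lam] by (subst integral_distr[OF muw_meas[OF r1] \<Phi>m]) simp
  ultimately have "(\<lambda>n. \<integral>\<omega>. norm (?\<Phi> (muw (r (Suc n)) \<omega>)) \<partial>completion M) \<longlonglongrightarrow> 0" by simp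
  moreover have "integrable (completion M) (\<lambda>\<omega>. ?\<Phi> (muw (r (Suc n)) \<omega>))" for n
    by (rule cM.integrable_const_bound[where B=1])
      (use wk_dist_range[of t lam] measurable_compose[OF muw_meas[OF r1] \<Phi>m] in auto)
  ultimately obtain r' :: "nat \<Rightarrow> nat" where r': "strict_mono r'" "AE \<omega> in completion M. (\<lambda>k. ?\<Phi> (muw (r (Suc (r' k))) \<omega>)) \<longlonglongrightarrow> 0"
    using tendsto_L1_AE_subseq[of "completion M" "\<lambda>n \<omega>. ?\<Phi> (muw (r (Suc n)) \<omega>)"] by blast
  have "AE \<omega> in completion M. wk_conv (\<lambda>k. muw (r (Suc (r' k))) \<omega>) lam"
    using r'(2) by eventually_elim (rule wk_conv_of_wk_dist[OF t muw_probs[OF r1] lam])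
  moreover have "strict_mono (\<lambda>k. Suc (r' k))" using r'(1) by (simp add: strict_mono_def)
  ultimately show ?thesis by (intro exI[of _ "\<lambda>k. Suc (r' k)"]) simp
qed

lemma near_nash_path:
  assumes "filterlim n sequentially sequentially" "\<And>k. n k \<ge> 1" "\<omega> \<in> space M"
  shows "near_nash (\<lambda>k. mu (n k) \<omega>)"
  using near_nash_mu[of n "\<lambda>_. \<omega>"] assms by simp

text \<open>A vanishing gap only gives equilibrium for the measure's own marginal. The test function
  therefore adds the distance of that marginal from \<open>lam\<close>; a further subsequence may be
  taken because it has the same limit law \<open>Q\<close>.\<close>

theorem limits_of_deterministic:
  assumes lam: "lam \<in> probs" and cw: "law_conv Lw (return (prob_algebra borel) lam)"
    and r: "strict_mono r" and c: "law_conv (L \<circ> r) Q"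
  shows "AE m in Q. m \<in> Meq C F lam"
proof -
  obtain t :: "nat \<Rightarrow> 'w" where t: "dense_seq t" using ex_dense_seq_second_countable by blast
  let ?H = "\<lambda>m. eq_gap m + wk_dist t lam (distr m borel fst)"
  obtain r' where r': "strict_mono r'" "\<And>k. r' k \<ge> 1"
    and ae: "AE \<omega> in completion M. wk_conv (\<lambda>k. muw (r (r' k)) \<omega>) lam"
    using AE_subseq_of_law_conv[OF lam cw r] by blast
  have rr1: "r (r' k) \<ge> 1" for k using seq_suble[OF r, of "r' k"] r'(2)[of k] by linarith
  have rr: "filterlim (\<lambda>k. r (r' k)) sequentially sequentially"
    by (rule filterlim_compose[OF filterlim_subseq[OF r] filterlim_subseq[OF r'(1)]])
  have H: "wcont ?H" unfolding wcont_def
  proof (intro allI impI)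
    fix ms and m :: "('w \<times> 'x) measure" assume "\<forall>n. ms n \<in> probs" "m \<in> probs" "wk_conv ms m"
    then show "(\<lambda>n. ?H (ms n)) \<longlonglongrightarrow> ?H m"
      by (intro tendsto_add eq_gap_cont wcontD[OF wcont_wk_dist[OF t]] wk_conv_fst distr_fst_probs) auto
  qed
  have Hb: "?H m \<in> {0..2 + 2 * bnd}" if "m \<in> probs" for m
    using eq_gap_bounds[OF that] wk_dist_range[of t lam "distr m borel fst"] by auto
  have "(\<lambda>n. \<integral>\<omega>. ?H (mu (r (r' n)) \<omega>) \<partial>completion M) \<longlonglongrightarrow> 0"
  proof (rule cM.bounded_convergence[where B="2 + 2 * bnd"])
    show "(\<lambda>\<omega>. ?H (mu (r (r' n)) \<omega>)) \<in> borel_measurable (completion M)" for n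
      by (rule measurable_compose[OF mu_meas[OF rr1] wcont_borel[OF H]])
    show "\<bar>?H (mu (r (r' n)) \<omega>)\<bar> \<le> 2 + 2 * bnd" for n \<omega> using Hb[OF mu_probs[OF rr1, of n \<omega>]] by auto
    show "AE \<omega> in completion M. (\<lambda>n. ?H (mu (r (r' n)) \<omega>)) \<longlonglongrightarrow> 0"
      using ae AE_space
    proof eventually_elim
      case (elim \<omega>)
      then have "near_nash (\<lambda>k. mu (r (r' k)) \<omega>)" by (intro near_nash_path rr rr1) simp
      then have "(\<lambda>k. eq_gap (mu (r (r' k)) \<omega>)) \<longlonglongrightarrow> 0"
        using elim lam by (intro near_nash_eq_gap_marginal) (simp_all add: distr_mu)
      moreover have "(\<lambda>k. wk_dist t lam (muw (r (r' k)) \<omega>)) \<longlonglongrightarrow> wk_dist t lam lam"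
        using elim by (intro wcontD[OF wcont_wk_dist[OF t]] muw_probs rr1 lam) simp
      ultimately have "(\<lambda>k. eq_gap (mu (r (r' k)) \<omega>) + wk_dist t lam (muw (r (r' k)) \<omega>)) \<longlonglongrightarrow> 0 + wk_dist t lam lam"
        by (rule tendsto_add)
      then show ?case by (simp add: distr_mu wk_dist_def)
    qed
  qed
  moreover have "law_conv (L \<circ> (\<lambda>k. r (r' k))) Q"
    using law_conv_subseq[OF c r'(1)] by (simp add: comp_def)
  moreover have "strict_mono (\<lambda>k. r (r' k))" using r r'(1) by (simp add: strict_mono_def)
  ultimately have "AE m in Q. m \<in> probs \<and> ?H m = 0" using law_limit_zero[OF _ _ H Hb] by blast
  then show ?thesis
  proof eventually_elim
    case (elim m)
    then have m: "m \<in> probs" and "eq_gap m = 0" "wk_dist t lam (distr m borel fst) = 0"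
      using eq_gap_bounds[of m] wk_dist_range[of t lam "distr m borel fst"] by auto
    then show ?case using eq_gap_zero[OF m] wk_dist_zero[OF t distr_fst_probs[OF m] lam] by simp
  qed
qed

text \<open>Every subsequence has a further one along which the type distributions converge almost
  surely; the distance then tends to \<open>0\<close> path by path, and bounded convergence applies
  to the indicators.\<close>

theorem dist_in_probability:
  assumes lam: "lam \<in> probs" and cw: "law_conv Lw (return (prob_algebra borel) lam)"
    and d: "compat_metric d" and e: "e > 0"
  shows "(\<lambda>n. measure (completion M) {\<omega> \<in> space M. (INF m\<in>Meq C F lam. d (mu n \<omega>) m) \<ge> e}) \<longlonglongrightarrow> 0"
proof (rule LIMSEQ_subsubseq)
  fix r :: "nat \<Rightarrow> nat" assume r: "strict_mono r"
  obtain r' where r': "strict_mono r'" "\<And>k. r' k \<ge> 1"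
    and ae: "AE \<omega> in completion M. wk_conv (\<lambda>k. muw (r (r' k)) \<omega>) lam"
    using AE_subseq_of_law_conv[OF lam cw r] by blast
  have rr1: "r (r' k) \<ge> 1" for k using seq_suble[OF r, of "r' k"] r'(2)[of k] by linarith
  have rr: "filterlim (\<lambda>k. r (r' k)) sequentially sequentially"
    by (rule filterlim_compose[OF filterlim_subseq[OF r] filterlim_subseq[OF r'(1)]])
  define A where "A n = {\<omega> \<in> space M. (INF m\<in>Meq C F lam. d (mu n \<omega>) m) \<ge> e}" for n
  \<comment> \<open>\<open>A n\<close> may be non-measurable, in which case its \<open>measure\<close> is \<open>0\<close>.\<close>
  define A' where "A' n = (if A n \<in> sets (completion M) then A n else {})" for n
  have A': "A' n \<in> sets (completion M)" "A' n \<subseteq> A n" "measure (completion M) (A n) = measure (completion M) (A' n)" for n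
    by (auto simp: A'_def measure_notin_sets)
  have "(\<lambda>n. \<integral>\<omega>. (indicator (A' (r (r' n))) \<omega> :: real) \<partial>completion M) \<longlonglongrightarrow> 0"
  proof (rule cM.bounded_convergence[where B=1])
    show "AE \<omega> in completion M. (\<lambda>n. indicator (A' (r (r' n))) \<omega> :: real) \<longlonglongrightarrow> 0"
      using ae AE_space
    proof eventually_elim
      case (elim \<omega>)
      then have "near_nash (\<lambda>k. mu (r (r' k)) \<omega>)" by (intro near_nash_path rr rr1) simp
      then have "(\<lambda>k. INF m\<in>Meq C F lam. d (mu (r (r' k)) \<omega>) m) \<longlonglongrightarrow> 0"
        using elim lam d by (intro near_nash_dist) (simp_all add: distr_mu)
      then have "eventually (\<lambda>k. (INF m\<in>Meq C F lam. d (mu (r (r' k)) \<omega>) m) < e) sequentially"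
        using e by (rule order_tendstoD)
      then have "eventually (\<lambda>k. indicator (A' (r (r' k))) \<omega> = (0 :: real)) sequentially"
        by eventually_elim (use A'(2) in \<open>fastforce simp: A_def indicator_def\<close>)
      then show ?case by (rule tendsto_eventually)
    qed
  qed (use A' in \<open>auto simp: indicator_def\<close>)
  then have "(\<lambda>n. measure (completion M) (A (r (r' n)))) \<longlonglongrightarrow> 0"
    by (simp add: A'(3) sets.Int_space_eq2[OF A'(1), simplified])
  with r'(1) show "\<exists>r'. strict_mono (r' :: nat \<Rightarrow> nat) \<and> (\<lambda>n. measure (completion M)
      {\<omega> \<in> space M. (INF m\<in>Meq C F lam. d (mu (r (r' n)) \<omega>) m) \<ge> e}) \<longlonglongrightarrow> 0"
    unfolding A_def by blast
qed

text \<open>The law of large numbers for countably many tents leaves a single null set, off which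
  the type distributions converge weakly; the rest is a pathwise argument. The null set concerns the
  types alone, hence lies in \<open>M\<close> itself.\<close>

theorem dist_almost_surely:
  assumes lam: "lam \<in> probs"
    and indep: "\<And>n. n \<ge> 1 \<Longrightarrow> indep_vars (\<lambda>_. borel) (\<lambda>i \<omega>. W n \<omega> i) {..<n}"
    and law: "\<And>n i. i < n \<Longrightarrow> distr M borel (\<lambda>\<omega>. W n \<omega> i) = lam"
    and d: "compat_metric d"
  shows "AE \<omega> in M. (\<lambda>n. INF m\<in>Meq C F lam. d (mu n \<omega>) m) \<longlonglongrightarrow> 0"
proof -
  obtain t :: "nat \<Rightarrow> 'w" where t: "dense_seq t" using ex_dense_seq_second_countable by blast
  have "AE \<omega> in M. (\<lambda>n. (\<Sum>i<n. tent t l (W n \<omega> i)) / n) \<longlonglongrightarrow> integral\<^sup>L lam (tent t l)" for l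
  proof -
    obtain B where B: "\<And>x. \<bar>tent t l x\<bar> \<le> B" using tent_bounded by blast
    show ?thesis
    proof (rule array_SLLN_bounded[where X="\<lambda>n i \<omega>. tent t l (W n \<omega> i)", OF _ B])
      show "indep_vars (\<lambda>_. borel) (\<lambda>i \<omega>. tent t l (W n \<omega> i)) {..<n}" if "n \<ge> 1" for n
        by (rule indep_vars_compose2[OF indep[OF that] borel_tent])
      show "expectation (\<lambda>\<omega>. tent t l (W n \<omega> i)) = integral\<^sup>L lam (tent t l)" if "i < n" for n i
        unfolding law[OF that, symmetric] by (rule integral_distr[symmetric, OF W_coord[OF that] borel_tent])
    qed
  qed
  then have "AE \<omega> in M. \<forall>l. (\<lambda>n. (\<Sum>i<n. tent t l (W n \<omega> i)) / n) \<longlonglongrightarrow> integral\<^sup>L lam (tent t l)"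
    by (subst AE_all_countable) simp
  then show ?thesis using AE_space
  proof eventually_elim
    case (elim \<omega>)
    have "wk_conv (\<lambda>n. muw (Suc n) \<omega>) lam"
    proof (subst wk_conv_iff_tent[OF t muw_probs lam])
      show "\<forall>l. (\<lambda>n. integral\<^sup>L (muw (Suc n) \<omega>) (tent t l)) \<longlonglongrightarrow> integral\<^sup>L lam (tent t l)"
        using elim(1) LIMSEQ_Suc unfolding muw_def integral_empirical[OF borel_tent] by blast
    qed simp
    moreover have "near_nash (\<lambda>n. mu (Suc n) \<omega>)" using elim by (intro near_nash_path filterlim_Suc) auto
    ultimately have "(\<lambda>n. INF m\<in>Meq C F lam. d (mu (Suc n) \<omega>) m) \<longlonglongrightarrow> 0"
      using lam d by (intro near_nash_dist) (simp_all add: distr_mu)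
    then show ?case by (rule LIMSEQ_imp_Suc)
  qed
qed

end

text \<open>Laws are formed under the completion, where \<open>mu n\<close> is measurable, and
  tightness starts at \<open>Suc n\<close> because \<open>empirical 0\<close> has total mass
  \<open>0\<close>.\<close>

theorem theorem3p5:
  fixes C :: "'w::polish_space \<Rightarrow> 'x::metric_space set"
    and F :: "('w \<times> 'x) measure \<Rightarrow> 'w \<Rightarrow> 'x \<Rightarrow> real"
    and eps :: "nat \<Rightarrow> real"
    and xhat :: "nat \<Rightarrow> (nat \<Rightarrow> 'w) \<Rightarrow> nat \<Rightarrow> 'x"
    and M :: "'o measure"
    and W :: "nat \<Rightarrow> 'o \<Rightarrow> nat \<Rightarrow> 'w"
    and mu :: "nat \<Rightarrow> 'o \<Rightarrow> ('w \<times> 'x) measure"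
    and muw :: "nat \<Rightarrow> 'o \<Rightarrow> 'w measure"
    and L :: "nat \<Rightarrow> ('w \<times> 'x) measure measure"
    and Lw :: "nat \<Rightarrow> 'w measure measure"
  assumes X_compact: "compact (UNIV :: 'x set)"
    and C_ne_closed: "\<forall>w. C w \<noteq> {} \<and> closed (C w)"
    and C_graph_closed: "closed {(w, x). x \<in> C w}"
    and C_lower: "\<forall>ws w x. ws \<longlonglongrightarrow> w \<longrightarrow> x \<in> C w \<longrightarrow>
                    (\<exists>r xs. strict_mono r \<and> (\<forall>k. xs k \<in> C (ws (r k))) \<and> xs \<longlonglongrightarrow> x)"
    and F_bounded: "bounded ((\<lambda>(m, w, x). F m w x) ` (probs \<times> UNIV \<times> UNIV))"
    and F_cont: "\<forall>ms m ws w xs x. (\<forall>k. ms k \<in> probs) \<longrightarrow> m \<in> probs \<longrightarrow> wk_conv ms m \<longrightarrow>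
                    ws \<longlonglongrightarrow> w \<longrightarrow> xs \<longlonglongrightarrow> x \<longrightarrow>
                    (\<lambda>k. F (ms k) (ws k) (xs k)) \<longlonglongrightarrow> F m w x"
    and eps_nonneg: "\<forall>n. eps n \<ge> 0"
    and eps_lim: "eps \<longlonglongrightarrow> 0"
    and xhat_nash: "\<forall>n\<ge>1. \<forall>w\<in>space (PiM {..<n} (\<lambda>_. borel)). nash_eq C F (eps n) n w (xhat n w)"
    and xhat_meas: "\<forall>n\<ge>1. \<forall>i<n. univ_meas (PiM {..<n} (\<lambda>_. borel)) (\<lambda>w. xhat n w i) borel"
    and M_prob: "prob_space M"
    and W_meas: "\<forall>n\<ge>1. W n \<in> measurable M (PiM {..<n} (\<lambda>_. borel))"
    and mu_def: "\<forall>n \<omega>. mu n \<omega> = empirical n (\<lambda>i. (W n \<omega> i, xhat n (W n \<omega>) i))"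
    and muw_def: "\<forall>n \<omega>. muw n \<omega> = empirical n (W n \<omega>)"
    and L_def: "\<forall>n. L n = distr (completion M) (prob_algebra borel) (mu n)"
    and Lw_def: "\<forall>n. Lw n = distr (completion M) (prob_algebra borel) (muw n)"
  shows
    "(tight_laws (\<lambda>n. Lw (Suc n)) \<longrightarrow>
        tight_laws (\<lambda>n. L (Suc n)) \<and>
        (\<forall>r Q. strict_mono r \<longrightarrow> law_conv (L \<circ> r) Q \<longrightarrow>
               (AE m in Q. m \<in> Meq C F (distr m borel fst))))
     \<and>
     (\<forall>lam0 \<in> probs. law_conv Lw (return (prob_algebra borel) lam0) \<longrightarrow>
        (\<forall>r Q. strict_mono r \<longrightarrow> law_conv (L \<circ> r) Q \<longrightarrow> (AE m in Q. m \<in> Meq C F lam0)) \<and>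
        (\<forall>d. compat_metric d \<longrightarrow> (\<forall>e>0.
           (\<lambda>n. measure (completion M)
                  {\<omega> \<in> space M. (INF m\<in>Meq C F lam0. d (mu n \<omega>) m) \<ge> e}) \<longlonglongrightarrow> 0)))
     \<and>
     (\<forall>lam0 \<in> probs.
        (\<forall>n\<ge>1. prob_space.indep_vars M (\<lambda>_. borel) (\<lambda>i \<omega>. W n \<omega> i) {..<n} \<and>
                (\<forall>i<n. distr M borel (\<lambda>\<omega>. W n \<omega> i) = lam0)) \<longrightarrow>
        (\<forall>d. compat_metric d \<longrightarrow>
           (AE \<omega> in M. (\<lambda>n. INF m\<in>Meq C F lam0. d (mu n \<omega>) m) \<longlonglongrightarrow> 0)))"
proof -
  have array: "nash_array C F M eps xhat W mu muw L Lw"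
  proof (intro nash_array.intro static_game.intro nash_array_axioms.intro X_compact C_graph_closed F_bounded M_prob eps_lim)
    show "C w \<noteq> {}" for w using C_ne_closed by simp
    show "\<exists>r xs. strict_mono r \<and> (\<forall>k. xs k \<in> C (ws (r k))) \<and> xs \<longlonglongrightarrow> x"
      if "ws \<longlonglongrightarrow> w" "x \<in> C w" for ws w x
      using C_lower that by simp
    show "(\<lambda>k. F (ms k) (ws k) (xs k)) \<longlonglongrightarrow> F m w x"
      if "\<And>k. ms k \<in> probs" "m \<in> probs" "wk_conv ms m" "ws \<longlonglongrightarrow> w" "xs \<longlonglongrightarrow> x" for ms m ws w xs x
      using F_cont that by simp
    show "nash_eq C F (eps n) n w (xhat n w)" if "n \<ge> 1" "w \<in> space (PiM {..<n} (\<lambda>_. borel))" for n w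
      using xhat_nash that by simp
    show "univ_meas (PiM {..<n} (\<lambda>_. borel)) (\<lambda>w. xhat n w i) borel" if "i < n" for n i
      using xhat_meas that by simp
    show "W n \<in> measurable M (PiM {..<n} (\<lambda>_. borel))" if "n \<ge> 1" for n
      using W_meas that by simp
  qed (simp_all add: mu_def muw_def L_def Lw_def)
  interpret A: nash_array C F M eps xhat W mu muw L Lw by (rule array)
  show ?thesis
  proof (intro conjI ballI impI allI)
    fix lam0 and d :: "('w \<times> 'x) measure \<Rightarrow> ('w \<times> 'x) measure \<Rightarrow> real" and e :: real
    assume "lam0 \<in> probs" "law_conv Lw (return (prob_algebra borel) lam0)" "compat_metric d" "0 < e"
    then show "(\<lambda>n. measure (completion M) {\<omega> \<in> space M. (INF m\<in>Meq C F lam0. d (mu n \<omega>) m) \<ge> e}) \<longlonglongrightarrow> 0"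
      by (rule A.dist_in_probability)
  next
    fix lam0 and d :: "('w \<times> 'x) measure \<Rightarrow> ('w \<times> 'x) measure \<Rightarrow> real"
    assume "lam0 \<in> probs" "compat_metric d"
      "\<forall>n\<ge>1. prob_space.indep_vars M (\<lambda>_. borel) (\<lambda>i \<omega>. W n \<omega> i) {..<n} \<and> (\<forall>i<n. distr M borel (\<lambda>\<omega>. W n \<omega> i) = lam0)"
    then show "AE \<omega> in M. (\<lambda>n. INF m\<in>Meq C F lam0. d (mu n \<omega>) m) \<longlonglongrightarrow> 0"
      by (intro A.dist_almost_surely) auto
  qed (rule A.tight_L A.limits_of_tight A.limits_of_deterministic, assumption+)+
qed

end
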